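(* Let $\Theta\subset\mathbb{R}^d$ be closed, convex and bounded, with $\mathcal{D}=\sup_{(\theta,\theta')\in\Theta^2}\|\theta-\theta'\|$, and let $\{P_\theta:\theta\in\Theta\}$ satisfy the regularity conditions (R) of the context. Let $\theta^{(1)},\dots,\theta^{(T)}$ be the iterates of the projected stochastic gradient algorithm described in the context, and $$\hat\theta_n^{(T)}=\frac1T\sum_{t=1}^T\theta^{(t)}.$$ Assume that there is a constant $B>0$ such that for any $\theta\in\Theta$, $\mathbb{E}\left[\|\widehat{\nabla_\theta\mathrm{Crit}}(\theta)\|^2\right]\le B^2$, and that $\mathrm{Crit}$ is a convex function of $\theta$. Then the choice of constant step size $\eta_t=\eta=\mathcal{D}/(B\sqrt T)$ leads to $$\mathbb{E}\left[\mathrm{Crit}(\hat\theta_n^{(T)})-\mathrm{Crit}(\hat\theta_n)\right]\le\frac{\mathcal{D}B}{\sqrt T},$$ where the expectation is taken with respect to the drawings of the $Y_j$'s in the algorithm. Moreover $$\mathbb{E}\left[\mathbb{D}_k\left(P_{\hat\theta_n^{(T)}},P^0\right)\right]\le\inf_{\theta\in\Theta}\mathbb{D}_k(P_\theta,P^0)+3\sqrt{\frac{1+2\sum_{t=1}^n\varrho_t}{n}}+\sqrt{\frac{\mathcal{D}B}{\sqrt T}},$$ where the expectation is taken with respect to the sample and to the $Y_j$'s, and the choice $T=n^2$ leads to $$\mathbb{E}\left[\mathbb{D}_k\left(P_{\hat\theta_n^{(n^2)}},P^0\right)\right]\le\inf_{\theta\in\Theta}\mathbb{D}_k(P_\theta,P^0)+\frac{\sqrt{\mathcal{D}B}+3\sqrt{1+2\sum_{t=1}^n\varrho_t}}{\sqrt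 n}.$$
   Context: $X_1,\dots,X_n$ are observations of a stationary process $(X_t)$ with marginal distribution $P^0$. $k$ is a symmetric positive definite characteristic kernel with $|k|\le1$, reproducing kernel Hilbert space $\mathcal{H}_k$, mean embeddings $\mu_P=\mathbb{E}_{X\sim P}[k(X,\cdot)]$ (characteristic means $P\mapsto\mu_P$ is injective), and $\mathbb{D}_k(P,Q)=\|\mu_P-\mu_Q\|_{\mathcal{H}_k}$. $\hat P_n=\frac1n\sum_{i=1}^n\delta_{X_i}$ and $\hat\theta_n$ is a minimizer (assumed to exist) of $\mathbb{D}_k(P_\theta,\hat P_n)$ over $\theta\in\Theta$. $\varrho_t=\left|\mathbb{E}\left\langle k(X_t,\cdot)-\mu_{P^0},\,k(X_0,\cdot)-\mu_{P^0}\right\rangle_{\mathcal{H}_k}\right|$. The criterion is $$\mathrm{Crit}(\theta)=\mathbb{E}_{X,X'\sim P_\theta}[k(X,X')]-\frac2n\sum_{i=1}^n\mathbb{E}_{X\sim P_\theta}[k(X_i,X)]$$ ($X,X'$ independent), which equals $\mathbb{D}_k^2(P_\theta,\hat P_n)$ up to a term not depending on $\theta$. Conditions (R): each $P_\theta$ has a density $p_\theta$ with respect to Lebesgue measure; for any $x$, $\theta\mapsto p_\theta(x)$ is differentiable with respect to $\theta$; and there is a nonnegative function $g(x,x')$ such that, for any $\theta\in\Theta$, $|k(x,x')\nabla_\theta[p_\theta(x)p_\theta(x')]|\le g(x,x')$, and $\iint g(x,x')\,\mathrm{d}x\,\mathrm{d}x'<\infty$. For an integer $M\ge2$ and $Y_1,\dots,Y_M$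 i.i.d. from $P_\theta$ (given the sample), the stochastic gradient is $$\widehat{\nabla_\theta\mathrm{Crit}}(\theta)=\frac2M\sum_{j=1}^M\left(\frac1{M-1}\sum_{\ell\ne j}k(Y_j,Y_\ell)-\frac1n\sum_{i=1}^nk(X_i,Y_j)\right)\nabla_\theta[\log p_\theta(Y_j)].$$ Algorithm: start from $\theta^{(0)}\in\Theta$; for $t=1,\dots,T$, draw $Y_1,\dots,Y_M$ i.i.d. from $P_{\theta^{(t-1)}}$ and set $\theta^{(t)}=\Pi_\Theta\left\{\theta^{(t-1)}-\eta_t\,\widehat{\nabla_\theta\mathrm{Crit}}(\theta^{(t-1)})\right\}$, where $\Pi_\Theta$ is the orthogonal projection onto $\Theta$ and the stochastic gradient is computed with these $Y_j$'s. *)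

theory Defs
  imports "HOL-Probability.Probability"
begin

section \<open>Kernels, mean embeddings and the maximum mean discrepancy\<close>

definition pos_def_kernel :: "('x \<Rightarrow> 'x \<Rightarrow> real) \<Rightarrow> bool" where
  "pos_def_kernel k \<longleftrightarrow> (\<forall>S c. finite S \<longrightarrow> 0 \<le> (\<Sum>x\<in>S. \<Sum>y\<in>S. c x * c y * k x y))"

text \<open>
  The reproducing kernel Hilbert space of \<open>k\<close> is a Hilbert space whose elements are functions.
  It is represented by a type \<open>'h\<close> (not necessarily separable) with an injective
  map \<open>fn\<close> sending each element to the function that it is. Linearity of \<open>fn\<close> follows from
  the reproducing property.
\<close>

definition is_rkhs ::
  "('h::{real_inner,complete_space} \<Rightarrow> 'x \<Rightarrow> real) \<Rightarrow> ('x \<Rightarrow> 'x \<Rightarrow> real) \<Rightarrow> bool" where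
  "is_rkhs fn k \<longleftrightarrow> inj fn \<and> (\<forall>x. \<exists>h. fn h = k x \<and> (\<forall>f. fn f x = f \<bullet> h))"

text \<open>The element \<open>k(x, \<cdot>)\<close> of the Hilbert space.\<close>

definition kfun ::
  "('h::{real_inner,complete_space} \<Rightarrow> 'x \<Rightarrow> real) \<Rightarrow> ('x \<Rightarrow> 'x \<Rightarrow> real) \<Rightarrow> 'x \<Rightarrow> 'h" where
  "kfun fn k x = inv fn (k x)"

text \<open>
  The Hilbert-space valued expectation of \<open>k(X, \<cdot>)\<close> for \<open>X \<sim> P\<close> is taken in the weak (Pettis)
  sense, because the Bochner integral of the library is restricted to separable spaces;
  the two agree in the separable case.
\<close>

definition mean_embedding ::
  "('h::{real_inner,complete_space} \<Rightarrow> 'x \<Rightarrow> real) \<Rightarrow> ('x \<Rightarrow> 'x \<Rightarrow> real) \<Rightarrow> 'x measure \<Rightarrow> 'h" where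
  "mean_embedding fn k P = (THE m. \<forall>f. m \<bullet> f = (\<integral>x. kfun fn k x \<bullet> f \<partial>P))"

definition characteristic ::
  "('h::{real_inner,complete_space} \<Rightarrow> 'x::topological_space \<Rightarrow> real) \<Rightarrow> ('x \<Rightarrow> 'x \<Rightarrow> real) \<Rightarrow> bool" where
  "characteristic fn k \<longleftrightarrow>
     inj_on (mean_embedding fn k) {P. prob_space P \<and> sets P = sets borel}"

definition mmd ::
  "('h::{real_inner,complete_space} \<Rightarrow> 'x \<Rightarrow> real) \<Rightarrow> ('x \<Rightarrow> 'x \<Rightarrow> real) \<Rightarrow>
   'x measure \<Rightarrow> 'x measure \<Rightarrow> real" where
  "mmd fn k P Q = norm (mean_embedding fn k P - mean_embedding fn k Q)"


section \<open>Observations\<close>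

text \<open>A sample \<open>x\<^sub>1, \<dots>, x\<^sub>n\<close> is a function on \<open>nat\<close> of which only the values at \<open>1, \<dots>, n\<close> matter.\<close>

definition empirical :: "nat \<Rightarrow> (nat \<Rightarrow> 'x::topological_space) \<Rightarrow> 'x measure" where
  "empirical n x = distr (uniform_count_measure {1..n}) borel x"

definition stationary_process :: "'o measure \<Rightarrow> (nat \<Rightarrow> 'o \<Rightarrow> 'x::topological_space) \<Rightarrow> bool" where
  "stationary_process \<Omega> X \<longleftrightarrow>
     (\<forall>t. X t \<in> \<Omega> \<rightarrow>\<^sub>M borel) \<and>
     (\<forall>s. distr \<Omega> (Pi\<^sub>M UNIV (\<lambda>_. borel)) (\<lambda>\<omega> t. X (t + s) \<omega>) =
          distr \<Omega> (Pi\<^sub>M UNIV (\<lambda>_. borel)) (\<lambda>\<omega> t. X t \<omega>))"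

definition rho ::
  "('h::{real_inner,complete_space} \<Rightarrow> 'x \<Rightarrow> real) \<Rightarrow> ('x \<Rightarrow> 'x \<Rightarrow> real) \<Rightarrow> 'x measure \<Rightarrow>
   'o measure \<Rightarrow> (nat \<Rightarrow> 'o \<Rightarrow> 'x) \<Rightarrow> nat \<Rightarrow> real" where
  "rho fn k P0 \<Omega> X t =
     \<bar>\<integral>\<omega>. (kfun fn k (X t \<omega>) - mean_embedding fn k P0) \<bullet>
          (kfun fn k (X 0 \<omega>) - mean_embedding fn k P0) \<partial>\<Omega>\<bar>"


section \<open>The criterion and its stochastic gradient\<close>

definition crit ::
  "('x \<Rightarrow> 'x \<Rightarrow> real) \<Rightarrow> ('a \<Rightarrow> 'x measure) \<Rightarrow> nat \<Rightarrow> (nat \<Rightarrow> 'x) \<Rightarrow> 'a \<Rightarrow> real" where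
  "crit k P n x \<theta> =
     (\<integral>z. k (fst z) (snd z) \<partial>(P \<theta> \<Otimes>\<^sub>M P \<theta>)) - 2 / real n * (\<Sum>i=1..n. \<integral>y. k (x i) y \<partial>P \<theta>)"

text \<open>
  Gradient at \<open>x\<close> of a function that is only given on the convex set \<open>S\<close>. If \<open>S\<close> has nonempty
  interior, the linear span below is the whole space and this is the usual gradient (one-sided at
  the boundary). Otherwise the derivative within \<open>S\<close> only determines the component of the gradient
  along the directions of \<open>S\<close>, and the span condition picks that component.
\<close>

definition gradient_within ::
  "('a::euclidean_space \<Rightarrow> real) \<Rightarrow> 'a \<Rightarrow> 'a set \<Rightarrow> 'a" where
  "gradient_within f x S =
     (THE v. v \<in> span {y - x | y. y \<in> S} \<and> (f has_derivative (\<lambda>h. v \<bullet> h)) (at x within S))"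

text \<open>
  The gradient of the log-density with respect to the parameter, extended by \<open>0\<close> to the
  \<open>P\<^sub>\<theta>\<close>-null set where the logarithm is not defined.
\<close>

definition score ::
  "'a::euclidean_space set \<Rightarrow> ('a \<Rightarrow> 'x \<Rightarrow> real) \<Rightarrow> 'a \<Rightarrow> 'x \<Rightarrow> 'a" where
  "score \<Theta> p \<theta> y = (if p \<theta> y > 0 then gradient_within (\<lambda>t. ln (p t y)) \<theta> \<Theta> else 0)"

definition regularity_conditions ::
  "'a::euclidean_space set \<Rightarrow> ('x::euclidean_space \<Rightarrow> 'x \<Rightarrow> real) \<Rightarrow> ('a \<Rightarrow> 'x measure) \<Rightarrow>
   ('a \<Rightarrow> 'x \<Rightarrow> real) \<Rightarrow> bool" where
  "regularity_conditions \<Theta> k P p \<longleftrightarrow>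
     (\<forall>\<theta>\<in>\<Theta>. p \<theta> \<in> borel_measurable borel \<and> (\<forall>x. 0 \<le> p \<theta> x) \<and>
            P \<theta> = density lborel (\<lambda>x. ennreal (p \<theta> x))) \<and>
     (\<forall>x. (\<lambda>\<theta>. p \<theta> x) differentiable_on \<Theta>) \<and>
     (\<exists>g. (\<forall>x x'. 0 \<le> g x x') \<and>
          integrable (lborel \<Otimes>\<^sub>M lborel) (\<lambda>(x, x'). g x x') \<and>
          (\<forall>\<theta>\<in>\<Theta>. \<forall>x x'.
             norm (k x x' *\<^sub>R gradient_within (\<lambda>t. p t x * p t x') \<theta> \<Theta>) \<le> g x x'))"

definition stoch_grad ::
  "('x \<Rightarrow> 'x \<Rightarrow> real) \<Rightarrow> 'a::euclidean_space set \<Rightarrow> ('a \<Rightarrow> 'x \<Rightarrow> real) \<Rightarrow> nat \<Rightarrow> nat \<Rightarrow>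
   (nat \<Rightarrow> 'x) \<Rightarrow> 'a \<Rightarrow> (nat \<Rightarrow> 'x) \<Rightarrow> 'a" where
  "stoch_grad k \<Theta> p n M x \<theta> y =
     (2 / real M) *\<^sub>R
       (\<Sum>j=1..M. (1 / (real M - 1) * (\<Sum>l\<in>{1..M} - {j}. k (y j) (y l))
                   - 1 / real n * (\<Sum>i=1..n. k (x i) (y j))) *\<^sub>R score \<Theta> p \<theta> (y j))"

definition iid :: "nat \<Rightarrow> 'x measure \<Rightarrow> (nat \<Rightarrow> 'x) measure" where
  "iid M Q = Pi\<^sub>M {1..M} (\<lambda>_. Q)"


section \<open>The projected stochastic gradient algorithm\<close>

text \<open>Sequences in \<open>\<Theta>\<close>.\<close>

definition path_space :: "'a::euclidean_space set \<Rightarrow> (nat \<Rightarrow> 'a) measure" where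
  "path_space \<Theta> = Pi\<^sub>M UNIV (\<lambda>_. restrict_space borel \<Theta>)"

text \<open>
  The conditional law, given the sample \<open>x\<close>, of the trajectory
  \<open>(\<theta>\<^sup>(\<^sup>0\<^sup>), \<dots>, \<theta>\<^sup>(\<^sup>T\<^sup>))\<close> produced by the algorithm, as a Giry-monad program. A trajectory is stored
  as a sequence \<open>w\<close> whose entries after time \<open>T\<close> still have the initial value. In the step, \<open>y\<close> is
  drawn afresh from the \<open>M\<close>-fold product of \<open>P\<close> at the current iterate \<open>w t\<close>.
\<close>

primrec sgd ::
  "('x \<Rightarrow> 'x \<Rightarrow> real) \<Rightarrow> 'a::euclidean_space set \<Rightarrow> ('a \<Rightarrow> 'x measure) \<Rightarrow> ('a \<Rightarrow> 'x \<Rightarrow> real) \<Rightarrow>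
   nat \<Rightarrow> nat \<Rightarrow> (nat \<Rightarrow> real) \<Rightarrow> 'a \<Rightarrow> (nat \<Rightarrow> 'x) \<Rightarrow> nat \<Rightarrow> (nat \<Rightarrow> 'a) measure" where
  "sgd k \<Theta> P p n M \<eta> \<theta>0 x 0 = return (path_space \<Theta>) (\<lambda>_. \<theta>0)"
| "sgd k \<Theta> P p n M \<eta> \<theta>0 x (Suc t) =
     sgd k \<Theta> P p n M \<eta> \<theta>0 x t \<bind>
       (\<lambda>w. distr (iid M (P (w t))) (path_space \<Theta>)
              (\<lambda>y. w(Suc t := closest_point \<Theta> (w t - \<eta> (Suc t) *\<^sub>R stoch_grad k \<Theta> p n M x (w t) y))))"

definition average_iterate :: "nat \<Rightarrow> (nat \<Rightarrow> 'a::real_vector) \<Rightarrow> 'a" where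
  "average_iterate T w = (1 / real T) *\<^sub>R (\<Sum>t=1..T. w t)"

text \<open>The expectation exists and is at most \<open>c\<close>. Integrability is required because the Bochner integral is \<open>0\<close> by convention
  for a non-integrable function.\<close>

definition has_expectation_le :: "'b measure \<Rightarrow> ('b \<Rightarrow> real) \<Rightarrow> real \<Rightarrow> bool" where
  "has_expectation_le N f c \<longleftrightarrow> integrable N f \<and> (\<integral>w. f w \<partial>N) \<le> c"

end

theory Submission
  imports Defs
begin

text \<open>
  The update is projected stochastic gradient descent for the convex function \<open>Crit\<close>, so the classical regret
  argument applies as soon as the expected stochastic gradient at \<open>a\<close> is a subgradient of \<open>Crit\<close> on \<open>\<Theta>\<close>. This is
  the delicate point: a density may vanish at \<open>a\<close> with nonzero one-sided derivative, where the score is \<open>0\<close>, and (R)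
  does not dominate the derivative of the linear term of \<open>Crit\<close>. Along the segment from \<open>a\<close> to \<open>b\<close>, the bound on
  the second moment of the stochastic gradient bounds the \<open>L\<^sup>1\<close> norm of that derivative uniformly (so the fundamental
  theorem of calculus holds under the integral) and, by Cauchy-Schwarz, makes the contribution of any set of small
  \<open>P\<^sub>\<theta>\<close>-measure uniformly small. Hence only sets on which differentiation at \<open>a\<close> is trivially dominated matter.

  The bounds for the maximum mean discrepancy follow from the triangle inequality through the empirical measure,
  Jensen's inequality, and the expansion of \<open>\<parallel>\<mu>\<^bsub>emp\<^esub> - \<mu>\<^bsub>P0\<^esub>\<parallel>\<^sup>2\<close> into covariances.
\<close>

text \<open>The regret argument needs less than an unbiased gradient: the inequality
  E[ghat(a) . (b - a)] \<le> Crit(b) - Crit(a) suffices, and one-sided information suffices for it.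
  Convexity bounds secant slopes from a by the total increment, so what is wanted is a lower bound
  for increments of Crit near a. An interior zero of the density along the segment is a minimum, so
  the score loses no derivative there and the end point a is the only bad one. The increment is
  therefore an integral over interior points; its integrand is truncated to a set E up to a uniform
  error, and only the truncated increment is differentiated at a. The bound on the derivative of the
  linear term comes from the symmetric form of the stochastic gradient. Its quadratic part is
  controlled by (R), so the second moment also controls the sum of the M linear contributions;
  independence and a sign test pass from that sum to a single summand.\<close>

section \<open>Mean embeddings\<close>

text \<open>The midpoint of two members of S again has norm at least \<open>d\<close>, so the
  parallelogram law makes a minimizing sequence Cauchy. The point is used twice: for the Riesz
  representation, and to project an element of the RKHS onto a closed subspace.\<close>

lemma min_norm_point:
  fixes S :: "'h::{real_inner,complete_space} set"
  assumes S: "closed S" "convex S" "S \<noteq> {}"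
  shows "\<exists>z\<in>S. \<forall>y\<in>S. norm z \<le> norm y"
proof -
  define d where "d = (INF y\<in>S. norm y)"
  have bdd: "bdd_below (norm ` S)" by (intro bdd_belowI[of _ 0]) auto
  have d_le: "d \<le> norm y" if "y \<in> S" for y
    unfolding d_def using that by (intro cINF_lower bdd)
  have d0: "0 \<le> d" unfolding d_def using S by (intro cINF_greatest) auto
  have "\<exists>y\<in>S. norm y < d + 1 / real (Suc n)" for n
    using cInf_lessD[of "norm ` S" "d + 1 / real (Suc n)"] S by (auto simp: d_def)
  then obtain z where z: "\<And>n. z n \<in> S" "\<And>n. norm (z n) < d + 1 / real (Suc n)" by metis
  have lim: "(\<lambda>n. (d + 1 / real (Suc n))\<^sup>2) \<longlonglongrightarrow> (d + 0)\<^sup>2"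
    by (intro tendsto_intros LIMSEQ_Suc lim_inverse_n'[THEN LIMSEQ_Suc])
  have par: "(norm (z m - z n))\<^sup>2 \<le> 2 * (d + 1 / real (Suc m))\<^sup>2 + 2 * (d + 1 / real (Suc n))\<^sup>2 - 4 * d\<^sup>2" for m n
  proof -
    have "(1/2) *\<^sub>R z m + (1/2) *\<^sub>R z n \<in> S" using S(2) z(1) by (intro convexD) auto
    then have 1: "d\<^sup>2 \<le> (norm ((1/2) *\<^sub>R z m + (1/2) *\<^sub>R z n))\<^sup>2" using d0 d_le by (intro power_mono) auto
    have 2: "(norm (z m - z n))\<^sup>2 = 2 * (norm (z m))\<^sup>2 + 2 * (norm (z n))\<^sup>2 - 4 * (norm ((1/2) *\<^sub>R z m + (1/2) *\<^sub>R z n))\<^sup>2"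
      unfolding power2_norm_eq_inner by (simp add: inner_simps inner_commute)
    have sq: "(norm (z i))\<^sup>2 \<le> (d + 1 / real (Suc i))\<^sup>2" for i
      using z(2)[of i] by (intro power_mono) auto
    have gen: "x \<le> 2 * A + 2 * A' - 4 * D" if "D \<le> c" "x = 2 * a + 2 * b - 4 * c" "a \<le> A" "b \<le> A'"
      for a b c x A A' D :: real using that by (simp add: algebra_simps)
    show ?thesis by (rule gen[OF 1 2 sq sq])
  qed
  have "Cauchy z"
  proof (rule metric_CauchyI)
    fix e :: real assume e: "e > 0"
    then have "0 < e\<^sup>2 / 4" by simp
    from LIMSEQ_D[OF lim this]
    obtain N where N: "\<forall>n\<ge>N. \<bar>(d + 1 / real (Suc n))\<^sup>2 - d\<^sup>2\<bar> < e\<^sup>2 / 4" by auto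
    show "\<exists>N. \<forall>m\<ge>N. \<forall>n\<ge>N. dist (z m) (z n) < e"
    proof (intro exI allI impI)
      fix m n assume "m \<ge> N" "n \<ge> N"
      then have "(norm (z m - z n))\<^sup>2 < e\<^sup>2" using par[of m n] N[rule_format, of m] N[rule_format, of n] unfolding abs_less_iff by linarith
      then show "dist (z m) (z n) < e" using e by (simp add: dist_norm power_less_imp_less_base)
    qed
  qed
  then obtain l where l: "z \<longlonglongrightarrow> l" using Cauchy_convergent convergent_def by blast
  have "l \<in> S" using closed_sequentially[OF S(1) _ l] z(1) by auto
  moreover have "norm l \<le> d + 0"
  proof (rule LIMSEQ_le)
    show "(\<lambda>n. norm (z n)) \<longlonglongrightarrow> norm l" by (intro tendsto_norm l)
    show "(\<lambda>n. d + 1 / real (Suc n)) \<longlonglongrightarrow> d + 0"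
      by (intro tendsto_intros lim_inverse_n'[THEN LIMSEQ_Suc])
    show "\<exists>N. \<forall>n\<ge>N. norm (z n) \<le> d + 1 / real (Suc n)"
      by (intro exI allI impI less_imp_le z(2))
  qed
  ultimately show ?thesis using order_trans[OF _ d_le, of "norm l"] by (intro bexI[of _ l]) auto
qed

text \<open>The \<open>t\<close> chosen below minimizes the quadratic |z + t v|^2. Its value there
  is |z|^2 - (z . v)^2 / |v|^2, which the hypothesis forbids to be less than |z|^2.\<close>

lemma min_norm_orthogonal:
  fixes z v :: "'h::real_inner"
  assumes "\<And>t. norm z \<le> norm (z + t *\<^sub>R v)"
  shows "z \<bullet> v = 0"
proof (cases "v = 0")
  case False
  define t where "t = - (z \<bullet> v) / (v \<bullet> v)"
  have vv: "v \<bullet> v > 0" using False by simp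
  have "(norm z)\<^sup>2 \<le> (norm (z + t *\<^sub>R v))\<^sup>2" using assms by (intro power_mono) auto
  also have "\<dots> = (norm z)\<^sup>2 + 2 * t * (z \<bullet> v) + t\<^sup>2 * (v \<bullet> v)"
    unfolding power2_norm_eq_inner by (simp add: inner_simps inner_commute power2_eq_square)
  also have "t\<^sup>2 * (v \<bullet> v) = - t * (z \<bullet> v)"
    using False by (simp add: t_def power2_eq_square)
  also have "(norm z)\<^sup>2 + 2 * t * (z \<bullet> v) + - t * (z \<bullet> v) = (norm z)\<^sup>2 + t * (z \<bullet> v)" by simp
  also have "t * (z \<bullet> v) = - ((z \<bullet> v)\<^sup>2 / (v \<bullet> v))"
    by (simp add: t_def power2_eq_square)
  finally have "(z \<bullet> v)\<^sup>2 / (v \<bullet> v) \<le> 0" by simp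
  then show ?thesis using vv by (simp add: divide_le_0_iff)
qed simp

text \<open>A point \<open>z\<close> of least norm on the hyperplane l = 1 is orthogonal to the
  kernel of \<open>l\<close>, and f - l(f) z lies in that kernel. Hence z . f = l(f) |z|^2, and
  rescaling by 1 / |z|^2 gives the representer.\<close>

lemma riesz_representation:
  fixes l :: "'h::{real_inner,complete_space} \<Rightarrow> real"
  assumes l: "bounded_linear l"
  shows "\<exists>m. \<forall>f. m \<bullet> f = l f"
proof (cases "\<forall>f. l f = 0")
  case True
  then show ?thesis by (intro exI[of _ 0]) simp
next
  case False
  interpret bounded_linear l by fact
  obtain f0 where f0: "l f0 \<noteq> 0" using False by auto
  define S where "S = l -` {1}"
  have "closed S" unfolding S_def
    by (rule closed_vimage[OF closed_singleton linear_continuous_on[OF l]])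
  moreover have "convex S" unfolding S_def by (rule convexI) (simp add: add scaleR)
  moreover have "(1 / l f0) *\<^sub>R f0 \<in> S" using f0 by (simp add: S_def scaleR)
  then have "S \<noteq> {}" by blast
  ultimately obtain z where "z \<in> S" "\<forall>y\<in>S. norm z \<le> norm y"
    using min_norm_point by blast
  then have z: "l z = 1" "\<And>y. l y = 1 \<Longrightarrow> norm z \<le> norm y" by (auto simp: S_def)
  have z0: "z \<bullet> z \<noteq> 0" using z(1) zero by auto
  have orth: "z \<bullet> (f - l f *\<^sub>R z) = 0" for f
    by (rule min_norm_orthogonal, rule z(2)) (simp add: add scaleR diff z(1))
  have zf: "z \<bullet> f = l f * (z \<bullet> z)" for f
    using orth[of f] by (simp add: inner_diff_right)
  have "((1 / (z \<bullet> z)) *\<^sub>R z) \<bullet> f = l f" for f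
    using z0 by (simp only: inner_scaleR_left zf[of f]) simp
  then show ?thesis by blast
qed

text \<open>Nonnegativity of the variance; the uniform bound supplies the integrability of f and of
  its square.\<close>

lemma power2_expectation_le:
  assumes "prob_space N" "f \<in> borel_measurable N" "\<And>w. w \<in> space N \<Longrightarrow> \<bar>f w\<bar> \<le> C"
  shows "(\<integral>w. f w \<partial>N)\<^sup>2 \<le> (\<integral>w. (f w)\<^sup>2 \<partial>N :: real)"
proof -
  interpret prob_space N by fact
  have [measurable]: "f \<in> borel_measurable N" by fact
  have i: "integrable N f" using assms by (intro integrable_const_bound[where B=C]) auto
  have i2: "integrable N (\<lambda>w. (f w)\<^sup>2)"
  proof (rule integrable_const_bound[where B="C\<^sup>2"])
    have "(f w)\<^sup>2 \<le> C\<^sup>2" if "w \<in> space N" for w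
      using power_mono[OF assms(3)[OF that], of 2] by simp
    then show "AE w in N. norm ((f w)\<^sup>2) \<le> C\<^sup>2" by auto
  qed auto
  show ?thesis using variance_eq[OF i i2] variance_positive[of f] by simp
qed

locale rkhs_kernel =
  fixes k :: "'x::{second_countable_topology,topological_space} \<Rightarrow> 'x \<Rightarrow> real"
    and fn :: "'h::{real_inner,complete_space} \<Rightarrow> 'x \<Rightarrow> real"
  assumes k_measurable[measurable]: "(\<lambda>(x, y). k x y) \<in> borel_measurable (borel \<Otimes>\<^sub>M borel)"
    and k_bounded: "\<And>x y. \<bar>k x y\<bar> \<le> 1"
    and rkhs: "is_rkhs fn k"
begin

abbreviation "K \<equiv> kfun fn k"

lemma k_measurable_comp[measurable (raw)]:
  assumes [measurable]: "f \<in> borel_measurable M" "g \<in> borel_measurable M"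
  shows "(\<lambda>x. k (f x) (g x)) \<in> borel_measurable M"
proof -
  show ?thesis
    using measurable_compose[OF measurable_Pair[OF assms] k_measurable] by simp
qed

lemma inj_fn: "inj fn" using rkhs by (simp add: is_rkhs_def)

text \<open>The element that \<open>is_rkhs\<close> provides at x is unique by injectivity of
  \<open>fn\<close>, so it is the one that \<open>inv fn\<close> picks.\<close>

lemma fn_K: "fn (K x) = k x" and fn_inner: "fn f x = f \<bullet> K x"
proof -
  obtain h where h: "fn h = k x" "\<And>f. fn f x = f \<bullet> h" using rkhs by (auto simp: is_rkhs_def)
  have "K x = h" unfolding kfun_def h(1)[symmetric] using inj_fn by simp
  then show "fn (K x) = k x" "fn f x = f \<bullet> K x" using h by auto
qed

lemma K_inner: "K x \<bullet> K y = k x y"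
  using fn_inner[of "K x" y] by (simp add: fn_K)

lemma norm_K: "norm (K x) \<le> 1"
  using k_bounded[of x x] by (simp add: norm_eq_sqrt_inner K_inner)

lemma K_inner_le: "\<bar>K x \<bullet> f\<bar> \<le> norm f"
  using Cauchy_Schwarz_ineq2[of "K x" f] mult_left_le[OF norm_K[of x], of "norm f"] by (simp add: mult.commute)

text \<open>The measurable elements form a closed subspace containing every \<open>k(x, \<cdot>)\<close>, hence are everything.\<close>

lemma fn_measurable[measurable]: "fn f \<in> borel_measurable borel"
proof (rule ccontr)
  assume f: "fn f \<notin> borel_measurable borel"
  define V where "V = {g. fn g \<in> borel_measurable borel}"
  have fnadd: "fn (g + c *\<^sub>R h) = (\<lambda>x. fn g x + c * fn h x)" for g h c
    by (auto simp: fn_inner inner_simps)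
  have V: "g + c *\<^sub>R h \<in> V" if "g \<in> V" "h \<in> V" for g h c
    using that unfolding V_def mem_Collect_eq fnadd
    by (intro borel_measurable_add borel_measurable_times borel_measurable_const)
  have "closed V"
    unfolding closed_sequential_limits
  proof safe
    fix u l assume u: "\<forall>n. u n \<in> V" "u \<longlonglongrightarrow> l"
    \<comment> \<open>Norm convergence gives pointwise convergence, by pairing with
      \<open>K x\<close>.\<close>
    have lim: "(\<lambda>n. fn (u n) x) \<longlonglongrightarrow> fn l x" for x
      using tendsto_inner[OF u(2) tendsto_const, of "K x"] by (simp add: fn_inner)
    have "fn (u n) \<in> borel_measurable borel" for n using u(1) unfolding V_def by blast
    from borel_measurable_LIMSEQ_real[OF lim this]
    have "fn l \<in> borel_measurable borel" .
    then show "l \<in> V" unfolding V_def by blast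
  qed
  \<comment> \<open>Translating by \<open>f\<close> turns the projection of \<open>f\<close> onto
    the subspace \<open>V\<close> into a least-norm problem. The minimizer f + v is orthogonal to
    every \<open>K x\<close>, hence vanishes as a function, and f = -v lies in
    \<open>V\<close>.\<close>
  define S where "S = (+) f ` V"
  have "closed S" unfolding S_def using \<open>closed V\<close> by (rule closed_translation)
  moreover have "convex S"
  proof -
    have "convex V" unfolding convex_alt
    proof safe
      fix x y u assume "x \<in> V" "y \<in> V"
      then have "x + u *\<^sub>R (y + (-1) *\<^sub>R x) \<in> V" by (intro V)
      then show "(1 - u) *\<^sub>R x + u *\<^sub>R y \<in> V" by (simp add: algebra_simps)
    qed
    then show ?thesis unfolding S_def by (rule convex_translation)
  qed
  moreover have KV: "K x \<in> V" for x
  proof -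
    have "(\<lambda>y. k x y) \<in> borel_measurable borel" by measurable
    then show ?thesis unfolding V_def mem_Collect_eq fn_K .
  qed
  then have "S \<noteq> {}" by (auto simp: S_def)
  ultimately have "\<exists>z\<in>S. \<forall>y\<in>S. norm z \<le> norm y" by (rule min_norm_point)
  then obtain z where z: "z \<in> S" and z_le: "\<forall>y\<in>S. norm z \<le> norm y" by blast
  from z obtain v where v: "v \<in> V" "z = f + v" unfolding S_def by blast
  have "z \<bullet> K x = 0" for x
  proof (rule min_norm_orthogonal)
    fix t
    have "f + (v + t *\<^sub>R K x) \<in> S" unfolding S_def by (intro imageI V v(1) KV)
    then show "norm z \<le> norm (z + t *\<^sub>R K x)" using z_le by (simp add: v(2) add.assoc)
  qed
  then have "fn z = fn 0" by (intro ext) (simp add: fn_inner)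
  then have "z = 0" by (rule injD[OF inj_fn])
  then have "f = 0 + (-1) *\<^sub>R v" using v(2) by (simp add: eq_neg_iff_add_eq_0)
  moreover have "0 \<in> V" using V[OF KV KV, of undefined "-1" undefined] by simp
  ultimately have "f \<in> V" using V[OF _ v(1)] by blast
  then show False using f unfolding V_def by blast
qed

lemma K_inner_measurable[measurable (raw)]:
  assumes "g \<in> borel_measurable M"
  shows "(\<lambda>x. f \<bullet> K (g x)) \<in> borel_measurable M" "(\<lambda>x. K (g x) \<bullet> f) \<in> borel_measurable M"
proof -
  show "(\<lambda>x. f \<bullet> K (g x)) \<in> borel_measurable M"
    using measurable_compose[OF assms fn_measurable] by (simp only: fn_inner)
  then show "(\<lambda>x. K (g x) \<bullet> f) \<in> borel_measurable M"
    by (simp only: inner_commute)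
qed

definition is_law :: "'x measure \<Rightarrow> bool" where
  "is_law P \<longleftrightarrow> prob_space P \<and> sets P = sets borel"

lemma is_law_integrable:
  assumes "is_law P" shows "integrable P (\<lambda>x. K x \<bullet> f)"
proof -
  interpret prob_space P using assms by (simp add: is_law_def)
  have [measurable_cong]: "sets P = sets borel" using assms by (simp add: is_law_def)
  show ?thesis
    by (rule integrable_const_bound[where B="norm f"]) (auto simp: K_inner_le)
qed

text \<open>Since |K x| \<le> 1, f |-> E[f(X)] is a bounded functional, and its Riesz representer is
  the weak integral. Two representers differ by a vector orthogonal to itself, so the definite
  description is legitimate.\<close>

lemma mean_embedding:
  assumes P: "is_law P"
  shows "mean_embedding fn k P \<bullet> f = (\<integral>x. K x \<bullet> f \<partial>P)"
proof -
  interpret prob_space P using P by (simp add: is_law_def)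
  note i = is_law_integrable[OF P]
  have "bounded_linear (\<lambda>f. \<integral>x. K x \<bullet> f \<partial>P)"
  proof (rule bounded_linear_intro[where K=1])
    fix f
    have "\<bar>\<integral>x. K x \<bullet> f \<partial>P\<bar> \<le> (\<integral>x. \<bar>K x \<bullet> f\<bar> \<partial>P)" by (rule integral_abs_bound)
    also have "\<dots> \<le> (\<integral>x. norm f \<partial>P)"
      using i by (intro integral_mono) (auto simp: K_inner_le)
    finally show "norm (\<integral>x. K x \<bullet> f \<partial>P) \<le> norm f * 1" by (simp add: prob_space)
  qed (simp_all add: inner_simps i)
  then obtain m where m: "\<forall>f. m \<bullet> f = (\<integral>x. K x \<bullet> f \<partial>P)"
    using riesz_representation by blast
  have "mean_embedding fn k P = m"
    unfolding mean_embedding_def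
  proof (rule the_equality)
    show "\<forall>f. m \<bullet> f = (\<integral>x. K x \<bullet> f \<partial>P)" by (rule m)
  next
    fix m' assume "\<forall>f. m' \<bullet> f = (\<integral>x. K x \<bullet> f \<partial>P)"
    then have "(m' - m) \<bullet> (m' - m) = 0" using m by (simp add: inner_diff_left)
    then show "m' = m" by simp
  qed
  then show ?thesis using m by simp
qed

lemma mean_embedding_eqI:
  assumes "is_law P" "\<And>f. m \<bullet> f = (\<integral>x. K x \<bullet> f \<partial>P)"
  shows "mean_embedding fn k P = m"
proof -
  have "(mean_embedding fn k P - m) \<bullet> (mean_embedding fn k P - m) = 0"
    using assms by (simp add: inner_diff_left mean_embedding)
  then show ?thesis by simp
qed

lemma mean_embedding_inner:
  assumes "is_law P" "is_law Q"
  shows "mean_embedding fn k P \<bullet> mean_embedding fn k Q = (\<integral>z. k (fst z) (snd z) \<partial>(P \<Otimes>\<^sub>M Q))"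
proof -
  interpret P: prob_space P using assms by (simp add: is_law_def)
  interpret Q: prob_space Q using assms by (simp add: is_law_def)
  interpret PQ: pair_prob_space P Q ..
  have [measurable_cong]: "sets P = sets borel" "sets Q = sets borel" using assms by (auto simp: is_law_def)
  have i: "integrable (P \<Otimes>\<^sub>M Q) (\<lambda>z. k (fst z) (snd z))"
    by (rule PQ.integrable_const_bound[where B=1]) (auto simp: k_bounded)
  have "mean_embedding fn k P \<bullet> mean_embedding fn k Q = (\<integral>x. (\<integral>y. k x y \<partial>Q) \<partial>P)"
  proof -
    have "K x \<bullet> mean_embedding fn k Q = (\<integral>y. k x y \<partial>Q)" for x
    proof -
      have "K x \<bullet> mean_embedding fn k Q = (\<integral>y. K y \<bullet> K x \<partial>Q)"
        by (subst inner_commute) (rule mean_embedding[OF assms(2)])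
      also have "\<dots> = (\<integral>y. k x y \<partial>Q)"
        by (intro Bochner_Integration.integral_cong) (simp_all add: inner_commute K_inner[symmetric])
      finally show ?thesis .
    qed
    then show ?thesis by (simp add: mean_embedding[OF assms(1)])
  qed
  also have "\<dots> = (\<integral>x. (\<integral>y. k (fst (x, y)) (snd (x, y)) \<partial>Q) \<partial>P)" by simp
  also have "\<dots> = (\<integral>z. k (fst z) (snd z) \<partial>(P \<Otimes>\<^sub>M Q))"
    by (rule PQ.integral_fst'[OF i])
  finally show ?thesis .
qed

text \<open>Testing the embedding m against itself gives |m|^2 = E[K(X) . m] \<le> |m|.\<close>

lemma norm_mean_embedding_le:
  assumes "is_law P" shows "norm (mean_embedding fn k P) \<le> 1"
proof -
  let ?m = "mean_embedding fn k P"
  interpret prob_space P using assms by (simp add: is_law_def)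
  have "(norm ?m)\<^sup>2 = (\<integral>x. K x \<bullet> ?m \<partial>P)"
    by (simp add: power2_norm_eq_inner mean_embedding[OF assms])
  also have "\<dots> \<le> (\<integral>x. norm ?m \<partial>P)"
    using is_law_integrable[OF assms] K_inner_le[of _ ?m]
    by (intro integral_mono) (auto intro: order_trans[OF abs_ge_self])
  finally have "norm ?m * norm ?m \<le> norm ?m" by (simp add: prob_space power2_eq_square)
  then show ?thesis by (cases "norm ?m = 0") (auto simp: mult_le_cancel_left1)
qed

lemma mmd_le_2: "is_law P \<Longrightarrow> is_law Q \<Longrightarrow> mmd fn k P Q \<le> 2"
  unfolding mmd_def using norm_triangle_ineq4[of "mean_embedding fn k P" "mean_embedding fn k Q"]
    norm_mean_embedding_le[of P] norm_mean_embedding_le[of Q] by linarith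

lemma mmd_nonneg: "0 \<le> mmd fn k P Q" by (simp add: mmd_def)

lemma mmd_triangle: "mmd fn k P R \<le> mmd fn k P Q + mmd fn k Q R"
  unfolding mmd_def by (rule order_trans[OF _ norm_triangle_ineq]) simp

lemma mmd_sym: "mmd fn k P Q = mmd fn k Q P"
  unfolding mmd_def by (rule norm_minus_commute)

lemma mmd_power2:
  "(mmd fn k P Q)\<^sup>2 = mean_embedding fn k P \<bullet> mean_embedding fn k P
    - 2 * (mean_embedding fn k P \<bullet> mean_embedding fn k Q) + mean_embedding fn k Q \<bullet> mean_embedding fn k Q"
  unfolding mmd_def power2_norm_eq_inner by (simp add: inner_simps inner_commute)

section \<open>Empirical measures and their distance to the marginal law\<close>

lemma is_law_empirical:
  assumes "n \<ge> 1" shows "is_law (empirical n x)"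
proof -
  have "prob_space (uniform_count_measure {1..n})"
    using assms by (intro prob_space_uniform_count_measure) auto
  then show ?thesis
    unfolding is_law_def empirical_def
    by (auto intro!: prob_space.prob_space_distr simp: measurable_def space_uniform_count_measure)
qed

lemma mean_embedding_empirical:
  assumes n: "n \<ge> 1"
  shows "mean_embedding fn k (empirical n x) = (1 / real n) *\<^sub>R (\<Sum>i=1..n. K (x i))"
proof (rule mean_embedding_eqI[OF is_law_empirical[OF n]])
  fix f
  have "(\<integral>x. K x \<bullet> f \<partial>empirical n x) = (\<integral>i. K (x i) \<bullet> f \<partial>uniform_count_measure {1..n})"
    unfolding empirical_def
    by (intro integral_distr K_inner_measurable measurable_ident) (auto simp: measurable_def space_uniform_count_measure)
  also have "\<dots> = (\<Sum>i=1..n. K (x i) \<bullet> f) / real n"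
    unfolding uniform_count_measure_def
    by (subst lebesgue_integral_point_measure_finite) (auto simp: sum_divide_distrib)
  finally show "((1 / real n) *\<^sub>R (\<Sum>i=1..n. K (x i))) \<bullet> f = (\<integral>x. K x \<bullet> f \<partial>empirical n x)"
    by (simp add: inner_sum_left)
qed

text \<open>Differences of the criterion are thus differences of squared distances to the empirical
  measure; this is the only link between the optimization and the statistical bound.\<close>

lemma mmd_empirical_crit:
  assumes n: "n \<ge> 1" and P: "is_law (P \<theta>)"
  shows "(mmd fn k (P \<theta>) (empirical n x))\<^sup>2 =
    crit k P n x \<theta> + (norm (mean_embedding fn k (empirical n x)))\<^sup>2"
proof -
  have "mean_embedding fn k (P \<theta>) \<bullet> mean_embedding fn k (empirical n x) =
    (1 / real n) * (\<Sum>i=1..n. mean_embedding fn k (P \<theta>) \<bullet> K (x i))"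
    by (simp add: mean_embedding_empirical[OF n] inner_sum_right)
  also have "(\<Sum>i=1..n. mean_embedding fn k (P \<theta>) \<bullet> K (x i)) = (\<Sum>i=1..n. \<integral>y. k (x i) y \<partial>P \<theta>)"
    unfolding mean_embedding[OF P]
    by (intro sum.cong Bochner_Integration.integral_cong) (simp_all add: inner_commute K_inner[symmetric])
  finally show ?thesis
    unfolding mmd_power2 crit_def by (simp add: mean_embedding_inner P power2_norm_eq_inner)
qed

text \<open>Stationarity makes the covariance of the centred features depend on the lag alone. A row
  of the n x n covariance matrix contains one diagonal entry and each lag at most twice, whence 1 +
  2 \<Sum> rho; summing n rows leaves one factor n of the normalization 1 / n^2.\<close>

lemma expected_mmd_empirical:
  fixes \<Omega> :: "'o measure" and X :: "nat \<Rightarrow> 'o \<Rightarrow> 'x"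
  assumes \<Omega>: "prob_space \<Omega>" and stat: "stationary_process \<Omega> X"
    and marg: "\<And>t. distr \<Omega> borel (X t) = P0" and n: "n \<ge> 1"
  shows "(\<lambda>\<omega>. mmd fn k (empirical n (\<lambda>i. X i \<omega>)) P0) \<in> borel_measurable \<Omega>"
    and "(\<integral>\<omega>. mmd fn k (empirical n (\<lambda>i. X i \<omega>)) P0 \<partial>\<Omega>) \<le>
      sqrt ((1 + 2 * (\<Sum>t=1..n. rho fn k P0 \<Omega> X t)) / real n)"
proof -
  interpret prob_space \<Omega> by fact
  have X[measurable]: "X t \<in> borel_measurable \<Omega>" for t using stat by (simp add: stationary_process_def)
  have P0: "is_law P0"
    unfolding is_law_def marg[of 0, symmetric] by (auto intro!: prob_space_distr)
  define \<mu> where "\<mu> = mean_embedding fn k P0"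
  define c where "c x y = (K x - \<mu>) \<bullet> (K y - \<mu>)" for x y
  have c_eq: "c x y = k x y - K x \<bullet> \<mu> - K y \<bullet> \<mu> + \<mu> \<bullet> \<mu>" for x y
    by (simp add: c_def inner_simps K_inner inner_commute)
  have c_sym: "c x y = c y x" for x y by (simp add: c_def inner_commute)
  have c_meas[measurable (raw)]: "(\<lambda>x. c (f x) (g x)) \<in> borel_measurable M"
    if [measurable]: "f \<in> borel_measurable M" "g \<in> borel_measurable M" for f g and M :: "'c measure"
    unfolding c_eq by measurable
  have c_bound: "\<bar>c x y\<bar> \<le> 4" for x y
  proof -
    have 1: "norm (K x - \<mu>) \<le> 2" for x
      using norm_triangle_ineq4[of "K x" \<mu>] norm_K[of x] norm_mean_embedding_le[OF P0] unfolding \<mu>_def by linarith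
    have "\<bar>c x y\<bar> \<le> norm (K x - \<mu>) * norm (K y - \<mu>)" unfolding c_def by (rule Cauchy_Schwarz_ineq2)
    also have "\<dots> \<le> 2 * 2" using 1 by (intro mult_mono) auto
    finally show ?thesis by simp
  qed
  have c_int: "integrable \<Omega> (\<lambda>\<omega>. c (X i \<omega>) (X j \<omega>))" for i j
    by (intro integrable_const_bound[where B=4]) (auto simp: c_bound)
  define e where "e i j = (\<integral>\<omega>. c (X i \<omega>) (X j \<omega>) \<partial>\<Omega>)" for i j
  define r where "r t = rho fn k P0 \<Omega> X t" for t
  have r_e: "r t = \<bar>e t 0\<bar>" for t by (simp add: r_def rho_def e_def c_def \<mu>_def)
  have r0: "0 \<le> r t" for t by (simp add: r_e)
  have shift: "e (i + d) i = e d 0" for i d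
  proof -
    let ?S = "\<lambda>s. distr \<Omega> (Pi\<^sub>M UNIV (\<lambda>_. borel)) (\<lambda>\<omega> t. X (t + s) \<omega>)"
    \<comment> \<open>The covariance is read off from the law of the whole shifted path, which is
      the object that \<open>stationary_process\<close> compares.\<close>
    have A: "(\<integral>w. c (w d) (w 0) \<partial>?S s) = e (d + s) s" for s
      unfolding e_def by (subst integral_distr) (auto intro!: measurable_PiM_single')
    have B: "?S i = ?S 0" using stat by (simp add: stationary_process_def)
    have "e (d + i) i = e (d + 0) 0" by (simp only: A[symmetric] B)
    then show ?thesis by (simp add: add.commute)
  qed
  have e_le: "e i j \<le> r (if i \<le> j then j - i else i - j)" for i j
    using shift[of i "j - i"] shift[of j "i - j"] abs_ge_self[of "e (j - i) 0"] abs_ge_self[of "e (i - j) 0"]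
    by (auto simp: r_e e_def c_sym[of "X i _" "X j _"])
  \<comment> \<open>The diagonal is a variance, E[k(X, X)] - |\<mu>|^2 \<le> 1. The cruder pointwise
    bound 4 on \<open>c\<close> serves integrability only.\<close>
  have diag: "e i i \<le> 1" for i
  proof -
    have "e i i = (\<integral>x. c x x \<partial>P0)"
      unfolding e_def marg[of i, symmetric] by (subst integral_distr) auto
    also have "\<dots> = (\<integral>x. k x x \<partial>P0) - \<mu> \<bullet> \<mu>"
    proof -
      interpret P0: prob_space P0 using P0 by (simp add: is_law_def)
      have [measurable_cong]: "sets P0 = sets borel" using P0 by (simp add: is_law_def)
      have "integrable P0 (\<lambda>x. k x x)" by (rule P0.integrable_const_bound[where B=1]) (auto simp: k_bounded)
      then show ?thesis unfolding c_eq
        using is_law_integrable[OF P0, of \<mu>] mean_embedding[OF P0, of \<mu>]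
        by (simp add: P0.prob_space \<mu>_def[symmetric])
    qed
    also have "(\<integral>x. k x x \<partial>P0) \<le> 1"
    proof -
      interpret P0: prob_space P0 using P0 by (simp add: is_law_def)
      have [measurable_cong]: "sets P0 = sets borel" using P0 by (simp add: is_law_def)
      have "integrable P0 (\<lambda>x. k x x)" by (rule P0.integrable_const_bound[where B=1]) (auto simp: k_bounded)
      then have "(\<integral>x. k x x \<partial>P0) \<le> (\<integral>x. 1 \<partial>P0)"
        using k_bounded by (intro integral_mono) (auto intro: order_trans[OF abs_ge_self])
      then show ?thesis by (simp add: P0.prob_space)
    qed
    finally show ?thesis using inner_ge_zero[of \<mu>] by linarith
  qed
  have row: "(\<Sum>j=1..n. e i j) \<le> 1 + 2 * (\<Sum>t=1..n. r t)" if i: "i \<in> {1..n}" for i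
  proof -
    have "{1..n} = {1..<i} \<union> ({i} \<union> {i<..n})" using i by auto
    then have "(\<Sum>j=1..n. e i j) = (\<Sum>j\<in>{1..<i}. e i j) + (e i i + (\<Sum>j\<in>{i<..n}. e i j))"
      by (auto simp: sum.union_disjoint ivl_disj_int intro!: sum.union_disjoint)
    also have "(\<Sum>j\<in>{1..<i}. e i j) \<le> (\<Sum>j\<in>{1..<i}. r (i - j))"
      using e_le[of i] by (intro sum_mono) (fastforce split: if_splits)
    \<comment> \<open>The lags in this half row are distinct and lie in {1..n}; the missing ones may
      be added because the rho are nonnegative.\<close>
    also have "\<dots> = (\<Sum>t\<in>(\<lambda>j. i - j) ` {1..<i}. r t)"
      by (subst sum.reindex) (auto simp: inj_on_def)
    also have "\<dots> \<le> (\<Sum>t=1..n. r t)"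
      using i r0 by (intro sum_mono2) auto
    also have "(\<Sum>j\<in>{i<..n}. e i j) \<le> (\<Sum>j\<in>{i<..n}. r (j - i))"
      using e_le[of i] by (intro sum_mono) (fastforce split: if_splits)
    also have "\<dots> = (\<Sum>t\<in>(\<lambda>j. j - i) ` {i<..n}. r t)"
      by (subst sum.reindex) (auto simp: inj_on_def)
    also have "\<dots> \<le> (\<Sum>t=1..n. r t)"
      using i r0 by (intro sum_mono2) auto
    finally show ?thesis using diag[of i] by simp
  qed
  have mmd2: "(mmd fn k (empirical n (\<lambda>i. X i \<omega>)) P0)\<^sup>2 =
      1 / (real n)\<^sup>2 * (\<Sum>i=1..n. \<Sum>j=1..n. c (X i \<omega>) (X j \<omega>))" for \<omega>
  proof -
    have "(1 / real n) *\<^sub>R (\<Sum>i=1..n. K (X i \<omega>)) - \<mu> = (1 / real n) *\<^sub>R (\<Sum>i=1..n. K (X i \<omega>) - \<mu>)"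
      using n by (simp add: sum_subtractf scaleR_diff_right sum_constant_scaleR)
    then show ?thesis
      unfolding mmd_def mean_embedding_empirical[OF n] \<mu>_def[symmetric] power2_norm_eq_inner
      by (simp add: inner_sum_left inner_sum_right c_def power2_eq_square sum_divide_distrib)
         (subst sum.swap, simp add: inner_commute)
  qed
  have mmd_sqrt: "mmd fn k (empirical n (\<lambda>i. X i \<omega>)) P0 =
      sqrt (1 / (real n)\<^sup>2 * (\<Sum>i=1..n. \<Sum>j=1..n. c (X i \<omega>) (X j \<omega>)))" for \<omega>
    unfolding mmd2[symmetric] by (simp add: mmd_nonneg)
  show meas: "(\<lambda>\<omega>. mmd fn k (empirical n (\<lambda>i. X i \<omega>)) P0) \<in> borel_measurable \<Omega>"
    unfolding mmd_sqrt by measurable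
  have "(\<integral>\<omega>. mmd fn k (empirical n (\<lambda>i. X i \<omega>)) P0 \<partial>\<Omega>)\<^sup>2 \<le>
      (\<integral>\<omega>. (mmd fn k (empirical n (\<lambda>i. X i \<omega>)) P0)\<^sup>2 \<partial>\<Omega>)"
    using mmd_le_2[OF is_law_empirical[OF n] P0] mmd_nonneg
    by (intro power2_expectation_le[OF \<Omega> meas, of 2]) (auto simp: abs_of_nonneg)
  also have "\<dots> = 1 / (real n)\<^sup>2 * (\<Sum>i=1..n. \<Sum>j=1..n. e i j)"
    unfolding mmd2 e_def by (simp add: c_int Bochner_Integration.integral_sum)
  also have "\<dots> \<le> 1 / (real n)\<^sup>2 * (\<Sum>i=1..n. 1 + 2 * (\<Sum>t=1..n. r t))"
    by (intro mult_left_mono sum_mono row) auto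
  also have "\<dots> = (1 + 2 * (\<Sum>t=1..n. r t)) / real n"
    using n by (simp add: power2_eq_square)
  finally show "(\<integral>\<omega>. mmd fn k (empirical n (\<lambda>i. X i \<omega>)) P0 \<partial>\<Omega>) \<le>
      sqrt ((1 + 2 * (\<Sum>t=1..n. rho fn k P0 \<Omega> X t)) / real n)"
    unfolding r_def by (rule real_le_rsqrt)
qed

end

section \<open>Gradients within a convex set\<close>

text \<open>Restricting r to {0..1} keeps the segment inside S, where f is differentiable; at the
  end points the result is a one-sided derivative.\<close>

lemma has_derivative_along_segment:
  fixes f :: "'a::real_normed_vector \<Rightarrow> real"
  assumes S: "convex S" "a \<in> S" "b \<in> S" and r: "r \<in> {0..1}"
    and D: "(f has_derivative D) (at (a + r *\<^sub>R (b - a)) within S)"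
  shows "((\<lambda>s. f (a + s *\<^sub>R (b - a))) has_real_derivative D (b - a)) (at r within {0..1})"
proof -
  let ?c = "\<lambda>s::real. a + s *\<^sub>R (b - a)"
  have sub: "?c ` {0..1} \<subseteq> S"
  proof clarify
    fix s :: real assume "s \<in> {0..1}"
    then have "(1 - s) *\<^sub>R a + s *\<^sub>R b \<in> S" using S by (intro convexD) auto
    then show "?c s \<in> S" by (simp add: algebra_simps)
  qed
  have c: "(?c has_derivative (\<lambda>h. h *\<^sub>R (b - a))) (at r within {0..1})"
    by (auto intro!: derivative_eq_intros)
  have "((\<lambda>s. f (?c s)) has_derivative (\<lambda>h. D (h *\<^sub>R (b - a)))) (at r within {0..1})"
    by (rule has_derivative_in_compose[OF c has_derivative_subset[OF D sub]])
  moreover have "D (h *\<^sub>R (b - a)) = D (b - a) * h" for h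
    using linear_scale[OF has_derivative_linear[OF D], of h "b - a"] by simp
  ultimately show ?thesis by (simp add: has_field_derivative_def fun_eq_iff)
qed

text \<open>Differentiability within S sees only directions towards points of S. Along each of them
  the question is one-dimensional, and derivatives within a nondegenerate closed interval are
  unique.\<close>

lemma within_derivative_unique:
  fixes f :: "'a::real_normed_vector \<Rightarrow> real"
  assumes "convex S" "a \<in> S" "b \<in> S"
    and "(f has_derivative D) (at a within S)" "(f has_derivative D') (at a within S)"
  shows "D (b - a) = D' (b - a)"
proof (rule vector_derivative_unique_within_closed_interval[of 0 1 "0::real"])
  show "((\<lambda>s. f (a + s *\<^sub>R (b - a))) has_vector_derivative D (b - a)) (at 0 within cbox 0 1)"
    "((\<lambda>s. f (a + s *\<^sub>R (b - a))) has_vector_derivative D' (b - a)) (at 0 within cbox 0 1)"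
    using has_derivative_along_segment[OF assms(1-3), of 0 f] assms(4,5)
    by (simp_all add: has_real_derivative_iff_has_vector_derivative[symmetric])
qed auto

lemma orthogonal_span_decomp:
  fixes b :: "'a::euclidean_space"
  shows "\<exists>v z. v \<in> span L \<and> (\<forall>u\<in>span L. orthogonal z u) \<and> b = v + z"
proof -
  obtain v z where "v \<in> span L" "\<And>u. u \<in> span L \<Longrightarrow> orthogonal z u" "b = v + z"
    using orthogonal_subspace_decomp_exists[of L b] by blast
  then show ?thesis by blast
qed

text \<open>Existence: project the representer of some within-derivative onto the span of the
  directions of S; the discarded part is orthogonal to all directions, so the derivative within S is
  unaffected. Uniqueness: two candidates agree on every direction, and their difference lies in the
  span, hence is orthogonal to itself.\<close>

lemma gradient_within:
  fixes f :: "'a::euclidean_space \<Rightarrow> real"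
  assumes S: "convex S" "x \<in> S" and f: "f differentiable (at x within S)"
  shows "gradient_within f x S \<in> span {y - x | y. y \<in> S}"
    and "(f has_derivative (\<lambda>h. gradient_within f x S \<bullet> h)) (at x within S)"
proof -
  let ?L = "{y - x | y. y \<in> S}"
  let ?P = "\<lambda>v. v \<in> span ?L \<and> (f has_derivative (\<lambda>h. v \<bullet> h)) (at x within S)"
  obtain D where D: "(f has_derivative D) (at x within S)" using f by (auto simp: differentiable_def)
  obtain w where w: "\<And>h. w \<bullet> h = D h"
    using riesz_representation[OF has_derivative_bounded_linear[OF D]] by blast
  obtain v z where v: "v \<in> span ?L" "\<And>u. u \<in> span ?L \<Longrightarrow> orthogonal z u" "w = v + z"
    using orthogonal_subspace_decomp_exists[of ?L w] by blast
  have eq: "v \<bullet> (y - x) = D (y - x)" if "y \<in> S" for y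
  proof -
    have "z \<bullet> (y - x) = 0" using v(2)[of "y - x"] that by (auto simp: orthogonal_def intro: span_base)
    then show ?thesis using w[of "y - x"] v(3) by (simp add: inner_add_left)
  qed
  have "?P v"
  proof
    show "(f has_derivative (\<lambda>h. v \<bullet> h)) (at x within S)"
      using D unfolding has_derivative_within' by (auto simp: eq bounded_linear_inner_right)
  qed (rule v(1))
  moreover have "v' = v" if v': "?P v'" for v'
  proof -
    have "(v' - v) \<bullet> u = 0" if "u \<in> span ?L" for u
      using that
    proof (induction rule: span_induct_alt)
      case base then show ?case by simp
    next
      case (step c l u)
      then obtain y where "y \<in> S" "l = y - x" by auto
      then have "v' \<bullet> l = v \<bullet> l"
        using within_derivative_unique[OF S(1,2) \<open>y \<in> S\<close>] v' \<open>?P v\<close> by blast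
      then show ?case using step by (simp add: inner_simps)
    qed
    moreover have "v' - v \<in> span ?L" using v' v(1) by (intro span_diff) auto
    ultimately have "(v' - v) \<bullet> (v' - v) = 0" by blast
    then show ?thesis by simp
  qed
  ultimately have "?P (THE v. ?P v)" by (rule theI)
  then show "gradient_within f x S \<in> span ?L"
    "(f has_derivative (\<lambda>h. gradient_within f x S \<bullet> h)) (at x within S)"
    unfolding gradient_within_def by auto
qed

text \<open>Uniqueness concerns directions issuing from x; b - a is the difference (b - x) - (a - x)
  of two of them.\<close>

lemma gradient_within_inner:
  fixes f :: "'a::euclidean_space \<Rightarrow> real"
  assumes S: "convex S" "x \<in> S" "a \<in> S" "b \<in> S" and D: "(f has_derivative D) (at x within S)"
  shows "gradient_within f x S \<bullet> (b - a) = D (b - a)"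
proof -
  have "f differentiable (at x within S)" using D by (auto simp: differentiable_def)
  note g = gradient_within(2)[OF S(1,2) this]
  have "gradient_within f x S \<bullet> (b - x) = D (b - x)" "gradient_within f x S \<bullet> (a - x) = D (a - x)"
    using within_derivative_unique[OF S(1,2) _ g D] S by auto
  moreover have "D (b - a) = D (b - x) - D (a - x)"
    using linear_diff[OF has_derivative_linear[OF D], of "b - x" "a - x"] by simp
  ultimately show ?thesis by (simp add: inner_diff_right)
qed

lemma gradient_within_mult_inner:
  fixes f g :: "'a::euclidean_space \<Rightarrow> real"
  assumes S: "convex S" "x \<in> S" "a \<in> S" "b \<in> S"
    and f: "f differentiable (at x within S)" and g: "g differentiable (at x within S)"
  shows "gradient_within (\<lambda>t. f t * g t) x S \<bullet> (b - a) =
    (gradient_within f x S \<bullet> (b - a)) * g x + f x * (gradient_within g x S \<bullet> (b - a))"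
  using gradient_within_inner[OF S has_derivative_mult[OF gradient_within(2)[OF S(1,2) f] gradient_within(2)[OF S(1,2) g]]]
  by simp

lemma gradient_within_ln:
  fixes f :: "'a::euclidean_space \<Rightarrow> real"
  assumes S: "convex S" "x \<in> S" "a \<in> S" "b \<in> S"
    and f: "f differentiable (at x within S)" "f x > 0"
  shows "(\<lambda>t. ln (f t)) differentiable (at x within S)"
    "gradient_within (\<lambda>t. ln (f t)) x S \<bullet> (b - a) = (gradient_within f x S \<bullet> (b - a)) / f x"
proof -
  note d = has_derivative_ln[OF f(2) gradient_within(2)[OF S(1,2) f(1)]]
  show "(\<lambda>t. ln (f t)) differentiable (at x within S)" using d by (auto simp: differentiable_def)
  show "gradient_within (\<lambda>t. ln (f t)) x S \<bullet> (b - a) = (gradient_within f x S \<bullet> (b - a)) / f x"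
    using gradient_within_inner[OF S d] by (simp add: field_simps)
qed

text \<open>The parameter is replaced by the first point of a dense sequence within distance 1 / (n
  + 1). This takes countably many values, so the composition is jointly measurable, and continuity
  in the parameter gives the pointwise limit.\<close>

lemma caratheodory_measurable:
  fixes f :: "'a::{metric_space,second_countable_topology} \<Rightarrow> 'x \<Rightarrow> real"
  assumes cont: "\<And>x. x \<in> space N \<Longrightarrow> continuous_on S (\<lambda>\<theta>. f \<theta> x)"
    and meas: "\<And>\<theta>. \<theta> \<in> S \<Longrightarrow> f \<theta> \<in> borel_measurable N"
  shows "(\<lambda>z. f (fst z) (snd z)) \<in> borel_measurable (restrict_space borel S \<Otimes>\<^sub>M N)"
proof (cases "S = {}")
  case True
  then show ?thesis by (auto simp: measurable_def space_pair_measure space_restrict_space)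
next
  case False
  obtain T where T: "countable T" "T \<subseteq> S" "S \<subseteq> closure T" using separable[of S] by blast
  have T0: "T \<noteq> {}" using False T by auto
  define e where "e = from_nat_into T"
  have e: "e i \<in> S" for i using T T0 from_nat_into[OF T0] by (auto simp: e_def)
  have dense: "\<exists>i. dist (e i) \<theta> < 1 / real (Suc n)" if "\<theta> \<in> S" for \<theta> n
  proof -
    have "\<theta> \<in> closure T" using T(3) that by blast
    moreover have "0 < 1 / real (Suc n)" by simp
    ultimately obtain t where t: "t \<in> T" "dist t \<theta> < 1 / real (Suc n)"
      unfolding closure_approachable by blast
    obtain i where "from_nat_into T i = t" using from_nat_into_surj[OF T(1) t(1)] by blast
    then show ?thesis using t(2) unfolding e_def by blast
  qed
  define N' where "N' n \<theta> = (LEAST i. dist (e i) \<theta> < 1 / real (Suc n))" for n \<theta>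
  have near: "dist (e (N' n \<theta>)) \<theta> < 1 / real (Suc n)" if "\<theta> \<in> S" for n \<theta>
    unfolding N'_def by (rule LeastI_ex[OF dense[OF that]])
  have id[measurable]: "(\<lambda>x. x) \<in> borel_measurable (restrict_space borel S)"
    by (simp add: measurable_restrict_space1)
  have [measurable]: "(\<lambda>z. N' n (fst z)) \<in> measurable (restrict_space borel S \<Otimes>\<^sub>M N) (count_space UNIV)" for n
  proof -
    have "(\<lambda>\<theta>. N' n \<theta>) \<in> measurable (restrict_space borel S) (count_space UNIV)"
      unfolding N'_def by measurable
    from measurable_compose[OF measurable_fst this] show ?thesis .
  qed
  show ?thesis
  proof (rule borel_measurable_LIMSEQ_real)
    fix n
    have "(\<lambda>z. f (e i) (snd z)) \<in> borel_measurable (restrict_space borel S \<Otimes>\<^sub>M N)" for i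
      by (rule measurable_compose[OF measurable_snd meas[OF e]])
    then show "(\<lambda>z. f (e (N' n (fst z))) (snd z)) \<in> borel_measurable (restrict_space borel S \<Otimes>\<^sub>M N)"
      by (rule measurable_compose_countable) measurable
  next
    fix z assume "z \<in> space (restrict_space borel S \<Otimes>\<^sub>M N)"
    then have z: "fst z \<in> S" "snd z \<in> space N" by (auto simp: space_pair_measure space_restrict_space)
    have lim: "(\<lambda>n. e (N' n (fst z))) \<longlonglongrightarrow> fst z"
    proof (rule metric_LIMSEQ_I)
      fix r :: real assume "0 < r"
      then obtain m where m: "1 / real (Suc m) < r" using nat_approx_posE by blast
      show "\<exists>no. \<forall>n\<ge>no. dist (e (N' n (fst z))) (fst z) < r"
      proof (intro exI allI impI)
        fix n assume "m \<le> n"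
        then have "1 / real (Suc n) \<le> 1 / real (Suc m)" by (simp add: frac_le)
        then show "dist (e (N' n (fst z))) (fst z) < r" using near[OF z(1), of n] m by linarith
      qed
    qed
    then show "(\<lambda>n. f (e (N' n (fst z))) (snd z)) \<longlonglongrightarrow> f (fst z) (snd z)"
      by (intro continuous_on_tendsto_compose[OF cont[OF z(2)] lim z(1)] always_eventually allI e)
  qed
qed

section \<open>Measurability of the algorithm\<close>

text \<open>A one-sided derivative as the limit of a sequence: this makes directional gradients
  measurable and later opens the way to dominated convergence.\<close>

lemma real_derivative_LIMSEQ:
  fixes f :: "real \<Rightarrow> real"
  assumes "(f has_real_derivative D) (at 0 within {0..1})"
  shows "(\<lambda>n. real (Suc n) * (f (1 / real (Suc n)) - f 0)) \<longlonglongrightarrow> D"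
proof -
  have 1: "((\<lambda>y. (f y - f 0) / (y - 0)) \<longlongrightarrow> D) (at 0 within {0..1})"
    using assms by (simp add: has_field_derivative_iff)
  have 2: "filterlim (\<lambda>n. 1 / real (Suc n)) (at 0 within {0..1}) sequentially"
    unfolding filterlim_at
    by (intro conjI always_eventually allI lim_inverse_n'[THEN LIMSEQ_Suc]) auto
  show ?thesis
    using filterlim_compose[OF 1 2] by (simp add: field_simps)
qed

locale sgd_model = rkhs_kernel k fn
  for k :: "'x::euclidean_space \<Rightarrow> 'x \<Rightarrow> real" and fn :: "'h::{real_inner,complete_space} \<Rightarrow> 'x \<Rightarrow> real" +
  fixes \<Theta> :: "'a::euclidean_space set" and P :: "'a \<Rightarrow> 'x measure" and p :: "'a \<Rightarrow> 'x \<Rightarrow> real"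
    and n M :: nat
  assumes k_symmetric: "\<And>x y. k x y = k y x"
    and n: "n \<ge> 1" and M: "M \<ge> 2"
    and Theta: "closed \<Theta>" "convex \<Theta>" "bounded \<Theta>" "\<Theta> \<noteq> {}"
    and P_prob: "\<And>\<theta>. \<theta> \<in> \<Theta> \<Longrightarrow> prob_space (P \<theta>)"
    and R: "regularity_conditions \<Theta> k P p"
begin

abbreviation "ghat \<equiv> stoch_grad k \<Theta> p n M"
abbreviation "SGD \<equiv> sgd k \<Theta> P p n M"
abbreviation "LL \<equiv> lborel \<Otimes>\<^sub>M lborel :: ('x \<times> 'x) measure"
abbreviation "R\<Theta> \<equiv> restrict_space borel \<Theta>"

lemma p_nonneg: "\<theta> \<in> \<Theta> \<Longrightarrow> 0 \<le> p \<theta> x"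
  using R by (auto simp: regularity_conditions_def)

lemma p_meas: "\<theta> \<in> \<Theta> \<Longrightarrow> p \<theta> \<in> borel_measurable borel"
  using R unfolding regularity_conditions_def by blast

lemma P_density: "\<theta> \<in> \<Theta> \<Longrightarrow> P \<theta> = density lborel (\<lambda>x. ennreal (p \<theta> x))"
  using R unfolding regularity_conditions_def by blast

lemma p_differentiable: "\<theta> \<in> \<Theta> \<Longrightarrow> (\<lambda>t. p t x) differentiable (at \<theta> within \<Theta>)"
  using R unfolding regularity_conditions_def differentiable_on_def by blast

lemma sets_P: "\<theta> \<in> \<Theta> \<Longrightarrow> sets (P \<theta>) = sets borel"
  by (simp add: P_density)

lemma law_P: "\<theta> \<in> \<Theta> \<Longrightarrow> is_law (P \<theta>)"
  by (simp add: is_law_def P_prob sets_P)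

abbreviation "grad \<theta> x \<equiv> gradient_within (\<lambda>t. p t x) \<theta> \<Theta>"

lemma p_joint: "(\<lambda>z. p (fst z) (snd z)) \<in> borel_measurable (R\<Theta> \<Otimes>\<^sub>M borel)"
proof (rule caratheodory_measurable)
  fix x :: 'x
  have "(\<lambda>t. p t x) differentiable_on \<Theta>" using p_differentiable by (simp add: differentiable_on_def)
  then show "continuous_on \<Theta> (\<lambda>\<theta>. p \<theta> x)" by (rule differentiable_imp_continuous_on)
qed (rule p_meas)

lemma p_joint_compose[measurable (raw)]:
  assumes "f \<in> measurable N R\<Theta>" "g \<in> borel_measurable N"
  shows "(\<lambda>x. p (f x) (g x)) \<in> borel_measurable N"
  using measurable_compose[OF measurable_Pair[OF assms] p_joint] by simp

lemma Theta_segment: "a \<in> \<Theta> \<Longrightarrow> b \<in> \<Theta> \<Longrightarrow> 0 \<le> s \<Longrightarrow> s \<le> 1 \<Longrightarrow> a + s *\<^sub>R (b - a) \<in> \<Theta>"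
  using convexD[OF Theta(2), of a b "1 - s" s] by (simp add: algebra_simps)

lemma R_segment[measurable (raw)]:
  assumes [measurable]: "f \<in> measurable N R\<Theta>" and b: "b \<in> \<Theta>" and s: "0 \<le> s" "s \<le> 1"
  shows "(\<lambda>x. f x + s *\<^sub>R (b - f x)) \<in> measurable N R\<Theta>"
proof (rule measurable_restrict_space2)
  have f: "f \<in> borel_measurable N" using assms(1) by (simp add: measurable_restrict_space2_iff)
  show "(\<lambda>x. f x + s *\<^sub>R (b - f x)) \<in> borel_measurable N"
    by (intro borel_measurable_add borel_measurable_scaleR borel_measurable_diff borel_measurable_const f)
  show "(\<lambda>x. f x + s *\<^sub>R (b - f x)) \<in> space N \<rightarrow> \<Theta>"
    using measurable_space[OF assms(1)] b s by (auto simp: space_restrict_space intro!: Theta_segment)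
qed

lemma grad_dir_LIMSEQ:
  assumes "\<theta> \<in> \<Theta>" "b \<in> \<Theta>"
  shows "(\<lambda>i. real (Suc i) * (p (\<theta> + (1 / real (Suc i)) *\<^sub>R (b - \<theta>)) x - p \<theta> x)) \<longlonglongrightarrow> grad \<theta> x \<bullet> (b - \<theta>)"
proof -
  have "(\<theta> + 0 *\<^sub>R (b - \<theta>)) = \<theta>" by simp
  then have "((\<lambda>s. p (\<theta> + s *\<^sub>R (b - \<theta>)) x) has_real_derivative grad \<theta> x \<bullet> (b - \<theta>)) (at 0 within {0..1})"
    using has_derivative_along_segment[OF Theta(2) assms, of 0 "\<lambda>t. p t x"]
      gradient_within(2)[OF Theta(2) assms(1) p_differentiable[OF assms(1)]] by simp
  from real_derivative_LIMSEQ[OF this] show ?thesis by simp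
qed

text \<open>The direction b - \<theta> moves with \<theta> so that the quotients are taken along
  segments inside \<Theta>; a step in a fixed direction could leave the set at once. A fixed
  direction b - a is recovered in \<open>grad_dir_measurable\<close> as the difference of two moving
  ones.\<close>

lemma grad_dir_measurable0:
  assumes "b \<in> \<Theta>"
  shows "(\<lambda>z. grad (fst z) (snd z) \<bullet> (b - fst z)) \<in> borel_measurable (R\<Theta> \<Otimes>\<^sub>M borel)"
proof (rule borel_measurable_LIMSEQ_real)
  fix z assume "z \<in> space (R\<Theta> \<Otimes>\<^sub>M (borel :: 'x measure))"
  then have "fst z \<in> \<Theta>" by (auto simp: space_pair_measure space_restrict_space)
  then show "(\<lambda>i. real (Suc i) * (p (fst z + (1 / real (Suc i)) *\<^sub>R (b - fst z)) (snd z) - p (fst z) (snd z)))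
    \<longlonglongrightarrow> grad (fst z) (snd z) \<bullet> (b - fst z)"
    using assms by (rule grad_dir_LIMSEQ)
next
  fix i
  have "(\<lambda>z. fst z + (1 / real (Suc i)) *\<^sub>R (b - fst z)) \<in> measurable (R\<Theta> \<Otimes>\<^sub>M (borel :: 'x measure)) R\<Theta>"
    by (rule R_segment[OF measurable_fst assms]) auto
  then show "(\<lambda>z. real (Suc i) * (p (fst z + (1 / real (Suc i)) *\<^sub>R (b - fst z)) (snd z) - p (fst z) (snd z)))
      \<in> borel_measurable (R\<Theta> \<Otimes>\<^sub>M (borel :: 'x measure))"
    by (intro borel_measurable_times borel_measurable_diff borel_measurable_const p_joint_compose
        measurable_fst measurable_snd)
qed

lemma grad_dir_measurable:
  assumes "a \<in> \<Theta>" "b \<in> \<Theta>"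
  shows "(\<lambda>z. grad (fst z) (snd z) \<bullet> (b - a)) \<in> borel_measurable (R\<Theta> \<Otimes>\<^sub>M borel)"
proof -
  have "(\<lambda>z. grad (fst z) (snd z) \<bullet> (b - a)) =
    (\<lambda>z. grad (fst z) (snd z) \<bullet> (b - fst z) - grad (fst z) (snd z) \<bullet> (a - fst z))"
    by (rule ext) (simp add: inner_diff_right)
  then show ?thesis
    by (simp only:) (intro borel_measurable_diff grad_dir_measurable0 assms)
qed

lemma score_dir:
  assumes "\<theta> \<in> \<Theta>" "a \<in> \<Theta>" "b \<in> \<Theta>"
  shows "score \<Theta> p \<theta> y \<bullet> (b - a) = (if p \<theta> y > 0 then (grad \<theta> y \<bullet> (b - a)) / p \<theta> y else 0)"
  using gradient_within_ln(2)[OF Theta(2) assms p_differentiable[OF assms(1)]] by (simp add: score_def)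

text \<open>The span of the directions does not depend on the base point, since t - \<theta> = (t -
  \<theta>0) - (\<theta> - \<theta>0). One fixed subspace therefore contains all scores.\<close>

lemma score_in_span:
  assumes "\<theta> \<in> \<Theta>" "\<theta>0 \<in> \<Theta>"
  shows "score \<Theta> p \<theta> y \<in> span {t - \<theta>0 | t. t \<in> \<Theta>}"
proof (cases "p \<theta> y > 0")
  case True
  have "{t - \<theta> | t. t \<in> \<Theta>} \<subseteq> span {t - \<theta>0 | t. t \<in> \<Theta>}"
  proof clarify
    fix t assume "t \<in> \<Theta>"
    then have "(t - \<theta>0) - (\<theta> - \<theta>0) \<in> span {t - \<theta>0 | t. t \<in> \<Theta>}"
      using assms by (intro span_diff span_base) auto
    then show "t - \<theta> \<in> span {t - \<theta>0 | t. t \<in> \<Theta>}" by simp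
  qed
  then have "span {t - \<theta> | t. t \<in> \<Theta>} \<subseteq> span {t - \<theta>0 | t. t \<in> \<Theta>}"
    by (intro span_minimal subspace_span)
  then show ?thesis
    using gradient_within(1)[OF Theta(2) assms(1) gradient_within_ln(1)[OF Theta(2) assms(1) assms(1) assms(1) p_differentiable[OF assms(1)] True]] True
    by (auto simp: score_def)
qed (simp add: score_def span_zero)

text \<open>Measurability is available only along directions of \<Theta>. A basis vector is split
  into a part in their span, reached by induction over linear combinations, and a part to which
  every score is orthogonal.\<close>

lemma score_measurable: "(\<lambda>z. score \<Theta> p (fst z) (snd z)) \<in> borel_measurable (R\<Theta> \<Otimes>\<^sub>M borel)"
proof -
  obtain \<theta>0 where \<theta>0: "\<theta>0 \<in> \<Theta>" using Theta(4) by auto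
  let ?N = "R\<Theta> \<Otimes>\<^sub>M (borel :: 'x measure)"
  let ?L = "{t - \<theta>0 | t. t \<in> \<Theta>}"
  have in_space: "fst z \<in> \<Theta>" if "z \<in> space ?N" for z
    using that by (auto simp: space_pair_measure space_restrict_space)
  have span: "(\<lambda>z. score \<Theta> p (fst z) (snd z) \<bullet> u) \<in> borel_measurable ?N" if "u \<in> span ?L" for u
    using that
  proof (induction rule: span_induct_alt)
    case base then show ?case by simp
  next
    case (step c l u)
    then obtain t where t: "t \<in> \<Theta>" "l = t - \<theta>0" by auto
    note [measurable] = p_joint grad_dir_measurable[OF \<theta>0 t(1)] step.IH
    have "(\<lambda>z. if p (fst z) (snd z) > 0 then (grad (fst z) (snd z) \<bullet> (t - \<theta>0)) / p (fst z) (snd z) else 0)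
       \<in> borel_measurable ?N" by measurable
    then have [measurable]: "(\<lambda>z. score \<Theta> p (fst z) (snd z) \<bullet> l) \<in> borel_measurable ?N"
      unfolding t(2) by (subst measurable_cong[OF score_dir[OF in_space \<theta>0 t(1)]])
    have "(\<lambda>z. c * (score \<Theta> p (fst z) (snd z) \<bullet> l) + score \<Theta> p (fst z) (snd z) \<bullet> u) \<in> borel_measurable ?N"
      by measurable
    then show ?case by (simp add: inner_add_right)
  qed
  show ?thesis
  proof (subst borel_measurable_euclidean_space, intro ballI)
    fix b :: 'a assume "b \<in> Basis"
    obtain v z where v: "v \<in> span ?L" "\<forall>u\<in>span ?L. orthogonal z u" "b = v + z"
      using orthogonal_span_decomp[of ?L b] by (elim exE conjE)
    have "score \<Theta> p (fst w) (snd w) \<bullet> b = score \<Theta> p (fst w) (snd w) \<bullet> v" if "w \<in> space ?N" for w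
      using bspec[OF v(2) score_in_span[OF in_space[OF that] \<theta>0]] unfolding v(3)
      by (simp add: inner_add_right inner_add_left orthogonal_def inner_commute)
    then show "(\<lambda>w. score \<Theta> p (fst w) (snd w) \<bullet> b) \<in> borel_measurable ?N"
      by (subst measurable_cong) (auto intro: span[OF v(1)])
  qed
qed

lemma score_compose[measurable (raw)]:
  assumes "f \<in> measurable N R\<Theta>" "g \<in> borel_measurable N"
  shows "(\<lambda>x. score \<Theta> p (f x) (g x)) \<in> borel_measurable N"
  using measurable_compose[OF measurable_Pair[OF assms] score_measurable] by simp

section \<open>Probability kernels, path space and the law of the trajectory\<close>

lemma P_kernel[measurable]: "P \<in> measurable R\<Theta> (prob_algebra borel)"
proof (rule measurable_prob_algebra_generated[where G="sets borel" and \<Omega>=UNIV])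
  show "sets borel = sigma_sets UNIV (sets (borel :: 'x measure))"
    using sets.sigma_sets_eq[of "borel :: 'x measure"] by simp
  show "Int_stable (sets (borel :: 'x measure))" by (rule sets.Int_stable)
  fix A :: "'x set" assume A[measurable]: "A \<in> sets borel"
  have "(\<lambda>\<theta>. \<integral>\<^sup>+x. ennreal (p \<theta> x) * indicator A x \<partial>lborel) \<in> borel_measurable R\<Theta>"
  proof (rule lborel.borel_measurable_nn_integral)
    have 1: "(\<lambda>z. p (fst z) (snd z)) \<in> borel_measurable (R\<Theta> \<Otimes>\<^sub>M lborel)"
      by (intro p_joint_compose) measurable
    note [measurable] = 1
    show "(\<lambda>(\<theta>, x). ennreal (p \<theta> x) * indicator A x) \<in> borel_measurable (R\<Theta> \<Otimes>\<^sub>M lborel)"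
      unfolding case_prod_beta by measurable
  qed
  moreover have "emeasure (P \<theta>) A = (\<integral>\<^sup>+x. ennreal (p \<theta> x) * indicator A x \<partial>lborel)" if "\<theta> \<in> space R\<Theta>" for \<theta>
    using that p_meas[of \<theta>] by (simp add: P_density emeasure_density space_restrict_space)
  ultimately show "(\<lambda>\<theta>. emeasure (P \<theta>) A) \<in> borel_measurable R\<Theta>"
    by (subst measurable_cong) auto
qed (auto simp: space_restrict_space P_prob sets_P)

abbreviation "Y\<^sub>M \<equiv> Pi\<^sub>M {1..M} (\<lambda>_. borel :: 'x measure)"

lemma sets_iid: "\<theta> \<in> \<Theta> \<Longrightarrow> sets (iid M (P \<theta>)) = sets Y\<^sub>M"
  unfolding iid_def by (intro sets_PiM_cong) (auto simp: sets_P)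

lemma prob_iid: "\<theta> \<in> \<Theta> \<Longrightarrow> prob_space (iid M (P \<theta>))"
  unfolding iid_def by (intro prob_space_PiM P_prob)

text \<open>Rectangles form an intersection-stable generator, and the probability of a rectangle is
  a finite product of measurable functions of the parameter.\<close>

lemma iid_kernel[measurable]: "(\<lambda>\<theta>. iid M (P \<theta>)) \<in> measurable R\<Theta> (prob_algebra Y\<^sub>M)"
proof (rule measurable_prob_algebra_generated[OF sets_PiM Int_stable_prod_algebra prod_algebra_sets_into_space])
  fix \<theta> assume "\<theta> \<in> space R\<Theta>"
  then have \<theta>: "\<theta> \<in> \<Theta>" by (simp add: space_restrict_space)
  show "prob_space (iid M (P \<theta>))" by (rule prob_iid[OF \<theta>])
  show "sets (iid M (P \<theta>)) = sets Y\<^sub>M" by (rule sets_iid[OF \<theta>])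
next
  fix A assume "A \<in> prod_algebra {1..M} (\<lambda>_. borel :: 'x measure)"
  then obtain X where X: "A = Pi\<^sub>E {1..M} X" "\<And>i. i \<in> {1..M} \<Longrightarrow> X i \<in> sets borel"
    unfolding prod_algebra_eq_finite[OF finite_atLeastAtMost] by blast
  have "emeasure (iid M (P \<theta>)) A = (\<Prod>i\<in>{1..M}. emeasure (P \<theta>) (X i))" if "\<theta> \<in> space R\<Theta>" for \<theta>
  proof -
    have \<theta>: "\<theta> \<in> \<Theta>" using that by (simp add: space_restrict_space)
    interpret prob_space "P \<theta>" using \<theta> by (rule P_prob)
    interpret product_sigma_finite "\<lambda>_::nat. P \<theta>" by standard
    show ?thesis unfolding iid_def X(1) using X(2) \<theta> by (intro emeasure_PiM) (auto simp: sets_P)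
  qed
  moreover have "(\<lambda>\<theta>. \<Prod>i\<in>{1..M}. emeasure (P \<theta>) (X i)) \<in> borel_measurable R\<Theta>"
  proof (rule borel_measurable_prod_ennreal)
    fix i assume "i \<in> {1..M}"
    then show "(\<lambda>\<theta>. emeasure (P \<theta>) (X i)) \<in> borel_measurable R\<Theta>"
      by (intro measurable_compose[OF measurable_prob_algebraD[OF P_kernel]] measurable_emeasure_subprob_algebra X(2))
  qed
  ultimately show "(\<lambda>\<theta>. emeasure (iid M (P \<theta>)) A) \<in> borel_measurable R\<Theta>"
    by (subst measurable_cong) auto
qed

abbreviation "W \<equiv> path_space \<Theta>"

lemma space_W: "space W = UNIV \<rightarrow> \<Theta>"
  by (auto simp: path_space_def space_PiM space_restrict_space PiE_def extensional_def)

lemma coord_measurable[measurable]: "(\<lambda>w. w t) \<in> measurable W R\<Theta>"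
  unfolding path_space_def by (rule measurable_component_singleton) simp

lemma closest_point_measurable: "closest_point \<Theta> \<in> measurable borel R\<Theta>"
proof (rule measurable_restrict_space2)
  show "closest_point \<Theta> \<in> borel_measurable borel"
    by (intro borel_measurable_continuous_onI continuous_on_closest_point Theta)
  show "closest_point \<Theta> \<in> space borel \<rightarrow> \<Theta>"
    using closest_point_in_set[OF Theta(1,4)] by auto
qed

lemma stoch_grad_measurable:
  assumes [measurable]: "\<And>i. (\<lambda>\<omega>. X \<omega> i) \<in> borel_measurable N" "f \<in> measurable N R\<Theta>"
    "\<And>j. j \<in> {1..M} \<Longrightarrow> (\<lambda>\<omega>. y \<omega> j) \<in> borel_measurable N"
  shows "(\<lambda>\<omega>. ghat (X \<omega>) (f \<omega>) (y \<omega>)) \<in> borel_measurable N"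
  unfolding stoch_grad_def
  by (intro borel_measurable_scaleR borel_measurable_const borel_measurable_sum borel_measurable_diff
      borel_measurable_times k_measurable_comp score_compose assms) auto

definition step :: "real \<Rightarrow> nat \<Rightarrow> (nat \<Rightarrow> 'x) \<Rightarrow> (nat \<Rightarrow> 'a) \<Rightarrow> (nat \<Rightarrow> 'x) \<Rightarrow> nat \<Rightarrow> 'a" where
  "step \<eta> t x w y = w(Suc t := closest_point \<Theta> (w t - \<eta> *\<^sub>R ghat x (w t) y))"

lemma step_measurable:
  assumes X: "\<And>i. (\<lambda>\<omega>. X \<omega> i) \<in> borel_measurable N"
  shows "(\<lambda>(\<omega>, y). step \<eta> t (X (fst \<omega>)) (snd \<omega>) y) \<in> measurable ((N \<Otimes>\<^sub>M W) \<Otimes>\<^sub>M Y\<^sub>M) W"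
proof -
  let ?N = "(N \<Otimes>\<^sub>M W) \<Otimes>\<^sub>M Y\<^sub>M"
  have w: "(\<lambda>z. snd (fst z)) \<in> measurable ?N W" by measurable
  have wt: "(\<lambda>z. snd (fst z) i) \<in> measurable ?N R\<Theta>" for i
    by (rule measurable_compose[OF w coord_measurable])
  have wtb: "(\<lambda>z. snd (fst z) i) \<in> borel_measurable ?N" for i
    using wt by (simp add: measurable_restrict_space2_iff)
  have sg: "(\<lambda>z. ghat (X (fst (fst z))) (snd (fst z) t) (snd z)) \<in> borel_measurable ?N"
  proof (rule stoch_grad_measurable)
    show "(\<lambda>z. X (fst (fst z)) i) \<in> borel_measurable ?N" for i
      by (rule measurable_compose[OF _ X]) measurable
    show "(\<lambda>z. snd z j) \<in> borel_measurable ?N" if "j \<in> {1..M}" for j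
      by (rule measurable_compose[OF measurable_snd measurable_component_singleton[OF that]])
  qed (rule wt)
  have "(\<lambda>z. closest_point \<Theta> (snd (fst z) t - \<eta> *\<^sub>R ghat (X (fst (fst z))) (snd (fst z) t) (snd z)))
      \<in> measurable ?N R\<Theta>"
    by (intro measurable_compose[OF _ closest_point_measurable] borel_measurable_diff borel_measurable_scaleR
        borel_measurable_const wtb sg)
  then show ?thesis
    unfolding step_def case_prod_beta path_space_def
    by (intro measurable_fun_upd[where J=UNIV]) (use w in \<open>auto simp: path_space_def\<close>)
qed

text \<open>N is an arbitrary source of the sample: the space of the process when the trajectory law
  is bound with it, a one-point space when the sample is fixed.\<close>

lemma sgd_kernel:
  assumes X: "\<And>i. (\<lambda>\<omega>. X \<omega> i) \<in> borel_measurable N" and \<theta>0: "\<theta>0 \<in> \<Theta>"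
  shows "(\<lambda>\<omega>. SGD \<eta> \<theta>0 (X \<omega>) t) \<in> measurable N (prob_algebra W)"
proof (induction t)
  case 0
  have "return W (\<lambda>_. \<theta>0) \<in> space (prob_algebra W)"
    unfolding space_prob_algebra using \<theta>0 by (auto simp: space_W intro!: prob_space_return)
  then show ?case by simp
next
  case (Suc t)
  have "(\<lambda>z. distr (iid M (P (snd z t))) W (step (\<eta> (Suc t)) t (X (fst z)) (snd z)))
      \<in> measurable (N \<Otimes>\<^sub>M W) (prob_algebra W)"
  proof (rule measurable_distr_prob_space2)
    show "(\<lambda>z. iid M (P (snd z t))) \<in> measurable (N \<Otimes>\<^sub>M W) (prob_algebra Y\<^sub>M)"
      by (intro measurable_compose[OF _ iid_kernel] measurable_compose[OF measurable_snd coord_measurable])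
  qed (rule step_measurable[OF X])
  then have "(\<lambda>(\<omega>, w). distr (iid M (P (w t))) W (step (\<eta> (Suc t)) t (X \<omega>) w))
      \<in> measurable (N \<Otimes>\<^sub>M W) (prob_algebra W)" by (simp add: case_prod_beta')
  from measurable_bind_prob_space2[OF Suc this] show ?case
    by (simp add: step_def[abs_def])
qed

lemma sgd_space:
  assumes \<theta>0: "\<theta>0 \<in> \<Theta>"
  shows "prob_space (SGD \<eta> \<theta>0 x t)" "sets (SGD \<eta> \<theta>0 x t) = sets W"
    "space (SGD \<eta> \<theta>0 x t) = space W"
proof -
  have "(\<lambda>_. SGD \<eta> \<theta>0 x t) \<in> measurable (count_space (UNIV::unit set)) (prob_algebra W)"
    by (rule sgd_kernel[OF _ \<theta>0, where X="\<lambda>_. x"]) simp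
  from measurable_space[OF this, of "()"] have *: "SGD \<eta> \<theta>0 x t \<in> space (prob_algebra W)" by simp
  then show "prob_space (SGD \<eta> \<theta>0 x t)" "sets (SGD \<eta> \<theta>0 x t) = sets W"
    by (auto simp: space_prob_algebra)
  then show "space (SGD \<eta> \<theta>0 x t) = space W" by (intro sets_eq_imp_space_eq)
qed

end

section \<open>Second-order U-statistics\<close>

text \<open>Coordinates i and j are integrated out one after the other, and the remaining factors
  separate. The weight leaves out i and j, so a truncation in these two coordinates has to be put
  into G.\<close>

lemma nn_integral_PiM_pair:
  fixes Q :: "'x measure" and I :: "'i set"
  assumes Q: "prob_space Q" and I: "finite I" "i \<in> I" "j \<in> I" "i \<noteq> j"
    and G[measurable]: "G \<in> borel_measurable (Q \<Otimes>\<^sub>M Q)" and w[measurable]: "w \<in> borel_measurable Q"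
  shows "(\<integral>\<^sup>+y. G (y i, y j) * (\<Prod>l\<in>I - {i, j}. w (y l)) \<partial>Pi\<^sub>M I (\<lambda>_. Q)) =
    (\<integral>\<^sup>+z. G z \<partial>(Q \<Otimes>\<^sub>M Q)) * (\<integral>\<^sup>+x. w x \<partial>Q) ^ (card I - 2)"
proof -
  interpret Q: prob_space Q by fact
  interpret product_sigma_finite "\<lambda>_::'i. Q" by standard
  define J where "J = I - {i, j}"
  have J: "finite J" "i \<notin> insert j J" "j \<notin> J" "I = insert i (insert j J)" "card J = card I - 2"
    using I by (auto simp: J_def card_Diff_subset)
  have ij[measurable]: "i \<in> insert i (insert j J)" "j \<in> insert i (insert j J)"
    "j \<in> insert j J" "\<And>l. l \<in> J \<Longrightarrow> l \<in> insert i (insert j J)" "\<And>l. l \<in> J \<Longrightarrow> l \<in> insert j J" by auto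
  have "(\<integral>\<^sup>+y. G (y i, y j) * (\<Prod>l\<in>J. w (y l)) \<partial>Pi\<^sub>M I (\<lambda>_. Q)) =
    (\<integral>\<^sup>+x. (\<integral>\<^sup>+z. G (z, x j) * (\<Prod>l\<in>J. w (x l)) \<partial>Q) \<partial>Pi\<^sub>M (insert j J) (\<lambda>_. Q))"
  proof -
    have m1: "(\<lambda>y. G (y i, y j) * (\<Prod>l\<in>J. w (y l))) \<in> borel_measurable (Pi\<^sub>M (insert i (insert j J)) (\<lambda>_. Q))"
      by measurable
    have fin: "finite (insert j J)" using J by simp
    show ?thesis
      unfolding J(4) product_nn_integral_insert[OF fin J(2) m1]
      using J(2) I(4) by (intro nn_integral_cong arg_cong2[where f="(*)"] prod.cong) auto
  qed
  also have "\<dots> = (\<integral>\<^sup>+x. (\<integral>\<^sup>+z. G (z, x j) \<partial>Q) * (\<Prod>l\<in>J. w (x l)) \<partial>Pi\<^sub>M (insert j J) (\<lambda>_. Q))"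
    by (intro nn_integral_cong nn_integral_multc measurable_compose[OF measurable_Pair2' G])
      (auto simp: space_PiM)
  also have "\<dots> = (\<integral>\<^sup>+x. (\<integral>\<^sup>+u. (\<integral>\<^sup>+z. G (z, u) \<partial>Q) * (\<Prod>l\<in>J. w (x l)) \<partial>Q) \<partial>Pi\<^sub>M J (\<lambda>_. Q))"
  proof -
    have m2: "(\<lambda>x. (\<integral>\<^sup>+z. G (z, x j) \<partial>Q) * (\<Prod>l\<in>J. w (x l))) \<in> borel_measurable (Pi\<^sub>M (insert j J) (\<lambda>_. Q))"
      by measurable
    show ?thesis
      unfolding product_nn_integral_insert[OF J(1,3) m2] using J(3)
      by (intro nn_integral_cong arg_cong2[where f="(*)"] prod.cong) auto
  qed
  also have "\<dots> = (\<integral>\<^sup>+x. (\<integral>\<^sup>+u. (\<integral>\<^sup>+z. G (z, u) \<partial>Q) \<partial>Q) * (\<Prod>l\<in>J. w (x l)) \<partial>Pi\<^sub>M J (\<lambda>_. Q))"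
    by (intro nn_integral_cong nn_integral_multc) auto
  also have "\<dots> = (\<integral>\<^sup>+u. (\<integral>\<^sup>+z. G (z, u) \<partial>Q) \<partial>Q) * (\<integral>\<^sup>+x. (\<Prod>l\<in>J. w (x l)) \<partial>Pi\<^sub>M J (\<lambda>_. Q))"
    by (intro nn_integral_cmult) auto
  also have "(\<integral>\<^sup>+x. (\<Prod>l\<in>J. w (x l)) \<partial>Pi\<^sub>M J (\<lambda>_. Q)) = (\<integral>\<^sup>+x. w x \<partial>Q) ^ (card I - 2)"
    using J by (subst product_nn_integral_prod) auto
  also have "(\<integral>\<^sup>+u. (\<integral>\<^sup>+z. G (z, u) \<partial>Q) \<partial>Q) = (\<integral>\<^sup>+z. G z \<partial>(Q \<Otimes>\<^sub>M Q))"
  proof -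
    interpret PP: pair_sigma_finite Q Q ..
    show ?thesis by (rule PP.nn_integral_snd) simp
  qed
  finally show ?thesis by (simp add: J_def)
qed

text \<open>The nonnegative version is applied to |F| for integrability and to F and -F for the
  value; \<open>ennreal\<close> cuts these down to the positive and negative parts.\<close>

lemma PiM_pair_integral:
  fixes Q :: "'x measure" and I :: "'i set" and F :: "'x \<times> 'x \<Rightarrow> real"
  assumes Q: "prob_space Q" and I: "finite I" "i \<in> I" "j \<in> I" "i \<noteq> j"
    and F: "integrable (Q \<Otimes>\<^sub>M Q) F" and w[measurable]: "w \<in> borel_measurable Q"
    and w01: "\<And>x. 0 \<le> w x" "\<And>x. w x \<le> 1"
  shows "integrable (Pi\<^sub>M I (\<lambda>_. Q)) (\<lambda>y. F (y i, y j) * (\<Prod>l\<in>I - {i, j}. w (y l)))" (is ?A)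
    and "(\<integral>y. F (y i, y j) * (\<Prod>l\<in>I - {i, j}. w (y l)) \<partial>Pi\<^sub>M I (\<lambda>_. Q)) =
      (\<integral>z. F z \<partial>(Q \<Otimes>\<^sub>M Q)) * (\<integral>x. w x \<partial>Q) ^ (card I - 2)" (is ?B)
proof -
  interpret Q: prob_space Q by fact
  let ?P = "Pi\<^sub>M I (\<lambda>_. Q)"
  let ?W = "\<lambda>y. \<Prod>l\<in>I - {i, j}. w (y l)"
  have [measurable]: "F \<in> borel_measurable (Q \<Otimes>\<^sub>M Q)" using F by simp
  have ij[measurable]: "i \<in> I" "j \<in> I" "\<And>l. l \<in> I - {i, j} \<Longrightarrow> l \<in> I" using I by auto
  have iw: "integrable Q w" using w01 by (intro Q.integrable_const_bound[where B=1]) auto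
  have w0: "0 \<le> ?W y" for y using w01 by (intro prod_nonneg) auto
  have ew: "(\<integral>\<^sup>+x. ennreal (w x) \<partial>Q) = ennreal (\<integral>x. w x \<partial>Q)"
    using iw w01 by (intro nn_integral_eq_integral) auto
  have iw0: "0 \<le> (\<integral>x. w x \<partial>Q)" using w01 by (intro Bochner_Integration.integral_nonneg) auto
  have key: "(\<integral>\<^sup>+y. ennreal (H (y i, y j) * ?W y) \<partial>?P) =
      (\<integral>\<^sup>+z. ennreal (H z) \<partial>(Q \<Otimes>\<^sub>M Q)) * ennreal ((\<integral>x. w x \<partial>Q) ^ (card I - 2))"
    if [measurable]: "H \<in> borel_measurable (Q \<Otimes>\<^sub>M Q)" for H :: "'x \<times> 'x \<Rightarrow> real"
  proof -
    have "(\<integral>\<^sup>+y. ennreal (H (y i, y j) * ?W y) \<partial>?P) =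
      (\<integral>\<^sup>+y. ennreal (H (y i, y j)) * (\<Prod>l\<in>I - {i, j}. ennreal (w (y l))) \<partial>?P)"
      using w0 w01 by (simp add: ennreal_mult'' prod_ennreal)
    also have "\<dots> = (\<integral>\<^sup>+z. ennreal (H z) \<partial>(Q \<Otimes>\<^sub>M Q)) * (\<integral>\<^sup>+x. ennreal (w x) \<partial>Q) ^ (card I - 2)"
      by (rule nn_integral_PiM_pair[OF Q I, where G="\<lambda>z. ennreal (H z)"]) auto
    finally show ?thesis using iw0 by (simp add: ew ennreal_power)
  qed
  have fin: "(\<integral>\<^sup>+z. ennreal (norm (F z)) \<partial>(Q \<Otimes>\<^sub>M Q)) < \<infinity>"
    using F by (simp add: integrable_iff_bounded)
  show A: ?A
  proof (rule integrableI_bounded)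
    show "(\<integral>\<^sup>+y. ennreal (norm (F (y i, y j) * ?W y)) \<partial>?P) < \<infinity>"
      using key[of "\<lambda>z. norm (F z)"] fin w0 by (simp add: abs_mult ennreal_mult_less_top)
  qed measurable
  show ?B
    unfolding real_lebesgue_integral_def[OF A] real_lebesgue_integral_def[OF F]
    using key[of F] key[of "\<lambda>z. - F z"] iw0 by (simp add: enn2real_mult algebra_simps)
qed

lemma ennreal_power2_le_imp_le:
  assumes "x\<^sup>2 \<le> (ennreal c)\<^sup>2" "0 \<le> c"
  shows "x \<le> ennreal c"
proof (cases x)
  case (real l)
  then have "l\<^sup>2 \<le> c\<^sup>2" using assms by (simp add: ennreal_power)
  then show ?thesis using real assms by (auto intro: power2_le_imp_le)
next
  case top
  then show ?thesis using assms by (simp add: ennreal_power power_top_ennreal top_unique)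
qed

text \<open>A union bound: of m independent draws that hit a set with probability q, some draw
  misses it with probability at most m (1 - q).\<close>

lemma bernoulli_power_le: "(0::real) \<le> q \<Longrightarrow> q \<le> 1 \<Longrightarrow> 1 - q ^ m \<le> real m * (1 - q)"
  using Bernoulli_inequality[of "q - 1" m] by (simp add: algebra_simps)

text \<open>
  Truncation to a set \<open>E\<close> uses the weight \<open>\<Prod>\<^sub>l 1\<^sub>E(y\<^sub>l)\<close> in \<open>E[h]\<close>, so the second moment of \<open>h\<close> controls the
  error by Cauchy-Schwarz.
\<close>

locale u_statistic = prob_space Q for Q :: "'x measure" +
  fixes I :: "'i set" and U :: "'x \<times> 'x \<Rightarrow> real" and b :: "'x \<Rightarrow> real" and G B :: real
    and h :: "('i \<Rightarrow> 'x) \<Rightarrow> real"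
  assumes I: "finite I" "card I \<ge> 2"
    and U: "integrable (Q \<Otimes>\<^sub>M Q) U" and U_le: "(\<integral>z. \<bar>U z\<bar> \<partial>(Q \<Otimes>\<^sub>M Q)) \<le> G"
    and b[measurable]: "b \<in> borel_measurable Q"
    and h_def: "h = (\<lambda>y. 1 / (real (card I) * (real (card I) - 1)) * (\<Sum>i\<in>I. \<Sum>j\<in>I - {i}. U (y i, y j))
            - 2 / real (card I) * (\<Sum>i\<in>I. b (y i)))"
    and B: "B \<ge> 0" "(\<integral>\<^sup>+y. ennreal ((h y)\<^sup>2) \<partial>Pi\<^sub>M I (\<lambda>_. Q)) \<le> ennreal (B\<^sup>2)"
begin

abbreviation "PI \<equiv> Pi\<^sub>M I (\<lambda>_. Q)"
abbreviation "m \<equiv> real (card I)"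

lemma prob_PI: "prob_space PI"
  by (intro prob_space_PiM prob_space_axioms)

lemma U_meas[measurable]: "U \<in> borel_measurable (Q \<Otimes>\<^sub>M Q)"
  using U by simp

lemma h_meas[measurable]: "h \<in> borel_measurable PI"
  unfolding h_def by measurable

lemma m_ge: "m \<ge> 2" using I by simp

text \<open>Cauchy-Schwarz against the weight, whose square is at most itself. W = 1 yields the L1
  bound of \<open>h\<close>; one minus the product of indicators yields the cost of
  truncation.\<close>

lemma nn_h_weight:
  assumes [measurable]: "W \<in> borel_measurable PI" and W: "\<And>y. 0 \<le> W y" "\<And>y. W y \<le> 1"
  shows "(\<integral>\<^sup>+y. ennreal (\<bar>h y\<bar> * W y) \<partial>PI) \<le> ennreal (B * sqrt (\<integral>y. W y \<partial>PI))"
proof -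
  interpret PI: prob_space PI by (rule prob_PI)
  have iW: "integrable PI W" using W by (intro PI.integrable_const_bound[where B=1]) auto
  have W0: "0 \<le> (\<integral>y. W y \<partial>PI)" using W by (intro Bochner_Integration.integral_nonneg) auto
  have "(\<integral>\<^sup>+y. ennreal (\<bar>h y\<bar> * W y) \<partial>PI)\<^sup>2 = (\<integral>\<^sup>+y. ennreal \<bar>h y\<bar> * ennreal (W y) \<partial>PI)\<^sup>2"
    using W by (simp add: ennreal_mult'')
  also have CS: "\<dots> \<le> (\<integral>\<^sup>+y. (ennreal \<bar>h y\<bar>)\<^sup>2 \<partial>PI) * (\<integral>\<^sup>+y. (ennreal (W y))\<^sup>2 \<partial>PI)"
    by (rule Cauchy_Schwarz_nn_integral) auto
  finally have CS: "(\<integral>\<^sup>+y. ennreal (\<bar>h y\<bar> * W y) \<partial>PI)\<^sup>2 \<le>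
    (\<integral>\<^sup>+y. (ennreal \<bar>h y\<bar>)\<^sup>2 \<partial>PI) * (\<integral>\<^sup>+y. (ennreal (W y))\<^sup>2 \<partial>PI)" .
  have h2: "(\<integral>\<^sup>+y. (ennreal \<bar>h y\<bar>)\<^sup>2 \<partial>PI) \<le> ennreal (B\<^sup>2)"
    using B(2) by (simp add: ennreal_power)
  have "(\<integral>\<^sup>+y. (ennreal (W y))\<^sup>2 \<partial>PI) \<le> (\<integral>\<^sup>+y. ennreal (W y) \<partial>PI)"
  proof (intro nn_integral_mono)
    fix y show "(ennreal (W y))\<^sup>2 \<le> ennreal (W y)"
      using W[of y] by (simp add: ennreal_power power2_eq_square mult_left_le)
  qed
  also have "(\<integral>\<^sup>+y. ennreal (W y) \<partial>PI) = ennreal (\<integral>y. W y \<partial>PI)"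
    using iW W by (intro nn_integral_eq_integral) auto
  finally have W2: "(\<integral>\<^sup>+y. (ennreal (W y))\<^sup>2 \<partial>PI) \<le> ennreal (\<integral>y. W y \<partial>PI)" .
  note CS
  also note mult_mono[OF h2 W2]
  also have "ennreal (B\<^sup>2) * ennreal (\<integral>y. W y \<partial>PI) = (ennreal (B * sqrt (\<integral>y. W y \<partial>PI)))\<^sup>2"
    using B W0 by (simp add: ennreal_power power_mult_distrib ennreal_mult'')
  finally show ?thesis
    using B W0 by (intro ennreal_power2_le_imp_le) auto
qed

lemma h_integrable: "integrable PI h" and h_L1: "(\<integral>y. \<bar>h y\<bar> \<partial>PI) \<le> B"
proof -
  interpret PI: prob_space PI by (rule prob_PI)
  have *: "(\<integral>\<^sup>+y. ennreal \<bar>h y\<bar> \<partial>PI) \<le> ennreal B"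
    using nn_h_weight[of "\<lambda>_. 1"] by (simp add: PI.prob_space)
  show "integrable PI h"
    using * by (intro integrableI_bounded) (auto intro: le_less_trans)
  then show "(\<integral>y. \<bar>h y\<bar> \<partial>PI) \<le> B"
    using * B by (subst integral_eq_nn_integral) (auto intro: enn2real_leI)
qed

lemma pair_int:
  assumes "i \<in> I" "j \<in> I" "i \<noteq> j" "integrable (Q \<Otimes>\<^sub>M Q) F"
  shows "integrable PI (\<lambda>y. F (y i, y j) :: real)" "(\<integral>y. F (y i, y j) \<partial>PI) = (\<integral>z. F z \<partial>(Q \<Otimes>\<^sub>M Q))"
  using PiM_pair_integral[OF prob_space_axioms I(1) assms, of "\<lambda>_. 1"]
  by (simp_all add: prob_space)

definition "S y = 1 / (m * (m - 1)) * (\<Sum>i\<in>I. \<Sum>j\<in>I - {i}. U (y i, y j))"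
definition "V y = (\<Sum>i\<in>I. b (y i))"

lemma h_S_V: "h y = S y - 2 / m * V y"
  by (simp add: h_def S_def V_def)

lemma card_avg: "1 / (m * (m - 1)) * (\<Sum>i\<in>I. \<Sum>j\<in>I - {i}. c) = (c::real)"
proof -
  have "(\<Sum>i\<in>I. \<Sum>j\<in>I - {i}. c) = m * ((m - 1) * c)"
    using I by (simp add: card_Diff_subset of_nat_diff)
  then show ?thesis using m_ge by simp
qed

lemma double_sum_int:
  fixes f :: "'i \<Rightarrow> 'i \<Rightarrow> 'c \<Rightarrow> real"
  assumes "\<And>i j. i \<in> I \<Longrightarrow> j \<in> I - {i} \<Longrightarrow> integrable N (f i j)"
  shows "(\<integral>y. c * (\<Sum>i\<in>I. \<Sum>j\<in>I - {i}. f i j y) \<partial>N) = c * (\<Sum>i\<in>I. \<Sum>j\<in>I - {i}. \<integral>y. f i j y \<partial>N)"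
proof -
  have "(\<integral>y. (\<Sum>i\<in>I. \<Sum>j\<in>I - {i}. f i j y) \<partial>N) = (\<Sum>i\<in>I. \<integral>y. (\<Sum>j\<in>I - {i}. f i j y) \<partial>N)"
    using assms by (intro Bochner_Integration.integral_sum Bochner_Integration.integrable_sum)
  also have "\<dots> = (\<Sum>i\<in>I. \<Sum>j\<in>I - {i}. \<integral>y. f i j y \<partial>N)"
    using assms by (intro sum.cong refl Bochner_Integration.integral_sum)
  finally show ?thesis by simp
qed

lemma S_integrable: "integrable PI S" and S_L1: "(\<integral>y. \<bar>S y\<bar> \<partial>PI) \<le> G"
proof -
  have i: "integrable PI (\<lambda>y. U (y i, y j))" if "i \<in> I" "j \<in> I - {i}" for i j
    using pair_int[of i j U] U that by auto
  have i2: "integrable PI (\<lambda>y. \<bar>U (y i, y j)\<bar>)" if "i \<in> I" "j \<in> I - {i}" for i j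
    using i[OF that] by simp
  show s: "integrable PI S"
    unfolding S_def by (intro integrable_mult_right Bochner_Integration.integrable_sum i)
  have "(\<integral>y. \<bar>S y\<bar> \<partial>PI) \<le> (\<integral>y. 1 / (m * (m - 1)) * (\<Sum>i\<in>I. \<Sum>j\<in>I - {i}. \<bar>U (y i, y j)\<bar>) \<partial>PI)"
  proof (rule integral_mono)
    show "integrable PI (\<lambda>y. 1 / (m * (m - 1)) * (\<Sum>i\<in>I. \<Sum>j\<in>I - {i}. \<bar>U (y i, y j)\<bar>))"
      by (intro integrable_mult_right Bochner_Integration.integrable_sum i2)
    fix y
    have "\<bar>\<Sum>i\<in>I. \<Sum>j\<in>I - {i}. U (y i, y j)\<bar> \<le> (\<Sum>i\<in>I. \<Sum>j\<in>I - {i}. \<bar>U (y i, y j)\<bar>)"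
      by (intro order_trans[OF sum_abs] sum_mono order_refl)
    then show "\<bar>S y\<bar> \<le> 1 / (m * (m - 1)) * (\<Sum>i\<in>I. \<Sum>j\<in>I - {i}. \<bar>U (y i, y j)\<bar>)"
      using m_ge by (auto simp: S_def abs_mult intro!: divide_right_mono)
  qed (use s in simp)
  also have "\<dots> = 1 / (m * (m - 1)) * (\<Sum>i\<in>I. \<Sum>j\<in>I - {i}. \<integral>y. \<bar>U (y i, y j)\<bar> \<partial>PI)"
    by (intro double_sum_int i2)
  also have "\<dots> = 1 / (m * (m - 1)) * (\<Sum>i\<in>I. \<Sum>j\<in>I - {i}. \<integral>z. \<bar>U z\<bar> \<partial>(Q \<Otimes>\<^sub>M Q))"
    using U by (intro arg_cong2[where f="(*)"] refl sum.cong) (auto intro!: pair_int(2)[of _ _ "\<lambda>z. \<bar>U z\<bar>"])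
  also have "\<dots> = (\<integral>z. \<bar>U z\<bar> \<partial>(Q \<Otimes>\<^sub>M Q))" by (rule card_avg)
  finally show "(\<integral>y. \<bar>S y\<bar> \<partial>PI) \<le> G" using U_le by simp
qed

text \<open>Nothing beyond measurability is known about \<open>b\<close> at this point; V = m / 2 (S
  - h) inherits its bound from the two other terms.\<close>

lemma V_integrable: "integrable PI V" and V_L1: "(\<integral>y. \<bar>V y\<bar> \<partial>PI) \<le> m / 2 * (B + G)"
proof -
  have V: "V = (\<lambda>y. m / 2 * (S y - h y))"
    using m_ge by (auto simp: h_S_V)
  show "integrable PI V"
    unfolding V using S_integrable h_integrable by simp
  have "(\<integral>y. \<bar>V y\<bar> \<partial>PI) = m / 2 * (\<integral>y. \<bar>S y - h y\<bar> \<partial>PI)"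
    by (simp add: V abs_mult)
  also have "(\<integral>y. \<bar>S y - h y\<bar> \<partial>PI) \<le> (\<integral>y. \<bar>S y\<bar> + \<bar>h y\<bar> \<partial>PI)"
    using S_integrable h_integrable by (intro integral_mono) auto
  also have "\<dots> \<le> G + B"
    using S_integrable h_integrable S_L1 h_L1 by simp
  finally show "(\<integral>y. \<bar>V y\<bar> \<partial>PI) \<le> m / 2 * (B + G)"
    using m_ge by (simp add: algebra_simps)
qed

lemma b_integrable: "integrable Q b"
proof -
  obtain i where i: "i \<in> I" using I by fastforce
  define J where "J = I - {i}"
  have J: "I = insert i J" "finite J" "i \<notin> J" using I i by (auto simp: J_def)
  interpret product_sigma_finite "\<lambda>_::'i. Q" by standard
  interpret PJ: prob_space "Pi\<^sub>M J (\<lambda>_. Q)" by (intro prob_space_PiM prob_space_axioms)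
  have [measurable]: "V \<in> borel_measurable PI" using V_integrable by simp
  have Vm[measurable]: "V \<in> borel_measurable (Pi\<^sub>M (insert i J) (\<lambda>_. Q))"
    using \<open>V \<in> borel_measurable PI\<close> by (simp only: J(1)[symmetric])
  have "(\<integral>\<^sup>+x. (\<integral>\<^sup>+z. ennreal \<bar>V (x(i := z))\<bar> \<partial>Q) \<partial>Pi\<^sub>M J (\<lambda>_. Q)) =
      (\<integral>\<^sup>+y. ennreal \<bar>V y\<bar> \<partial>Pi\<^sub>M (insert i J) (\<lambda>_. Q))"
    by (rule product_nn_integral_insert[OF J(2,3), symmetric]) measurable
  also have "\<dots> = (\<integral>\<^sup>+y. ennreal \<bar>V y\<bar> \<partial>PI)" by (simp only: J(1)[symmetric])
  also have "\<dots> < \<infinity>" using V_integrable by (simp add: integrable_iff_bounded)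
  finally have "(\<integral>\<^sup>+x. (\<integral>\<^sup>+z. ennreal \<bar>V (x(i := z))\<bar> \<partial>Q) \<partial>Pi\<^sub>M J (\<lambda>_. Q)) \<noteq> \<infinity>" by simp
  then have AE: "AE x in Pi\<^sub>M J (\<lambda>_. Q). (\<integral>\<^sup>+z. ennreal \<bar>V (x(i := z))\<bar> \<partial>Q) \<noteq> \<infinity>"
    by (intro nn_integral_PInf_AE) (use Vm in \<open>measurable\<close>)
  have "ae_filter (Pi\<^sub>M J (\<lambda>_. Q)) \<noteq> bot"
    by (simp add: ae_filter_eq_bot_iff PJ.emeasure_space_1)
  from eventually_happens'[OF this AE] have "\<exists>x. (\<integral>\<^sup>+z. ennreal \<bar>V (x(i := z))\<bar> \<partial>Q) \<noteq> \<infinity>"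
    .
  then
  obtain x where x: "(\<integral>\<^sup>+z. ennreal \<bar>V (x(i := z))\<bar> \<partial>Q) \<noteq> \<infinity>" by auto
  have V: "V (x(i := z)) = b z + (\<Sum>j\<in>J. b (x j))" for z
  proof -
    have "V (x(i := z)) = b z + (\<Sum>j\<in>I - {i}. b ((x(i := z)) j))"
      by (simp add: V_def sum.remove[OF I(1) i])
    also have "(\<Sum>j\<in>I - {i}. b ((x(i := z)) j)) = (\<Sum>j\<in>J. b (x j))"
      by (intro sum.cong) (auto simp: J_def)
    finally show ?thesis .
  qed
  have "integrable Q (\<lambda>z. b z + (\<Sum>j\<in>J. b (x j)))"
    using x by (intro integrableI_bounded) (auto simp: V top.not_eq_extremum)
  then have "integrable Q (\<lambda>z. (b z + (\<Sum>j\<in>J. b (x j))) - (\<Sum>j\<in>J. b (x j)))"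
    by (intro Bochner_Integration.integrable_diff) auto
  then show ?thesis by simp
qed

lemma comp_int:
  assumes "i \<in> I" "integrable Q f"
  shows "integrable PI (\<lambda>y. f (y i) :: real)" "(\<integral>y. f (y i) \<partial>PI) = (\<integral>x. f x \<partial>Q)"
proof -
  have D: "distr PI Q (\<lambda>y. y i) = Q"
    using distr_PiM_component[of I "\<lambda>_. Q" i] assms prob_space_axioms by auto
  have [measurable]: "f \<in> borel_measurable Q" "i \<in> I" using assms by auto
  show "integrable PI (\<lambda>y. f (y i))"
    using assms by (subst integrable_distr_eq[symmetric, where g="\<lambda>y. y i" and N=Q]) (auto simp: D)
  show "(\<integral>y. f (y i) \<partial>PI) = (\<integral>x. f x \<partial>Q)"
    by (subst (2) D[symmetric], subst integral_distr) auto
qed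

lemma V_mean: "(\<integral>y. V y \<partial>PI) = m * (\<integral>x. b x \<partial>Q)"
  unfolding V_def using comp_int[OF _ b_integrable] by (simp add: Bochner_Integration.integral_sum)

lemma pair_prod_int:
  assumes "integrable Q f" "integrable Q g"
  shows "integrable (Q \<Otimes>\<^sub>M Q) (\<lambda>z. f (fst z) * g (snd z) :: real)"
    "(\<integral>z. f (fst z) * g (snd z) \<partial>(Q \<Otimes>\<^sub>M Q)) = (\<integral>x. f x \<partial>Q) * (\<integral>x. g x \<partial>Q)"
proof -
  interpret PP: pair_sigma_finite Q Q ..
  have [measurable]: "f \<in> borel_measurable Q" "g \<in> borel_measurable Q" using assms by auto
  have "integrable (Q \<Otimes>\<^sub>M Q) (\<lambda>(x, y). f x * g y)"
    by (rule PP.Fubini_integrable) (use assms in \<open>auto simp: abs_mult\<close>)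
  then show 1: "integrable (Q \<Otimes>\<^sub>M Q) (\<lambda>z. f (fst z) * g (snd z))"
    by (simp add: case_prod_beta')
  show "(\<integral>z. f (fst z) * g (snd z) \<partial>(Q \<Otimes>\<^sub>M Q)) = (\<integral>x. f x \<partial>Q) * (\<integral>x. g x \<partial>Q)"
    by (subst PP.integral_fst'[OF 1, symmetric]) simp
qed

text \<open>Testing \<open>V\<close> against the sign of one summand isolates that summand.\<close>

lemma b_L1: "(\<integral>x. \<bar>b x\<bar> \<partial>Q) \<le> m * (B + G)"
proof -
  interpret PI: prob_space PI by (rule prob_PI)
  obtain i where i: "i \<in> I" using I by fastforce
  let ?s = "\<lambda>x. sgn (b x)"
  let ?\<beta> = "\<integral>x. b x \<partial>Q" and ?\<sigma> = "\<integral>x. ?s x \<partial>Q"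
  have s: "integrable Q ?s" by (intro integrable_const_bound[where B=1]) (auto simp: sgn_if)
  have \<sigma>: "\<bar>?\<sigma>\<bar> \<le> 1"
  proof -
    have "\<bar>?\<sigma>\<bar> \<le> (\<integral>x. \<bar>?s x\<bar> \<partial>Q)" by (rule integral_abs_bound)
    also have "\<dots> \<le> (\<integral>x. 1 \<partial>Q)" using s by (intro integral_mono) (auto simp: sgn_if)
    finally show ?thesis by (simp add: prob_space)
  qed
  have t: "integrable PI (\<lambda>y. b (y j) * ?s (y i))"
    "(\<integral>y. b (y j) * ?s (y i) \<partial>PI) = ?\<beta> * ?\<sigma>" if "j \<in> I - {i}" for j
    using pair_int[of j i "\<lambda>z. b (fst z) * ?s (snd z)"] pair_prod_int[OF b_integrable s] that i by auto
  have t0: "integrable PI (\<lambda>y. \<bar>b (y i)\<bar>)" "(\<integral>y. \<bar>b (y i)\<bar> \<partial>PI) = (\<integral>x. \<bar>b x\<bar> \<partial>Q)"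
    using comp_int[OF i, of "\<lambda>x. \<bar>b x\<bar>"] b_integrable by auto
  \<comment> \<open>The i-th summand becomes |b|. Every other summand is independent of the sign
    factor and contributes the product of the means \<open>?\<beta>\<close> and
    \<open>?\<sigma>\<close>.\<close>
  have split: "V y * ?s (y i) = \<bar>b (y i)\<bar> + (\<Sum>j\<in>I - {i}. b (y j) * ?s (y i))" for y
    using I i by (subst (1) V_def) (simp add: sum.remove[of I i] sum_distrib_left abs_sgn algebra_simps)
  have iV: "integrable PI (\<lambda>y. V y * ?s (y i))"
    unfolding split by (intro Bochner_Integration.integrable_add t0(1) Bochner_Integration.integrable_sum t(1))
  have "(\<integral>y. V y * ?s (y i) \<partial>PI) = (\<integral>x. \<bar>b x\<bar> \<partial>Q) + (m - 1) * (?\<beta> * ?\<sigma>)"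
    unfolding split
    by (subst Bochner_Integration.integral_add[OF t0(1) Bochner_Integration.integrable_sum[OF t(1)]], assumption,
        subst Bochner_Integration.integral_sum[OF t(1)]) (use I i in \<open>auto simp: t0 t of_nat_diff\<close>)
  moreover have "(\<integral>y. V y * ?s (y i) \<partial>PI) \<le> (\<integral>y. \<bar>V y\<bar> \<partial>PI)"
    using iV V_integrable by (intro integral_mono) (auto simp: sgn_if)
  moreover note V_L1
  \<comment> \<open>The cross terms are controlled by the mean of V: (m - 1) |\<beta>| \<le> m
    |\<beta>| = |E V|. Added to the bound for E|V|, this doubles m / 2 to m.\<close>
  moreover have "- ((m - 1) * (?\<beta> * ?\<sigma>)) \<le> m / 2 * (B + G)"
  proof -
    have "- (?\<beta> * ?\<sigma>) \<le> \<bar>?\<beta>\<bar>"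
      using mult_left_le[OF \<sigma>, of "\<bar>?\<beta>\<bar>"] by (auto simp: abs_mult[symmetric])
    then have "- ((m - 1) * (?\<beta> * ?\<sigma>)) \<le> (m - 1) * \<bar>?\<beta>\<bar>"
      using m_ge mult_left_mono[of "- (?\<beta> * ?\<sigma>)" "\<bar>?\<beta>\<bar>" "m - 1"] by simp
    also have "\<dots> \<le> m * \<bar>?\<beta>\<bar>" using m_ge by (intro mult_right_mono) auto
    also have "\<dots> = \<bar>\<integral>y. V y \<partial>PI\<bar>" by (simp add: V_mean abs_mult)
    also have "\<dots> \<le> m / 2 * (B + G)" using integral_abs_bound[of PI V] V_L1 by linarith
    finally show ?thesis .
  qed
  ultimately show ?thesis by argo
qed

text \<open>With the weight W, the mean of h W factorizes into UE q^(m - 2) - 2 bE q^(m - 1).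
  Passing from h to h W costs the square-root term; replacing the powers of q by 1 costs the linear
  term, whose factor collects the L1 bounds of U and b.\<close>

lemma h_truncated_mean:
  assumes E[measurable]: "E \<in> sets Q"
  defines "q \<equiv> prob E"
  shows "\<bar>(\<integral>y. h y \<partial>PI) - ((\<integral>z. U z * (indicator E (fst z) * indicator E (snd z)) \<partial>(Q \<Otimes>\<^sub>M Q))
            - 2 * (\<integral>x. b x * indicator E x \<partial>Q))\<bar>
    \<le> B * sqrt (m * (1 - q)) + m * (1 - q) * (G + 2 * (m * (B + G)))"
proof -
  interpret PI: prob_space PI by (rule prob_PI)
  interpret product_sigma_finite "\<lambda>_::'i. Q" by standard
  let ?e = "indicator E :: 'x \<Rightarrow> real"
  define UE where "UE = (\<integral>z. U z * (?e (fst z) * ?e (snd z)) \<partial>(Q \<Otimes>\<^sub>M Q))"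
  define bE where "bE = (\<integral>x. b x * ?e x \<partial>Q)"
  define W where "W y = (\<Prod>l\<in>I. ?e (y l))" for y :: "'i \<Rightarrow> 'x"
  have [measurable]: "W \<in> borel_measurable PI" unfolding W_def by measurable
  have W01: "0 \<le> W y" "W y \<le> 1" for y
    unfolding W_def by (auto intro!: prod_nonneg prod_le_1)
  have q01: "0 \<le> q" "q \<le> 1" by (auto simp: q_def)
  have ie: "integrable Q ?e" by (intro integrable_const_bound[where B=1]) auto
  have eq: "(\<integral>x. ?e x \<partial>Q) = q" by (simp add: q_def)
  have iUE: "integrable (Q \<Otimes>\<^sub>M Q) (\<lambda>z. U z * (?e (fst z) * ?e (snd z)))"
    by (rule Bochner_Integration.integrable_bound[OF U]) (auto simp: indicator_def)
  have ibE: "integrable Q (\<lambda>x. b x * ?e x)"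
    by (rule Bochner_Integration.integrable_bound[OF b_integrable]) (auto simp: indicator_def)
  have WU: "U (y i, y j) * W y = (U (y i, y j) * (?e (y i) * ?e (y j))) * (\<Prod>l\<in>I - {i, j}. ?e (y l))"
    if "i \<in> I" "j \<in> I - {i}" for i j y
  proof -
    have "W y = ?e (y i) * (?e (y j) * (\<Prod>l\<in>I - {i} - {j}. ?e (y l)))"
      using I that unfolding W_def by (simp add: prod.remove[of I i] prod.remove[of "I - {i}" j])
    then show ?thesis by (simp add: Diff_insert2[symmetric] insert_commute)
  qed
  have iU: "integrable PI (\<lambda>y. U (y i, y j) * W y)" "(\<integral>y. U (y i, y j) * W y \<partial>PI) = UE * q ^ (card I - 2)"
    if ij: "i \<in> I" "j \<in> I - {i}" for i j
  proof -
    have ne: "i \<noteq> j" "j \<in> I" using ij by auto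
    note * = PiM_pair_integral[OF prob_space_axioms I(1) ij(1) ne(2,1) iUE, of ?e]
    show "integrable PI (\<lambda>y. U (y i, y j) * W y)"
      unfolding WU[OF ij] using *(1) by simp
    show "(\<integral>y. U (y i, y j) * W y \<partial>PI) = UE * q ^ (card I - 2)"
      unfolding WU[OF ij] UE_def eq[symmetric] using *(2) by simp
  qed
  have Wb: "b (y i) * W y = (\<Prod>l\<in>I. if l = i then b (y l) * ?e (y l) else ?e (y l))" if "i \<in> I" for i y
    using I that unfolding W_def by (simp add: prod.remove[of I i])
  have ib: "integrable PI (\<lambda>y. b (y i) * W y)" "(\<integral>y. b (y i) * W y \<partial>PI) = bE * q ^ (card I - 1)"
    if i: "i \<in> I" for i
  proof -
    let ?f = "\<lambda>l. if l = i then \<lambda>x. b x * ?e x else ?e"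
    have f: "integrable Q (?f l)" for l using ibE ie by simp
    have Wf: "b (y i) * W y = (\<Prod>l\<in>I. ?f l (y l))" for y
      unfolding Wb[OF i] by (intro prod.cong) auto
    show "integrable PI (\<lambda>y. b (y i) * W y)"
      unfolding Wf by (rule product_integrable_prod[OF I(1) f])
    have "(\<integral>y. b (y i) * W y \<partial>PI) = (\<Prod>l\<in>I. \<integral>x. ?f l x \<partial>Q)"
      unfolding Wf by (rule product_integral_prod[OF I(1) f])
    also have "\<dots> = bE * q ^ (card I - 1)"
      using I i by (simp add: prod.remove[of I i] q_def bE_def)
    finally show "(\<integral>y. b (y i) * W y \<partial>PI) = bE * q ^ (card I - 1)" .
  qed
  have hW_eq: "h y * W y = 1 / (m * (m - 1)) * (\<Sum>i\<in>I. \<Sum>j\<in>I - {i}. U (y i, y j) * W y)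
      - 2 / m * (\<Sum>i\<in>I. b (y i) * W y)" for y
    unfolding h_def by (simp add: sum_distrib_right left_diff_distrib)
  have ihW: "integrable PI (\<lambda>y. h y * W y)"
    unfolding hW_eq using iU ib by (intro Bochner_Integration.integrable_diff integrable_mult_right Bochner_Integration.integrable_sum) auto
  have "(\<integral>y. h y * W y \<partial>PI) = (\<integral>y. 1 / (m * (m - 1)) * (\<Sum>i\<in>I. \<Sum>j\<in>I - {i}. U (y i, y j) * W y) \<partial>PI)
      - (\<integral>y. 2 / m * (\<Sum>i\<in>I. b (y i) * W y) \<partial>PI)"
    unfolding hW_eq by (intro Bochner_Integration.integral_diff integrable_mult_right Bochner_Integration.integrable_sum iU ib)
  also have "(\<integral>y. 2 / m * (\<Sum>i\<in>I. b (y i) * W y) \<partial>PI) = 2 / m * (\<Sum>i\<in>I. bE * q ^ (card I - 1))"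
    by (subst integral_mult_right_zero) (simp add: Bochner_Integration.integral_sum ib)
  also have "(\<integral>y. 1 / (m * (m - 1)) * (\<Sum>i\<in>I. \<Sum>j\<in>I - {i}. U (y i, y j) * W y) \<partial>PI) =
      1 / (m * (m - 1)) * (\<Sum>i\<in>I. \<Sum>j\<in>I - {i}. UE * q ^ (card I - 2))"
    by (subst double_sum_int[OF iU(1)]) (auto simp: iU(2) intro!: sum.cong)
  also have "1 / (m * (m - 1)) * (\<Sum>i\<in>I. \<Sum>j\<in>I - {i}. UE * q ^ (card I - 2)) - 2 / m * (\<Sum>i\<in>I. bE * q ^ (card I - 1))
      = UE * q ^ (card I - 2) - 2 * (bE * q ^ (card I - 1))"
  proof -
    have "m \<noteq> 0" using m_ge by linarith
    then show ?thesis unfolding card_avg by simp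
  qed
  finally have hW: "(\<integral>y. h y * W y \<partial>PI) = UE * q ^ (card I - 2) - 2 * (bE * q ^ (card I - 1))" .
  have "(\<integral>y. W y \<partial>PI) = q ^ card I"
    unfolding W_def using product_integral_prod[OF I(1), of "\<lambda>_. ?e"] ie by (simp add: q_def)
  moreover have "integrable PI W" using W01 by (intro PI.integrable_const_bound[where B=1]) auto
  ultimately have "(\<integral>y. 1 - W y \<partial>PI) = 1 - q ^ card I" by (simp add: PI.prob_space)
  then have "(\<integral>\<^sup>+y. ennreal (\<bar>h y\<bar> * (1 - W y)) \<partial>PI) \<le> ennreal (B * sqrt (1 - q ^ card I))"
    using nn_h_weight[of "\<lambda>y. 1 - W y"] W01 by simp
  also have "\<dots> \<le> ennreal (B * sqrt (m * (1 - q)))"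
    using B bernoulli_power_le[OF q01] by (intro ennreal_leI mult_left_mono) auto
  finally have *: "(\<integral>\<^sup>+y. ennreal (\<bar>h y\<bar> * (1 - W y)) \<partial>PI) \<le> ennreal (B * sqrt (m * (1 - q)))" .
  have "\<bar>(\<integral>y. h y \<partial>PI) - (\<integral>y. h y * W y \<partial>PI)\<bar> = \<bar>\<integral>y. h y * (1 - W y) \<partial>PI\<bar>"
    using h_integrable ihW by (simp add: algebra_simps)
  also have "\<dots> \<le> (\<integral>y. \<bar>h y\<bar> * (1 - W y) \<partial>PI)"
    using integral_abs_bound[of PI "\<lambda>y. h y * (1 - W y)"] W01 by (simp add: abs_mult)
  also have "\<dots> \<le> B * sqrt (m * (1 - q))"
    using * B W01 q01 by (subst integral_eq_nn_integral) (auto intro!: enn2real_leI)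
  finally have 1: "\<bar>(\<integral>y. h y \<partial>PI) - (\<integral>y. h y * W y \<partial>PI)\<bar> \<le> B * sqrt (m * (1 - q))" .
  have UE_le: "\<bar>UE\<bar> \<le> G"
  proof -
    have "\<bar>UE\<bar> \<le> (\<integral>z. \<bar>U z * (?e (fst z) * ?e (snd z))\<bar> \<partial>(Q \<Otimes>\<^sub>M Q))"
      unfolding UE_def by (rule integral_abs_bound)
    also have "\<dots> \<le> (\<integral>z. \<bar>U z\<bar> \<partial>(Q \<Otimes>\<^sub>M Q))"
      using iUE U by (intro integral_mono) (auto simp: indicator_def)
    finally show ?thesis using U_le by simp
  qed
  have bE_le: "\<bar>bE\<bar> \<le> m * (B + G)"
  proof -
    have "\<bar>bE\<bar> \<le> (\<integral>x. \<bar>b x * ?e x\<bar> \<partial>Q)"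
      unfolding bE_def by (rule integral_abs_bound)
    also have "\<dots> \<le> (\<integral>x. \<bar>b x\<bar> \<partial>Q)"
      using ibE b_integrable by (intro integral_mono) (auto simp: indicator_def)
    finally show ?thesis using b_L1 by simp
  qed
  have pw: "1 - q ^ j \<le> m * (1 - q)" if "j \<le> card I" for j
    using bernoulli_power_le[OF q01, of j] mult_right_mono[of "real j" m "1 - q"] q01 that by simp
  have pw0: "0 \<le> 1 - q ^ j" for j using q01 by (simp add: power_le_one)
  have "\<bar>UE * (1 - q ^ (card I - 2))\<bar> \<le> G * (m * (1 - q))"
    unfolding abs_mult using UE_le pw[of "card I - 2"] pw0[of "card I - 2"] by (intro mult_mono) auto
  moreover have "\<bar>bE * (1 - q ^ (card I - 1))\<bar> \<le> m * (B + G) * (m * (1 - q))"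
    unfolding abs_mult using bE_le pw[of "card I - 1"] pw0[of "card I - 1"] by (intro mult_mono) auto
  moreover have "(\<integral>y. h y * W y \<partial>PI) - (UE - 2 * bE) =
      2 * (bE * (1 - q ^ (card I - 1))) - UE * (1 - q ^ (card I - 2))"
    unfolding hW by (simp add: algebra_simps)
  ultimately have "\<bar>(\<integral>y. h y * W y \<partial>PI) - (UE - 2 * bE)\<bar> \<le> G * (m * (1 - q)) + 2 * (m * (B + G) * (m * (1 - q)))"
    by linarith
  then show ?thesis
    using 1 unfolding UE_def[symmetric] bE_def[symmetric] by (simp add: algebra_simps)
qed

end

section \<open>Differentiation along segments\<close>

text \<open>
  The derivative in the parameter is only assumed to exist pointwise and to have bounded \<open>L\<^sup>1\<close> norm; it need not
  be continuous or dominated. The Henstock-Kurzweil fundamental theorem applies to almost every \<open>x\<close>.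
\<close>

lemma integral_FTC_parametric:
  fixes f f' :: "real \<Rightarrow> 'c \<Rightarrow> real"
  assumes N: "sigma_finite_measure N" and s: "0 \<le> s" "s \<le> 1"
    and deriv: "\<And>x r. x \<in> space N \<Longrightarrow> r \<in> {0..1} \<Longrightarrow> ((\<lambda>r. f r x) has_real_derivative f' r x) (at r within {0..1})"
    and meas: "(\<lambda>z. f' (snd z) (fst z)) \<in> borel_measurable (N \<Otimes>\<^sub>M borel)"
    and bound: "\<And>r. 0 < r \<Longrightarrow> r < 1 \<Longrightarrow> (\<integral>\<^sup>+x. ennreal \<bar>f' r x\<bar> \<partial>N) \<le> ennreal C"
    and int: "\<And>r. r \<in> {0..1} \<Longrightarrow> integrable N (f r)"
  shows "set_integrable lborel {0<..<s} (\<lambda>r. \<integral>x. f' r x \<partial>N)"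
    and "(\<integral>x. f s x \<partial>N) - (\<integral>x. f 0 x \<partial>N) = (LINT r:{0<..<s}|lborel. (\<integral>x. f' r x \<partial>N))"
proof -
  interpret N: sigma_finite_measure N by fact
  interpret pair_sigma_finite N lborel ..
  \<comment> \<open>The indicator excludes the end points, where \<open>bound\<close> gives nothing;
    they are negligible for the integral over r.\<close>
  define F where "F x r = indicator {0<..<s} r * f' r x" for x r
  have mF: "(\<lambda>z. F (fst z) (snd z)) \<in> borel_measurable (N \<Otimes>\<^sub>M lborel)"
    unfolding F_def
  proof (rule borel_measurable_times)
    show "(\<lambda>z. indicator {0<..<s} (snd z)) \<in> borel_measurable (N \<Otimes>\<^sub>M lborel)" by measurable
    show "(\<lambda>z. f' (snd z) (fst z)) \<in> borel_measurable (N \<Otimes>\<^sub>M lborel)"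
      using meas by (simp add: measurable_cong_sets[OF sets_pair_measure_cong[OF refl sets_lborel] refl])
  qed
  have mF': "case_prod F \<in> borel_measurable (N \<Otimes>\<^sub>M lborel)"
    using mF by (simp add: case_prod_beta')
  have "(\<integral>\<^sup>+z. ennreal \<bar>F (fst z) (snd z)\<bar> \<partial>(N \<Otimes>\<^sub>M lborel)) = (\<integral>\<^sup>+r. (\<integral>\<^sup>+x. ennreal \<bar>F x r\<bar> \<partial>N) \<partial>lborel)"
    using nn_integral_snd[of "\<lambda>z. ennreal \<bar>F (fst z) (snd z)\<bar>"] mF by simp
  also have "\<dots> \<le> (\<integral>\<^sup>+r. ennreal C * indicator {0<..<s} r \<partial>lborel)"
  proof (rule nn_integral_mono)
    fix r :: real
    show "(\<integral>\<^sup>+x. ennreal \<bar>F x r\<bar> \<partial>N) \<le> ennreal C * indicator {0<..<s} r"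
      using bound[of r] s by (cases "r \<in> {0<..<s}") (auto simp: F_def)
  qed
  also have "\<dots> = ennreal C * ennreal s" using s by (simp add: nn_integral_cmult)
  also have "\<dots> < \<infinity>" by (simp add: ennreal_mult_less_top)
  finally have "(\<integral>\<^sup>+z. ennreal (norm (F (fst z) (snd z))) \<partial>(N \<Otimes>\<^sub>M lborel)) < \<infinity>" by simp
  then have iF: "integrable (N \<Otimes>\<^sub>M lborel) (\<lambda>z. F (fst z) (snd z))"
    by (intro integrableI_bounded mF)
  then have iF': "integrable (N \<Otimes>\<^sub>M lborel) (case_prod F)" by (simp add: case_prod_beta')
  \<comment> \<open>For almost every x the section is Lebesgue integrable, so its Lebesgue integral
    is the Henstock-Kurzweil integral, which is determined by a derivative that merely exists
    everywhere.\<close>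
  have "AE x in N. (\<integral>r. F x r \<partial>lborel) = f s x - f 0 x"
    using AE_integrable_fst[OF iF'] AE_space
  proof eventually_elim
    fix x assume i: "integrable lborel (F x)" and x: "x \<in> space N"
    have si: "set_integrable lborel {0<..<s} (\<lambda>r. f' r x)"
      unfolding set_integrable_def using i by (simp add: F_def[abs_def])
    have "(LINT r:{0<..<s}|lborel. f' r x) = integral {0<..<s} (\<lambda>r. f' r x)"
      by (rule set_borel_integral_eq_integral(2)[OF si])
    also have "\<dots> = integral {0..s} (\<lambda>r. f' r x)" by (rule integral_open_interval_real[symmetric])
    also have "((\<lambda>r. f' r x) has_integral (f s x - f 0 x)) {0..s}"
    proof (rule fundamental_theorem_of_calculus[OF s(1)])
      fix r assume r: "r \<in> {0..s}"
      then have "((\<lambda>r. f r x) has_real_derivative f' r x) (at r within {0..1})"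
        using s by (intro deriv x) auto
      then have "((\<lambda>r. f r x) has_real_derivative f' r x) (at r within {0..s})"
        by (rule DERIV_subset) (use s in auto)
      then show "((\<lambda>r. f r x) has_vector_derivative f' r x) (at r within {0..s})"
        by (simp add: has_real_derivative_iff_has_vector_derivative)
    qed
    then have "integral {0..s} (\<lambda>r. f' r x) = f s x - f 0 x" by (rule integral_unique)
    finally show "(\<integral>r. F x r \<partial>lborel) = f s x - f 0 x"
      by (simp add: set_lebesgue_integral_def F_def)
  qed
  then have "(\<integral>x. (\<integral>r. F x r \<partial>lborel) \<partial>N) = (\<integral>x. f s x - f 0 x \<partial>N)"
    using integrable_fst[OF iF'] int[of s] int[of 0] s by (intro integral_cong_AE) auto
  also have "\<dots> = (\<integral>x. f s x \<partial>N) - (\<integral>x. f 0 x \<partial>N)"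
    using int[of s] int[of 0] s by simp
  finally have "(\<integral>x. f s x \<partial>N) - (\<integral>x. f 0 x \<partial>N) = (\<integral>r. (\<integral>x. F x r \<partial>N) \<partial>lborel)"
    using Fubini_integral[OF iF'] by simp
  moreover have eq: "(\<integral>x. F x r \<partial>N) = indicator {0<..<s} r * (\<integral>x. f' r x \<partial>N)" for r
    by (simp add: F_def)
  ultimately show "(\<integral>x. f s x \<partial>N) - (\<integral>x. f 0 x \<partial>N) = (LINT r:{0<..<s}|lborel. (\<integral>x. f' r x \<partial>N))"
    by (simp add: set_lebesgue_integral_def)
  show "set_integrable lborel {0<..<s} (\<lambda>r. \<integral>x. f' r x \<partial>N)"
    using integrable_snd[OF iF'] by (simp add: set_integrable_def eq)
qed

lemma sum_offdiag_swap:
  fixes f :: "'i \<Rightarrow> 'i \<Rightarrow> real"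
  assumes "finite I"
  shows "(\<Sum>i\<in>I. \<Sum>j\<in>I - {i}. f i j) = (\<Sum>i\<in>I. \<Sum>j\<in>I - {i}. f j i)"
proof -
  have 1: "(\<Sum>j\<in>I - {i}. h j) = (\<Sum>j\<in>I. if j = i then 0 else h j)" for i and h :: "'i \<Rightarrow> real"
    using assms by (intro sum.mono_neutral_cong_left) auto
  show ?thesis
    unfolding 1 by (subst sum.swap) (intro sum.cong refl, auto)
qed

section \<open>The directional stochastic gradient along a segment as a U-statistic\<close>

locale sgd_segment = sgd_model k fn \<Theta> P p n M
  for k :: "'x::euclidean_space \<Rightarrow> 'x \<Rightarrow> real" and fn :: "'h::{real_inner,complete_space} \<Rightarrow> 'x \<Rightarrow> real"
    and \<Theta> :: "'a::euclidean_space set" and P p n M +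
  fixes a b :: 'a and xs :: "nat \<Rightarrow> 'x" and B :: real and g :: "'x \<Rightarrow> 'x \<Rightarrow> real"
  assumes ab: "a \<in> \<Theta>" "b \<in> \<Theta>" and B0: "B \<ge> 0"
    and second_moment: "\<And>\<theta>. \<theta> \<in> \<Theta> \<Longrightarrow>
      (\<integral>\<^sup>+y. ennreal ((norm (ghat xs \<theta> y))\<^sup>2) \<partial>iid M (P \<theta>)) \<le> ennreal (B\<^sup>2)"
    and g_nonneg: "\<And>x x'. 0 \<le> g x x'"
    and g_integrable: "integrable LL (\<lambda>(x, x'). g x x')"
    and g_dom: "\<And>\<theta> x x'. \<theta> \<in> \<Theta> \<Longrightarrow>
      norm (k x x' *\<^sub>R gradient_within (\<lambda>t. p t x * p t x') \<theta> \<Theta>) \<le> g x x'"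
begin

text \<open>Clamping makes the segment a total measurable path. \<open>Dt\<close> is the derivative as seen by the score.\<close>

definition "\<gamma> r = a + (max 0 (min 1 r)) *\<^sub>R (b - a)" for r :: real
definition "q r x = p (\<gamma> r) x"
definition "D r x = grad (\<gamma> r) x \<bullet> (b - a)"
definition "Dt r x = (if q r x > 0 then D r x else 0)"
definition "\<alpha> y = 1 / real n * (\<Sum>i=1..n. k (xs i) y)"
definition "s r x = score \<Theta> p (\<gamma> r) x \<bullet> (b - a)"
definition "h r y = ghat xs (\<gamma> r) y \<bullet> (b - a)"
definition "m r = (\<integral>y. h r y \<partial>iid M (P (\<gamma> r)))"
text \<open>\<open>G\<close>, \<open>B'\<close> and \<open>C\<close> bound, at every point of the
  segment, the L1 norm of the quadratic part, the L2 norm of \<open>h\<close> and the L1 norm of the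
  derivative of the linear part. \<open>C\<close> and \<open>err\<close> are the constants of
  \<open>b_L1\<close> and \<open>h_truncated_mean\<close>, with t the mass that the truncation set
  misses.\<close>

definition "G = norm (b - a) * (\<integral>z. g (fst z) (snd z) \<partial>LL)"
definition "B' = B * norm (b - a)"
definition "C = real M * (B' + G)"
definition "err t = B' * sqrt (real M * t) + real M * t * (G + 2 * C)"

text \<open>The product rule for k q q, with the derivative of q left open as \<open>d\<close>, so
  that it can be instantiated both by \<open>D\<close> and by \<open>Dt\<close>.\<close>

definition "kD d r z = k (fst z) (snd z) * (d r (fst z) * q r (snd z) + q r (fst z) * d r (snd z))"
  for d :: "real \<Rightarrow> 'x \<Rightarrow> real"
definition "ind E z = (indicator E (fst z) * indicator E (snd z) :: real)" for E :: "'x set"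

lemma \<gamma>_in: "\<gamma> r \<in> \<Theta>"
  unfolding \<gamma>_def by (rule Theta_segment[OF ab]) auto

lemma \<gamma>_eq: "r \<in> {0..1} \<Longrightarrow> \<gamma> r = a + r *\<^sub>R (b - a)"
  by (simp add: \<gamma>_def)

lemma \<gamma>_measurable[measurable]: "\<gamma> \<in> measurable borel R\<Theta>"
  unfolding \<gamma>_def
  by (rule measurable_restrict_space2) (auto intro!: Theta_segment ab)

lemma \<gamma>_compose[measurable (raw)]: "f \<in> borel_measurable N \<Longrightarrow> (\<lambda>x. \<gamma> (f x)) \<in> measurable N R\<Theta>"
  by (rule measurable_compose[OF _ \<gamma>_measurable])

lemma q_nonneg: "0 \<le> q r x"
  by (simp add: q_def p_nonneg \<gamma>_in)

lemma q_meas[measurable (raw)]: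
  "f \<in> borel_measurable N \<Longrightarrow> w \<in> borel_measurable N \<Longrightarrow> (\<lambda>x. q (f x) (w x)) \<in> borel_measurable N"
  unfolding q_def by (intro p_joint_compose \<gamma>_compose)

lemma D_meas[measurable (raw)]:
  assumes "f \<in> borel_measurable N" "w \<in> borel_measurable N"
  shows "(\<lambda>x. D (f x) (w x)) \<in> borel_measurable N"
  using measurable_compose[OF measurable_Pair[OF \<gamma>_compose[OF assms(1)] assms(2)] grad_dir_measurable[OF ab]]
  by (simp add: D_def)

lemma Dt_meas[measurable (raw)]:
  assumes [measurable]: "f \<in> borel_measurable N" "w \<in> borel_measurable N"
  shows "(\<lambda>x. Dt (f x) (w x)) \<in> borel_measurable N"
  unfolding Dt_def by measurable

lemma \<alpha>_meas[measurable (raw)]: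
  assumes [measurable]: "w \<in> borel_measurable N"
  shows "(\<lambda>x. \<alpha> (w x)) \<in> borel_measurable N"
  unfolding \<alpha>_def by measurable

lemma \<alpha>_le: "\<bar>\<alpha> y\<bar> \<le> 1"
proof -
  have "\<bar>\<Sum>i=1..n. k (xs i) y\<bar> \<le> (\<Sum>i=1..n. 1)"
    by (intro order_trans[OF sum_abs] sum_mono k_bounded)
  then show ?thesis using n by (simp add: \<alpha>_def abs_mult divide_le_eq)
qed

lemma s_eq: "s r x = (if q r x > 0 then D r x / q r x else 0)"
  unfolding s_def q_def D_def by (rule score_dir[OF \<gamma>_in ab])

lemma q_s: "q r x * s r x = Dt r x"
  by (simp add: s_eq Dt_def)

lemma s_meas[measurable (raw)]:
  assumes [measurable]: "f \<in> borel_measurable N" "w \<in> borel_measurable N"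
  shows "(\<lambda>x. s (f x) (w x)) \<in> borel_measurable N"
  unfolding s_eq by measurable

lemma q_deriv:
  assumes r: "r \<in> {0..1}"
  shows "((\<lambda>r. q r x) has_real_derivative D r x) (at r within {0..1})"
proof -
  have "((\<lambda>s. p (a + s *\<^sub>R (b - a)) x) has_real_derivative grad (\<gamma> r) x \<bullet> (b - a)) (at r within {0..1})"
    using has_derivative_along_segment[OF Theta(2) ab r, of "\<lambda>t. p t x"]
      gradient_within(2)[OF Theta(2) \<gamma>_in[of r] p_differentiable[OF \<gamma>_in[of r]]] \<gamma>_eq[OF r] by simp
  then show ?thesis
    unfolding D_def
    by (rule has_field_derivative_transform_within[OF _ zero_less_one r]) (simp add: q_def \<gamma>_eq)
qed

lemma q_continuous: "continuous_on {0..1} (\<lambda>r. q r x)"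
  using q_deriv by (intro DERIV_continuous_on) auto

text \<open>An interior zero of the density is a minimum in the parameter.\<close>

lemma D_eq_Dt: "0 < r \<Longrightarrow> r < 1 \<Longrightarrow> D r x = Dt r x"
proof (cases "q r x > 0")
  case False
  assume r: "0 < r" "r < 1"
  have q0: "q r x = 0" using False q_nonneg[of r x] by simp
  have "((\<lambda>r. q r x) has_real_derivative D r x) (at r within {0<..<1})"
    by (rule DERIV_subset[OF q_deriv]) (use r in auto)
  then have "((\<lambda>r. q r x) has_real_derivative D r x) (at r)"
    using r by (subst (asm) at_within_open) auto
  then have "D r x = 0"
    by (rule DERIV_local_min[OF _ zero_less_one]) (auto simp: q0 q_nonneg)
  then show ?thesis using False by (simp add: Dt_def)
qed (simp add: Dt_def)

lemma G_nonneg: "0 \<le> G"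
  unfolding G_def using g_nonneg by (intro mult_nonneg_nonneg Bochner_Integration.integral_nonneg) auto

lemma B'_nonneg: "0 \<le> B'"
  using B0 by (simp add: B'_def)

lemma C_nonneg: "0 \<le> C"
  unfolding C_def using G_nonneg B'_nonneg by (intro mult_nonneg_nonneg) auto

text \<open>The product rule identifies \<open>kD D\<close> with the gradient that (R) dominates,
  tested in the direction b - a.\<close>

lemma kD_le: "\<bar>kD D r z\<bar> \<le> g (fst z) (snd z) * norm (b - a)"
proof -
  have "kD D r z = (k (fst z) (snd z) *\<^sub>R gradient_within (\<lambda>t. p t (fst z) * p t (snd z)) (\<gamma> r) \<Theta>) \<bullet> (b - a)"
    using gradient_within_mult_inner[OF Theta(2) \<gamma>_in ab p_differentiable[OF \<gamma>_in, where x="fst z"] p_differentiable[OF \<gamma>_in, where x="snd z"], of r]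
    by (simp add: kD_def D_def q_def)
  also have "\<bar>\<dots>\<bar> \<le> norm (k (fst z) (snd z) *\<^sub>R gradient_within (\<lambda>t. p t (fst z) * p t (snd z)) (\<gamma> r) \<Theta>) * norm (b - a)"
    by (rule Cauchy_Schwarz_ineq2)
  also have "\<dots> \<le> g (fst z) (snd z) * norm (b - a)"
    by (intro mult_right_mono g_dom \<gamma>_in) auto
  finally show ?thesis .
qed

lemma kDt_cases: "kD Dt r z = kD D r z \<or> q r (fst z) * q r (snd z) = 0"
  using q_nonneg[of r "fst z"] q_nonneg[of r "snd z"] by (auto simp: kD_def Dt_def)

lemma kD_meas[measurable (raw)]:
  assumes [measurable]: "f \<in> borel_measurable N" "w \<in> borel_measurable N" "w' \<in> borel_measurable N"
  shows "(\<lambda>x. kD D (f x) (w x, w' x)) \<in> borel_measurable N" "(\<lambda>x. kD Dt (f x) (w x, w' x)) \<in> borel_measurable N"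
  unfolding kD_def by measurable

lemma g_int: "integrable LL (\<lambda>z. g (fst z) (snd z) * norm (b - a))"
  using g_integrable by (simp add: case_prod_beta')

lemma kD_integrable: "integrable LL (kD D r)" "(\<integral>z. \<bar>kD D r z\<bar> \<partial>LL) \<le> G"
proof -
  have [measurable]: "kD D r \<in> borel_measurable LL"
    using kD_meas(1)[of "\<lambda>_. r" "LL" fst snd] by simp
  show i: "integrable LL (kD D r)"
    by (rule Bochner_Integration.integrable_bound[OF g_int]) (auto simp: kD_le g_nonneg intro: order_trans[OF kD_le])
  have "(\<integral>z. \<bar>kD D r z\<bar> \<partial>LL) \<le> (\<integral>z. g (fst z) (snd z) * norm (b - a) \<partial>LL)"
    by (intro integral_mono integrable_abs i g_int kD_le)
  then show "(\<integral>z. \<bar>kD D r z\<bar> \<partial>LL) \<le> G" by (simp add: G_def mult.commute)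
qed

lemma P_\<gamma>: "P (\<gamma> r) = density lborel (\<lambda>x. ennreal (q r x))"
  unfolding q_def by (rule P_density[OF \<gamma>_in])

lemma integrable_P: "f \<in> borel_measurable borel \<Longrightarrow> integrable (P (\<gamma> r)) f \<longleftrightarrow> integrable lborel (\<lambda>x. q r x * f x :: real)"
  unfolding P_\<gamma> by (subst integrable_density) (auto simp: q_nonneg)

lemma integral_P: "f \<in> borel_measurable borel \<Longrightarrow> (\<integral>x. f x \<partial>P (\<gamma> r)) = (\<integral>x. q r x * f x \<partial>lborel :: real)"
  unfolding P_\<gamma> by (subst integral_density) (auto simp: q_nonneg)

lemma PP_\<gamma>: "P (\<gamma> r) \<Otimes>\<^sub>M P (\<gamma> r) = density LL (\<lambda>z. ennreal (q r (fst z) * q r (snd z)))"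
proof -
  interpret prob_space "P (\<gamma> r)" by (rule P_prob[OF \<gamma>_in])
  have "sigma_finite_measure (density lborel (\<lambda>x. ennreal (q r x)))"
    unfolding P_\<gamma>[symmetric] by unfold_locales
  then have "P (\<gamma> r) \<Otimes>\<^sub>M P (\<gamma> r) = density LL (\<lambda>(x, y). ennreal (q r x) * ennreal (q r y))"
    unfolding P_\<gamma> by (intro pair_measure_density) (auto intro: lborel.sigma_finite_measure_axioms)
  then show ?thesis by (simp add: ennreal_mult q_nonneg case_prod_beta')
qed

lemma integrable_PP:
  "f \<in> borel_measurable (borel \<Otimes>\<^sub>M borel) \<Longrightarrow>
    integrable (P (\<gamma> r) \<Otimes>\<^sub>M P (\<gamma> r)) f \<longleftrightarrow> integrable LL (\<lambda>z. (q r (fst z) * q r (snd z)) * f z :: real)"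
  unfolding PP_\<gamma> by (subst integrable_density) (auto simp: q_nonneg cong: measurable_cong_sets)

lemma integral_PP:
  "f \<in> borel_measurable (borel \<Otimes>\<^sub>M borel) \<Longrightarrow>
    (\<integral>z. f z \<partial>(P (\<gamma> r) \<Otimes>\<^sub>M P (\<gamma> r))) = (\<integral>z. (q r (fst z) * q r (snd z)) * f z \<partial>LL :: real)"
  unfolding PP_\<gamma> by (subst integral_density) (auto simp: q_nonneg cong: measurable_cong_sets)

text \<open>The symmetrized kernel of the quadratic part. Weighted with the two densities it becomes
  \<open>kD Dt\<close>, see \<open>qqU\<close>.\<close>

definition "U r z = k (fst z) (snd z) * (s r (fst z) + s r (snd z))"

lemma U_meas'[measurable]: "U r \<in> borel_measurable (borel \<Otimes>\<^sub>M borel)"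
  unfolding U_def by measurable

lemma qqU: "(q r (fst z) * q r (snd z)) * U r z = kD Dt r z"
  by (simp add: U_def kD_def q_s[symmetric] algebra_simps)

text \<open>If both densities are positive, \<open>Dt\<close> and \<open>D\<close> agree at both
  points; otherwise the product of the densities is 0, and so is \<open>kD Dt\<close> by
  \<open>qqU\<close>. The domination in (R) thus passes from the true derivative to the one built
  from the score.\<close>

lemma kDt_le: "\<bar>kD Dt r z\<bar> \<le> \<bar>kD D r z\<bar>"
  using kDt_cases[of r z] qqU[of r z] by auto

lemma kDt_integrable: "integrable LL (kD Dt r)" "(\<integral>z. \<bar>kD Dt r z\<bar> \<partial>LL) \<le> G"
proof -
  have [measurable]: "kD Dt r \<in> borel_measurable LL"
    using kD_meas(2)[of "\<lambda>_. r" "LL" fst snd] by simp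
  show i: "integrable LL (kD Dt r)"
    by (rule Bochner_Integration.integrable_bound[OF kD_integrable(1)[of r]]) (auto simp: kDt_le)
  have "(\<integral>z. \<bar>kD Dt r z\<bar> \<partial>LL) \<le> (\<integral>z. \<bar>kD D r z\<bar> \<partial>LL)"
    by (intro integral_mono integrable_abs i kD_integrable(1) kDt_le)
  then show "(\<integral>z. \<bar>kD Dt r z\<bar> \<partial>LL) \<le> G" using kD_integrable(2)[of r] by simp
qed

text \<open>By symmetry of k the score may be attached to either argument of an off-diagonal pair.
  Using both versions turns 2 / (M (M - 1)) times the sum of k s into 1 / (M (M - 1)) times the sum
  of \<open>U\<close>.\<close>

lemma h_U: "h r y = 1 / (real M * (real M - 1)) * (\<Sum>i\<in>{1..M}. \<Sum>j\<in>{1..M} - {i}. U r (y i, y j))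
    - 2 / real M * (\<Sum>i\<in>{1..M}. \<alpha> (y i) * s r (y i))"
proof -
  let ?I = "{1..M}"
  have "(\<Sum>i\<in>?I. \<Sum>j\<in>?I - {i}. U r (y i, y j)) =
      (\<Sum>i\<in>?I. \<Sum>j\<in>?I - {i}. k (y i) (y j) * s r (y i)) + (\<Sum>i\<in>?I. \<Sum>j\<in>?I - {i}. k (y i) (y j) * s r (y j))"
    by (simp add: U_def distrib_left sum.distrib)
  also have "(\<Sum>i\<in>?I. \<Sum>j\<in>?I - {i}. k (y i) (y j) * s r (y j)) = (\<Sum>i\<in>?I. \<Sum>j\<in>?I - {i}. k (y i) (y j) * s r (y i))"
    by (subst sum_offdiag_swap) (auto simp: k_symmetric)
  finally have U: "(\<Sum>i\<in>?I. \<Sum>j\<in>?I - {i}. U r (y i, y j)) = 2 * (\<Sum>i\<in>?I. \<Sum>j\<in>?I - {i}. k (y i) (y j) * s r (y i))"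
    by simp
  have "h r y = 2 / real M * (\<Sum>j=1..M. (1 / (real M - 1) * (\<Sum>l\<in>{1..M} - {j}. k (y j) (y l)) - \<alpha> (y j)) * s r (y j))"
    by (simp add: h_def stoch_grad_def inner_sum_left s_def \<alpha>_def)
  also have "\<dots> = 2 / real M * ((1 / (real M - 1)) * (\<Sum>i\<in>?I. \<Sum>j\<in>?I - {i}. k (y i) (y j) * s r (y i)) - (\<Sum>i\<in>?I. \<alpha> (y i) * s r (y i)))"
    by (simp add: left_diff_distrib sum_subtractf sum_distrib_left sum_distrib_right mult.assoc)
  finally show ?thesis unfolding U by (simp add: right_diff_distrib)
qed

text \<open>The constants do not depend on r; this uniformity is what allows integration over the
  segment.\<close>

lemma u_stat: "u_statistic (P (\<gamma> r)) {1..M} (U r) (\<lambda>x. \<alpha> x * s r x) G B' (h r)"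
proof -
  interpret prob_space "P (\<gamma> r)" by (rule P_prob[OF \<gamma>_in])
  have sP[measurable_cong]: "sets (P (\<gamma> r)) = sets borel" by (rule sets_P[OF \<gamma>_in])
  show ?thesis
  proof (unfold_locales)
    show "finite {1..M}" "card {1..M} \<ge> 2" using M by auto
    have iU: "integrable LL (\<lambda>z. (q r (fst z) * q r (snd z)) * U r z)"
      unfolding qqU by (rule kDt_integrable)
    then show "integrable (P (\<gamma> r) \<Otimes>\<^sub>M P (\<gamma> r)) (U r)"
      by (subst integrable_PP[OF U_meas'])
    have "(\<integral>z. \<bar>U r z\<bar> \<partial>(P (\<gamma> r) \<Otimes>\<^sub>M P (\<gamma> r))) = (\<integral>z. \<bar>kD Dt r z\<bar> \<partial>LL)"
      unfolding qqU[symmetric] by (subst integral_PP) (auto simp: abs_mult q_nonneg)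
    then show "(\<integral>z. \<bar>U r z\<bar> \<partial>(P (\<gamma> r) \<Otimes>\<^sub>M P (\<gamma> r))) \<le> G"
      using kDt_integrable(2)[of r] by simp
    show "(\<lambda>x. \<alpha> x * s r x) \<in> borel_measurable (P (\<gamma> r))" by measurable
    show "h r = (\<lambda>y. 1 / (real (card {1..M}) * (real (card {1..M}) - 1)) * (\<Sum>i\<in>{1..M}. \<Sum>j\<in>{1..M} - {i}. U r (y i, y j))
            - 2 / real (card {1..M}) * (\<Sum>i\<in>{1..M}. \<alpha> (y i) * s r (y i)))"
      using h_U by (simp add: fun_eq_iff)
    show "B' \<ge> 0" by (rule B'_nonneg)
    have "(\<integral>\<^sup>+y. ennreal ((h r y)\<^sup>2) \<partial>iid M (P (\<gamma> r))) \<le>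
        (\<integral>\<^sup>+y. ennreal ((norm (b - a))\<^sup>2) * ennreal ((norm (ghat xs (\<gamma> r) y))\<^sup>2) \<partial>iid M (P (\<gamma> r)))"
    proof (rule nn_integral_mono)
      fix y
      have "\<bar>h r y\<bar>\<^sup>2 \<le> (norm (ghat xs (\<gamma> r) y) * norm (b - a))\<^sup>2"
        unfolding h_def by (intro power_mono Cauchy_Schwarz_ineq2) auto
      then show "ennreal ((h r y)\<^sup>2) \<le> ennreal ((norm (b - a))\<^sup>2) * ennreal ((norm (ghat xs (\<gamma> r) y))\<^sup>2)"
        by (subst ennreal_mult''[symmetric]) (auto simp: power_mult_distrib mult.commute intro!: ennreal_leI)
    qed
    also have "\<dots> = ennreal ((norm (b - a))\<^sup>2) * (\<integral>\<^sup>+y. ennreal ((norm (ghat xs (\<gamma> r) y))\<^sup>2) \<partial>iid M (P (\<gamma> r)))"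
    proof (rule nn_integral_cmult)
      have "(\<lambda>y. ghat xs (\<gamma> r) y) \<in> borel_measurable Y\<^sub>M"
        by (rule stoch_grad_measurable) (use \<gamma>_in in \<open>auto simp: space_restrict_space\<close>)
      then show "(\<lambda>y. ennreal ((norm (ghat xs (\<gamma> r) y))\<^sup>2)) \<in> borel_measurable (iid M (P (\<gamma> r)))"
        unfolding measurable_cong_sets[OF sets_iid[OF \<gamma>_in] refl] by measurable
    qed
    also have "\<dots> \<le> ennreal ((norm (b - a))\<^sup>2) * ennreal (B\<^sup>2)"
      by (intro mult_left_mono second_moment \<gamma>_in) auto
    also have "\<dots> = ennreal (B'\<^sup>2)"
      by (simp add: B'_def ennreal_mult''[symmetric] power_mult_distrib mult.commute)
    finally show "(\<integral>\<^sup>+y. ennreal ((h r y)\<^sup>2) \<partial>Pi\<^sub>M {1..M} (\<lambda>_. P (\<gamma> r))) \<le> ennreal (B'\<^sup>2)"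
      by (simp add: iid_def)
  qed
qed

text \<open>For d = D, the combination u - 2 w is the formal derivative in r of the criterion with
  all integrals restricted to E.\<close>

definition "u d E r = (\<integral>z. kD d r z * ind E z \<partial>LL)"
definition "w d E r = (\<integral>x. \<alpha> x * d r x * indicator E x \<partial>lborel)" for d :: "real \<Rightarrow> 'x \<Rightarrow> real"

lemma \<alpha>Dt_integrable: "integrable lborel (\<lambda>x. \<alpha> x * Dt r x)" "(\<integral>x. \<bar>\<alpha> x * Dt r x\<bar> \<partial>lborel) \<le> C"
proof -
  interpret us: u_statistic "P (\<gamma> r)" "{1..M}" "U r" "\<lambda>x. \<alpha> x * s r x" G B' "h r" by (rule u_stat)
  have eq: "q r x * (\<alpha> x * s r x) = \<alpha> x * Dt r x" for x by (simp add: q_s[symmetric])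
  show "integrable lborel (\<lambda>x. \<alpha> x * Dt r x)"
    using us.b_integrable unfolding eq[symmetric] by (subst (asm) integrable_P) auto
  have "(\<integral>x. \<bar>\<alpha> x * Dt r x\<bar> \<partial>lborel) = (\<integral>x. \<bar>\<alpha> x * s r x\<bar> \<partial>P (\<gamma> r))"
    unfolding eq[symmetric] by (subst integral_P) (auto simp: abs_mult q_nonneg)
  then show "(\<integral>x. \<bar>\<alpha> x * Dt r x\<bar> \<partial>lborel) \<le> C" using us.b_L1 by (simp add: C_def)
qed

lemma m_truncated:
  assumes E[measurable]: "E \<in> sets borel"
  shows "\<bar>m r - (u Dt E r - 2 * w Dt E r)\<bar> \<le> err (1 - measure (P (\<gamma> r)) E)"
proof -
  interpret us: u_statistic "P (\<gamma> r)" "{1..M}" "U r" "\<lambda>x. \<alpha> x * s r x" G B' "h r" by (rule u_stat)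
  have sP[measurable_cong]: "sets (P (\<gamma> r)) = sets borel" by (rule sets_P[OF \<gamma>_in])
  have "(\<integral>z. U r z * (indicator E (fst z) * indicator E (snd z)) \<partial>(P (\<gamma> r) \<Otimes>\<^sub>M P (\<gamma> r))) = u Dt E r"
    unfolding u_def ind_def qqU[symmetric] by (subst integral_PP) (auto simp: mult.assoc)
  moreover have "(\<integral>x. \<alpha> x * s r x * indicator E x \<partial>P (\<gamma> r)) = w Dt E r"
    unfolding w_def q_s[symmetric] by (subst integral_P) (auto simp: algebra_simps)
  moreover have "E \<in> sets (P (\<gamma> r))" by (simp add: sP)
  ultimately show ?thesis
    using us.h_truncated_mean[of E] by (simp add: m_def iid_def err_def C_def)
qed

end

section \<open>The criterion restricted to a set of observations, and its derivative at the start of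
  the segment\<close>

context sgd_segment
begin

definition "\<phi> E r = (\<integral>z. k (fst z) (snd z) * (q r (fst z) * q r (snd z)) * ind E z \<partial>LL)
   - 2 * (\<integral>x. \<alpha> x * q r x * indicator E x \<partial>lborel)"

lemma ind_cases: "ind E z = 0 \<or> (ind E z = 1 \<and> fst z \<in> E \<and> snd z \<in> E)"
  by (auto simp: ind_def indicator_def)

lemma ind_meas[measurable]:
  assumes [measurable]: "E \<in> sets borel"
  shows "ind E \<in> borel_measurable (borel \<Otimes>\<^sub>M borel)"
  unfolding ind_def by measurable

lemma kqq_integrable:
  assumes [measurable]: "E \<in> sets borel"
  shows "integrable LL (\<lambda>z. k (fst z) (snd z) * (q r (fst z) * q r (snd z)) * ind E z)"
proof -
  interpret Q: prob_space "P (\<gamma> r)" by (rule P_prob[OF \<gamma>_in])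
  interpret QQ: pair_prob_space "P (\<gamma> r)" "P (\<gamma> r)" ..
  have sP: "sets (P (\<gamma> r) \<Otimes>\<^sub>M P (\<gamma> r)) = sets (borel \<Otimes>\<^sub>M borel)"
    by (intro sets_pair_measure_cong sets_P \<gamma>_in)
  have m: "(\<lambda>z. k (fst z) (snd z) * ind E z) \<in> borel_measurable (borel \<Otimes>\<^sub>M borel)" by measurable
  have "\<bar>k (fst z) (snd z) * ind E z\<bar> \<le> 1" for z
    using k_bounded[of "fst z" "snd z"] ind_cases[of E z] by auto
  then have "integrable (P (\<gamma> r) \<Otimes>\<^sub>M P (\<gamma> r)) (\<lambda>z. k (fst z) (snd z) * ind E z)"
    by (intro QQ.integrable_const_bound[where B=1]) (auto simp: measurable_cong_sets[OF sP refl] m)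
  then show ?thesis
    by (subst (asm) integrable_PP[OF m]) (simp add: mult_ac)
qed

lemma bounded_P_integrable:
  assumes "f \<in> borel_measurable borel" "\<And>x. \<bar>f x\<bar> \<le> 1"
  shows "integrable lborel (\<lambda>x. q r x * f x)"
proof -
  interpret Q: prob_space "P (\<gamma> r)" by (rule P_prob[OF \<gamma>_in])
  have "integrable (P (\<gamma> r)) f"
    using assms by (intro Q.integrable_const_bound[where B=1]) (auto simp: measurable_cong_sets[OF sets_P[OF \<gamma>_in] refl])
  then show ?thesis by (subst (asm) integrable_P[OF assms(1)])
qed

lemma \<alpha>q_integrable:
  assumes [measurable]: "E \<in> sets borel"
  shows "integrable lborel (\<lambda>x. \<alpha> x * q r x * indicator E x)"
proof -
  have "integrable lborel (\<lambda>x. q r x * (\<alpha> x * indicator E x))"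
    using \<alpha>_le by (intro bounded_P_integrable) (auto simp: indicator_def)
  then show ?thesis by (simp add: mult_ac)
qed

lemma crit_\<phi>: "crit k P n xs (\<gamma> r) = \<phi> UNIV r"
proof -
  interpret Q: prob_space "P (\<gamma> r)" by (rule P_prob[OF \<gamma>_in])
  have "(\<integral>z. k (fst z) (snd z) \<partial>(P (\<gamma> r) \<Otimes>\<^sub>M P (\<gamma> r))) =
      (\<integral>z. k (fst z) (snd z) * (q r (fst z) * q r (snd z)) * ind UNIV z \<partial>LL)"
    by (subst integral_PP) (auto simp: ind_def mult_ac)
  moreover have "1 / real n * (\<Sum>i=1..n. \<integral>y. k (xs i) y \<partial>P (\<gamma> r)) = (\<integral>x. \<alpha> x \<partial>P (\<gamma> r))"
  proof -
    have "integrable (P (\<gamma> r)) (k (xs i))" for i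
    proof -
      have "(\<lambda>y. k (xs i) y) \<in> borel_measurable borel" by measurable
      then show ?thesis
        by (intro Q.integrable_const_bound[where B=1])
          (auto simp: k_bounded measurable_cong_sets[OF sets_P[OF \<gamma>_in] refl])
    qed
    then show ?thesis by (simp add: \<alpha>_def Bochner_Integration.integral_sum)
  qed
  moreover have "(\<integral>x. \<alpha> x \<partial>P (\<gamma> r)) = (\<integral>x. \<alpha> x * q r x * indicator UNIV x \<partial>lborel)"
    by (subst integral_P) (auto simp: mult_ac)
  ultimately show ?thesis by (simp add: crit_def \<phi>_def)
qed

text \<open>The quadratic part is dominated through g at every r. The linear part is bounded by
  \<open>C\<close> at interior r only, where \<open>D\<close> and \<open>Dt\<close> agree.\<close>

lemma \<phi>_FTC:
  fixes s :: real
  assumes E[measurable]: "E \<in> sets borel" and s: "0 \<le> s" "s \<le> 1"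
  shows "set_integrable lborel {0<..<s} (\<lambda>r. u D E r - 2 * w D E r)"
    and "\<phi> E s - \<phi> E 0 = (LINT r:{0<..<s}|lborel. u D E r - 2 * w D E r)"
proof -
  have sf2: "sigma_finite_measure (lborel \<Otimes>\<^sub>M lborel :: ('x \<times> 'x) measure)"
    by (simp add: lborel_prod sigma_finite_lborel)
  let ?f1 = "\<lambda>r z. k (fst z) (snd z) * (q r (fst z) * q r (snd z)) * ind E z"
  let ?f1' = "\<lambda>r z. kD D r z * ind E z"
  have d1: "((\<lambda>r. ?f1 r z) has_real_derivative ?f1' r z) (at r within {0..1})" if "r \<in> {0..1}" for r z
    using q_deriv[OF that, of "fst z"] q_deriv[OF that, of "snd z"]
    by (auto intro!: derivative_eq_intros simp: kD_def algebra_simps)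
  have m1: "(\<lambda>z. ?f1' (snd z) (fst z)) \<in> borel_measurable (LL \<Otimes>\<^sub>M borel)"
    unfolding kD_def by measurable
  have b1: "(\<integral>\<^sup>+z. ennreal \<bar>?f1' r z\<bar> \<partial>LL) \<le> ennreal G" for r
  proof -
    have "(\<integral>\<^sup>+z. ennreal \<bar>?f1' r z\<bar> \<partial>LL) \<le> (\<integral>\<^sup>+z. ennreal \<bar>kD D r z\<bar> \<partial>LL)"
    proof (rule nn_integral_mono)
      fix z show "ennreal \<bar>?f1' r z\<bar> \<le> ennreal \<bar>kD D r z\<bar>"
        using ind_cases[of E z] by auto
    qed
    also have "\<dots> = ennreal (\<integral>z. \<bar>kD D r z\<bar> \<partial>LL)"
      by (intro nn_integral_eq_integral integrable_abs kD_integrable) auto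
    also have "\<dots> \<le> ennreal G" by (intro ennreal_leI kD_integrable)
    finally show ?thesis .
  qed
  note F1 = integral_FTC_parametric[OF sf2 s d1 m1 b1 kqq_integrable[OF E]]
  let ?f2 = "\<lambda>r x. \<alpha> x * q r x * indicator E x"
  let ?f2' = "\<lambda>r x. \<alpha> x * D r x * indicator E x"
  have d2: "((\<lambda>r. ?f2 r x) has_real_derivative ?f2' r x) (at r within {0..1})" if "r \<in> {0..1}" for r x
    using q_deriv[OF that, of x] by (auto intro!: derivative_eq_intros)
  have m2: "(\<lambda>z. ?f2' (snd z) (fst z)) \<in> borel_measurable (lborel \<Otimes>\<^sub>M borel)"
    by measurable
  have b2: "(\<integral>\<^sup>+x. ennreal \<bar>?f2' r x\<bar> \<partial>lborel) \<le> ennreal C" if "0 < r" "r < 1" for r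
  proof -
    have "(\<integral>\<^sup>+x. ennreal \<bar>?f2' r x\<bar> \<partial>lborel) \<le> (\<integral>\<^sup>+x. ennreal \<bar>\<alpha> x * Dt r x\<bar> \<partial>lborel)"
      by (rule nn_integral_mono) (auto simp: D_eq_Dt[OF that] indicator_def)
    also have "\<dots> = ennreal (\<integral>x. \<bar>\<alpha> x * Dt r x\<bar> \<partial>lborel)"
      by (intro nn_integral_eq_integral integrable_abs \<alpha>Dt_integrable) auto
    also have "\<dots> \<le> ennreal C" by (intro ennreal_leI \<alpha>Dt_integrable)
    finally show ?thesis .
  qed
  note F2 = integral_FTC_parametric[OF sigma_finite_lborel s d2 m2 b2 \<alpha>q_integrable[OF E]]
  have i1: "set_integrable lborel {0<..<s} (u D E)"
    using F1(1) unfolding u_def[abs_def] by simp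
  have i2: "set_integrable lborel {0<..<s} (\<lambda>r. 2 * w D E r)"
    using F2(1) unfolding w_def by simp
  show "set_integrable lborel {0<..<s} (\<lambda>r. u D E r - 2 * w D E r)"
    by (rule set_integral_diff(1)[OF i1 i2])
  have "\<phi> E s - \<phi> E 0 = (LINT r:{0<..<s}|lborel. u D E r) - (LINT r:{0<..<s}|lborel. 2 * w D E r)"
    using F1(2) F2(2) unfolding \<phi>_def u_def w_def by simp
  also have "\<dots> = (LINT r:{0<..<s}|lborel. u D E r - 2 * w D E r)"
    by (rule set_integral_diff(2)[OF i1 i2, symmetric])
  finally show "\<phi> E s - \<phi> E 0 = (LINT r:{0<..<s}|lborel. u D E r - 2 * w D E r)" .
qed

lemma uw_Dt: "0 < r \<Longrightarrow> r < 1 \<Longrightarrow> u D E r - 2 * w D E r = u Dt E r - 2 * w Dt E r"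
  by (simp add: u_def w_def kD_def D_eq_Dt)

lemma err_0: "err 0 = 0" by (simp add: err_def)

lemma err_mono: "0 \<le> t \<Longrightarrow> t \<le> t' \<Longrightarrow> err t \<le> err t'"
  unfolding err_def using B'_nonneg G_nonneg C_nonneg by (intro add_mono mult_mono real_sqrt_le_mono) auto

lemma err_tendsto: "(f \<longlongrightarrow> t) F \<Longrightarrow> ((\<lambda>i. err (f i)) \<longlongrightarrow> err t) F"
  unfolding err_def by (intro tendsto_intros)

text \<open>Truncation to UNIV costs nothing. With \<open>uw_Dt\<close> this makes m r the integrand
  in the formula for the increment of Crit.\<close>

lemma m_eq: "m r = u Dt UNIV r - 2 * w Dt UNIV r"
proof -
  interpret Q: prob_space "P (\<gamma> r)" by (rule P_prob[OF \<gamma>_in])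
  have "space (P (\<gamma> r)) = UNIV" using sets_eq_imp_space_eq[OF sets_P[OF \<gamma>_in[of r]]] by simp
  then have "measure (P (\<gamma> r)) UNIV = 1" using Q.prob_space by simp
  then show ?thesis using m_truncated[of UNIV r] by (simp add: err_0)
qed

text \<open>Both increments are integrals over interior points. The integrand for UNIV is m r
  itself, and truncation to E changes it by at most err \<delta>; no derivative at 0 is
  involved.\<close>

lemma \<phi>_diff_lower:
  fixes s :: real
  assumes E: "E \<in> sets borel" and s: "0 \<le> s" "s \<le> 1"
    and \<delta>: "\<And>r. 0 < r \<Longrightarrow> r < s \<Longrightarrow> 1 - measure (P (\<gamma> r)) E \<le> \<delta>"
  shows "\<phi> UNIV s - \<phi> UNIV 0 \<ge> \<phi> E s - \<phi> E 0 - s * err \<delta>"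
proof -
  have U: "UNIV \<in> sets (borel :: 'x measure)" by simp
  note FE = \<phi>_FTC[OF E s] and FU = \<phi>_FTC[OF U s]
  have ic: "set_integrable lborel {0<..<s} (\<lambda>r. err \<delta>)"
    unfolding set_integrable_def using s by simp
  have "(LINT r:{0<..<s}|lborel. (u D E r - 2 * w D E r) - err \<delta>) \<le> (LINT r:{0<..<s}|lborel. u D UNIV r - 2 * w D UNIV r)"
  proof (rule set_integral_mono[OF set_integral_diff(1)[OF FE(1) ic] FU(1)])
    fix r assume "r \<in> {0<..<s}"
    then have r: "0 < r" "r < s" "r < 1" using s by auto
    interpret Q: prob_space "P (\<gamma> r)" by (rule P_prob[OF \<gamma>_in])
    have "err (1 - measure (P (\<gamma> r)) E) \<le> err \<delta>"
      using \<delta>[OF r(1,2)] Q.prob_le_1[of E] by (intro err_mono) auto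
    then show "u D E r - 2 * w D E r - err \<delta> \<le> u D UNIV r - 2 * w D UNIV r"
      using m_truncated[OF E, of r] unfolding uw_Dt[OF r(1,3)] m_eq[symmetric] by linarith
  qed
  moreover have "(LINT r:{0<..<s}|lborel. (u D E r - 2 * w D E r) - err \<delta>) = \<phi> E s - \<phi> E 0 - (LINT r:{0<..<s}|lborel. err \<delta>)"
    using set_integral_diff(2)[OF FE(1) ic] FE(2) by simp
  moreover have "(LINT r:{0<..<s}|lborel. err \<delta>) = s * err \<delta>"
    using s by (simp add: set_lebesgue_integral_def)
  ultimately show ?thesis using FU(2) by simp
qed

text \<open>On \<open>nice N\<close> the density stays within \<open>N r\<close> of its initial value, so differentiation at \<open>0\<close> is dominated.\<close>

definition "nice N = {x. norm x \<le> real N \<and> 0 < q 0 x \<and> q 0 x \<le> real N \<and>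
  (\<forall>t::rat. 0 < t \<and> of_rat t * real N \<le> 1 \<longrightarrow> \<bar>q (of_rat t) x - q 0 x\<bar> \<le> real N * of_rat t)}"

text \<open>The condition on the quotients is imposed at rational t only, which leaves a countable
  intersection.\<close>

lemma nice_sets[measurable]: "nice N \<in> sets borel"
proof -
  have "{x \<in> space borel. norm x \<le> real N \<and> 0 < q 0 x \<and> q 0 x \<le> real N \<and>
    (\<forall>t::rat. 0 < t \<and> of_rat t * real N \<le> 1 \<longrightarrow> \<bar>q (of_rat t) x - q 0 x\<bar> \<le> real N * of_rat t)} \<in> sets borel"
    by measurable
  then show ?thesis by (simp add: nice_def)
qed

lemma nice_rat:
  assumes "x \<in> nice N" "0 < t" "of_rat t * real N \<le> 1"
  shows "\<bar>q (of_rat t) x - q 0 x\<bar> \<le> real N * of_rat t"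
  using assms unfolding nice_def by blast

text \<open>By continuity a failure at r would persist at a rational slightly below r, where t N
  \<le> 1 still holds.\<close>

lemma nice_real:
  assumes x: "x \<in> nice N" and r: "0 < r" "r * real N \<le> 1" "1 \<le> N"
  shows "\<bar>q r x - q 0 x\<bar> \<le> real N * r"
proof (rule ccontr)
  assume "\<not> ?thesis"
  then have pos: "0 < \<bar>q r x - q 0 x\<bar> - real N * r" by simp
  have r1: "r \<in> {0..1}"
  proof -
    have "r * 1 \<le> r * real N" using r by (intro mult_left_mono) auto
    then have "r \<le> 1" using r(2) by linarith
    then show ?thesis using r(1) by simp
  qed
  have "continuous_on {0..1} (\<lambda>r. \<bar>q r x - q 0 x\<bar> - real N * r)"
    by (intro continuous_intros q_continuous)
  then have "\<exists>d>0. \<forall>r'\<in>{0..1}. dist r' r < d \<longrightarrow> dist (\<bar>q r' x - q 0 x\<bar> - real N * r') (\<bar>q r x - q 0 x\<bar> - real N * r) < \<bar>q r x - q 0 x\<bar> - real N * r"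
    using r1 pos unfolding continuous_on_iff by blast
  then obtain d where d: "d > 0" "\<And>r'. r' \<in> {0..1} \<Longrightarrow> dist r' r < d \<Longrightarrow>
      dist (\<bar>q r' x - q 0 x\<bar> - real N * r') (\<bar>q r x - q 0 x\<bar> - real N * r) < \<bar>q r x - q 0 x\<bar> - real N * r"
    by blast
  obtain t where t: "max (r - d) 0 < of_rat t" "of_rat t < r"
    using of_rat_dense[of "max (r - d) 0" r] d(1) r(1) by auto
  have "of_rat t * real N \<le> r * real N" using t(2) by (intro mult_right_mono) auto
  then have tK: "of_rat t * real N \<le> 1" using r(2) by linarith
  have "of_rat t \<le> (1::real)" using t(2) r1 unfolding atLeastAtMost_iff by linarith
  then have t01: "of_rat t \<in> {0..1::real}" "dist (of_rat t) r < d" using t by (auto simp: dist_real_def)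
  have "0 < t" using t(1) by simp
  from nice_rat[OF x this tK]
  have "\<bar>q (of_rat t) x - q 0 x\<bar> \<le> real N * of_rat t" .
  then show False using d(2)[OF t01] by (simp add: dist_real_def)
qed

lemma nice_mono: "N \<le> N' \<Longrightarrow> nice N \<subseteq> nice N'"
proof
  fix x assume N: "N \<le> N'" and x: "x \<in> nice N"
  have "\<bar>q (of_rat t) x - q 0 x\<bar> \<le> real N' * of_rat t" if t: "0 < t" "of_rat t * real N' \<le> 1" for t :: rat
  proof -
    have t0: "0 \<le> (of_rat t :: real)" using t(1) by simp
    have "of_rat t * real N \<le> of_rat t * real N'" using N t0 by (intro mult_left_mono) auto
    then have "of_rat t * real N \<le> 1" using t(2) by linarith
    then have "\<bar>q (of_rat t) x - q 0 x\<bar> \<le> real N * of_rat t" by (rule nice_rat[OF x t(1)])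
    also have "\<dots> \<le> real N' * of_rat t" using N t0 by (intro mult_right_mono) auto
    finally show ?thesis .
  qed
  then show "x \<in> nice N'" using x N by (auto simp: nice_def)
qed

text \<open>Differentiability at 0 bounds the difference quotients near 0 by |D 0 x| + 1. The side
  condition t N \<le> 1 lets the same N also encode how near.\<close>

lemma nice_Union: "(\<Union>N. nice N) = {x. 0 < q 0 x}"
proof (intro set_eqI iffI)
  fix x assume "x \<in> {x. 0 < q 0 x}"
  then have q0: "0 < q 0 x" by simp
  have "((\<lambda>y. (q y x - q 0 x) / (y - 0)) \<longlongrightarrow> D 0 x) (at 0 within {0..1})"
    using q_deriv[of 0 x] by (simp add: has_field_derivative_iff)
  then have "\<forall>\<^sub>F y in at 0 within {0..1}. dist ((q y x - q 0 x) / (y - 0)) (D 0 x) < 1"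
    by (rule tendstoD) simp
  then obtain d where d: "d > 0" "\<And>y. y \<in> {0..1} \<Longrightarrow> y \<noteq> 0 \<Longrightarrow> dist y 0 < d \<Longrightarrow> dist ((q y x - q 0 x) / (y - 0)) (D 0 x) < 1"
    unfolding eventually_at by blast
  obtain N where N: "\<bar>D 0 x\<bar> + 1 + 2 / d + norm x + q 0 x + 1 \<le> real N"
    using real_arch_simple by blast
  have pos: "0 < 2 / d" using d(1) by simp
  have "\<bar>q (of_rat t) x - q 0 x\<bar> \<le> real N * of_rat t" if t: "0 < t" "of_rat t * real N \<le> 1" for t :: rat
  proof -
    have t0: "0 < (of_rat t :: real)" using t(1) by simp
    have K1: "1 \<le> real N" "2 / d \<le> real N" "\<bar>D 0 x\<bar> + 1 \<le> real N"
      using N pos norm_ge_zero[of x] q0 abs_ge_zero[of "D 0 x"] by linarith+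
    have "of_rat t * 1 \<le> of_rat t * real N" using t0 K1 by (intro mult_left_mono) auto
    then have t1: "of_rat t \<le> (1::real)" using t(2) by linarith
    have "of_rat t * (2 / d) \<le> of_rat t * real N" using t0 K1 by (intro mult_left_mono) auto
    then have "of_rat t * (2 / d) \<le> 1" using t(2) by linarith
    then have "of_rat t * 2 \<le> d" using d(1) by (simp add: field_simps)
    then have td: "of_rat t < d" using t0 by linarith
    have "dist ((q (of_rat t) x - q 0 x) / (of_rat t - 0)) (D 0 x) < 1"
      using t0 t1 td by (intro d(2)) auto
    then have "\<bar>(q (of_rat t) x - q 0 x) / of_rat t\<bar> \<le> real N"
      using K1(3) unfolding dist_real_def diff_zero by linarith
    then have "\<bar>q (of_rat t) x - q 0 x\<bar> / of_rat t \<le> real N"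
      unfolding abs_divide abs_of_pos[OF t0] .
    then show ?thesis using t0 by (simp add: pos_divide_le_eq)
  qed
  moreover have "norm x \<le> real N" "q 0 x \<le> real N"
    using N pos norm_ge_zero[of x] q0 abs_ge_zero[of "D 0 x"] by linarith+
  ultimately have "x \<in> nice N" using q0 by (auto simp: nice_def)
  then show "x \<in> (\<Union>N. nice N)" by blast
qed (auto simp: nice_def)

lemma measure_P: "E \<in> sets borel \<Longrightarrow> measure (P (\<gamma> r)) E = (\<integral>x. q r x * indicator E x \<partial>lborel)"
  using integral_P[of "indicator E" r] sets_eq_imp_space_eq[OF sets_P[OF \<gamma>_in[of r]]] by (simp add: sets_P[OF \<gamma>_in])

text \<open>The union misses only the zeros of the density at a, a null set for P (\<gamma>
  0).\<close>

lemma nice_measure_tendsto: "(\<lambda>N. measure (P (\<gamma> 0)) (nice N)) \<longlonglongrightarrow> 1"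
proof -
  interpret Q: prob_space "P (\<gamma> 0)" by (rule P_prob[OF \<gamma>_in])
  have sp: "space (P (\<gamma> 0)) = UNIV" using sets_eq_imp_space_eq[OF sets_P[OF \<gamma>_in[of 0]]] by simp
  have "(\<lambda>N. measure (P (\<gamma> 0)) (nice N)) \<longlonglongrightarrow> measure (P (\<gamma> 0)) (\<Union>N. nice N)"
    by (rule Q.finite_Lim_measure_incseq) (auto simp: sets_P[OF \<gamma>_in] incseq_def nice_mono)
  moreover have "measure (P (\<gamma> 0)) (\<Union>N. nice N) = measure (P (\<gamma> 0)) UNIV"
  proof -
    have 1: "{x. 0 < q 0 x} \<in> sets borel" by measurable
    have 2: "q 0 x * indicator {x. 0 < q 0 x} x = q 0 x * indicator UNIV x" for x
      using q_nonneg[of 0 x] by (auto simp: indicator_def)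
    show ?thesis unfolding nice_Union measure_P[OF 1] measure_P[OF sets.top[of borel, unfolded space_borel]]
      by (intro Bochner_Integration.integral_cong refl 2)
  qed
  ultimately show ?thesis using Q.prob_space by (simp add: sp)
qed

lemma nice_finite: "integrable lborel (\<lambda>x. indicator (nice N) x * c :: real)"
proof -
  have "emeasure lborel (nice N) \<le> emeasure lborel (cball (0::'x) (real N))"
    by (rule emeasure_mono) (auto simp: nice_def)
  also have "\<dots> < \<infinity>" by (rule emeasure_lborel_cball_finite)
  finally have "emeasure lborel (nice N) < \<infinity>" .
  then show ?thesis by simp
qed

text \<open>The set has finite volume, so a change of the density by at most N r costs at most N r
  times that volume. A set nearly full for the law at 0 therefore stays nearly full for all small
  r.\<close>

lemma nice_measure_lower:
  assumes r: "0 < r" "r * real N \<le> 1" "1 \<le> N"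
  shows "measure (P (\<gamma> r)) (nice N) \<ge> measure (P (\<gamma> 0)) (nice N) - r * (real N * measure lborel (nice N))"
proof -
  let ?i = "indicator (nice N) :: 'x \<Rightarrow> real"
  have i: "integrable lborel (\<lambda>x. q r x * ?i x)" for r
    by (intro bounded_P_integrable) (auto simp: indicator_def)
  have "(\<integral>x. q 0 x * ?i x \<partial>lborel) \<le> (\<integral>x. q r x * ?i x + ?i x * (real N * r) \<partial>lborel)"
  proof (intro integral_mono Bochner_Integration.integrable_add i nice_finite)
    fix x show "q 0 x * ?i x \<le> q r x * ?i x + ?i x * (real N * r)"
      using nice_real[OF _ r, of x] by (auto simp: indicator_def)
  qed
  also have "\<dots> = (\<integral>x. q r x * ?i x \<partial>lborel) + (\<integral>x. ?i x * (real N * r) \<partial>lborel)"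
    by (intro Bochner_Integration.integral_add i nice_finite)
  also have "(\<integral>x. ?i x * (real N * r) \<partial>lborel) = r * (real N * measure lborel (nice N))"
    by simp
  finally show ?thesis unfolding measure_P[OF nice_sets] by simp
qed

text \<open>Dominated convergence on a set of finite volume. The sequence starts at 1 / (N + 1), so
  that every t i N \<le> 1, as \<open>nice_real\<close> requires.\<close>

lemma \<phi>_nice_derivative:
  assumes N: "1 \<le> N"
  defines "t \<equiv> \<lambda>i. 1 / real (Suc (i + N))"
  shows "(\<lambda>i. (\<phi> (nice N) (t i) - \<phi> (nice N) 0) / t i) \<longlonglongrightarrow> u D (nice N) 0 - 2 * w D (nice N) 0"
proof -
  let ?E = "nice N"
  let ?i = "indicator ?E :: 'x \<Rightarrow> real"
  have t: "0 < t i" "t i \<le> 1" "t i * real N \<le> 1" for i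
    by (auto simp: t_def divide_le_eq)
  have ql: "(\<lambda>i. (q (t i) x - q 0 x) / t i) \<longlonglongrightarrow> D 0 x" for x
    using LIMSEQ_ignore_initial_segment[OF real_derivative_LIMSEQ[OF q_deriv[of 0 x]], of N]
    by (simp add: t_def mult.commute)
  have t0: "t \<longlonglongrightarrow> 0"
    unfolding t_def using LIMSEQ_ignore_initial_segment[OF lim_inverse_n'[THEN LIMSEQ_Suc], of N] by simp
  have qc: "(\<lambda>i. q (t i) x) \<longlonglongrightarrow> q 0 x" for x
    using t by (intro continuous_on_tendsto_compose[OF q_continuous t0] always_eventually allI) (auto simp: less_imp_le)
  have dq: "\<bar>(q (t i) x - q 0 x) / t i\<bar> \<le> real N" if "x \<in> ?E" for i x
    using nice_real[OF that t(1,3) N] t(1)[of i] by (simp add: abs_divide divide_le_eq)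
  have qK: "\<bar>q (t i) x\<bar> \<le> 2 * real N" if "x \<in> ?E" for i x
  proof -
    have "\<bar>q (t i) x - q 0 x\<bar> \<le> real N * t i" using nice_real[OF that t(1,3) N] .
    also have "\<dots> \<le> real N * 1" using t by (intro mult_left_mono) auto
    finally have "\<bar>q (t i) x - q 0 x\<bar> \<le> real N" by simp
    moreover have "0 < q 0 x" "q 0 x \<le> real N" using that by (auto simp: nice_def)
    ultimately show ?thesis by linarith
  qed
  have "(\<lambda>i. \<integral>x. \<alpha> x * ((q (t i) x - q 0 x) / t i) * ?i x \<partial>lborel) \<longlonglongrightarrow> (\<integral>x. \<alpha> x * D 0 x * ?i x \<partial>lborel)"
  proof (rule integral_dominated_convergence)
    show "integrable lborel (\<lambda>x. ?i x * real N)" by (rule nice_finite)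
    show "AE x in lborel. (\<lambda>i. \<alpha> x * ((q (t i) x - q 0 x) / t i) * ?i x) \<longlonglongrightarrow> \<alpha> x * D 0 x * ?i x"
      by (intro always_eventually allI tendsto_intros ql)
    fix i show "AE x in lborel. norm (\<alpha> x * ((q (t i) x - q 0 x) / t i) * ?i x) \<le> ?i x * real N"
    proof (intro always_eventually allI)
      fix x
      have "\<bar>\<alpha> x\<bar> * \<bar>(q (t i) x - q 0 x) / t i\<bar> \<le> 1 * real N" if "x \<in> ?E"
        using \<alpha>_le dq[OF that] by (intro mult_mono) auto
      then show "norm (\<alpha> x * ((q (t i) x - q 0 x) / t i) * ?i x) \<le> ?i x * real N"
        by (auto simp: indicator_def abs_mult)
    qed
  qed measurable
  moreover have "(\<integral>x. \<alpha> x * ((q (t i) x - q 0 x) / t i) * ?i x \<partial>lborel) =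
      ((\<integral>x. \<alpha> x * q (t i) x * ?i x \<partial>lborel) - (\<integral>x. \<alpha> x * q 0 x * ?i x \<partial>lborel)) / t i" for i
  proof -
    have "\<alpha> x * ((q (t i) x - q 0 x) / t i) * ?i x = (\<alpha> x * q (t i) x * ?i x - \<alpha> x * q 0 x * ?i x) / t i" for x
      by (simp add: left_diff_distrib right_diff_distrib diff_divide_distrib)
    then show ?thesis
      using \<alpha>q_integrable[OF nice_sets[of N], of "t i"] \<alpha>q_integrable[OF nice_sets[of N], of 0]
      by (simp only: integral_divide_zero Bochner_Integration.integral_diff)
  qed
  ultimately have W: "(\<lambda>i. ((\<integral>x. \<alpha> x * q (t i) x * ?i x \<partial>lborel) - (\<integral>x. \<alpha> x * q 0 x * ?i x \<partial>lborel)) / t i) \<longlonglongrightarrow> w D ?E 0"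
    by (simp only: w_def)
  let ?L = "lborel \<Otimes>\<^sub>M lborel :: ('x \<times> 'x) measure"
  \<comment> \<open>Discrete product rule: q_t q_t' - q_0 q_0' = (q_t - q_0) q_t' + q_0 (q_t' -
    q_0'). On \<open>nice N\<close> the quotients are at most N, q_t at most 2 N and q_0 at most N,
    which gives the dominating constant 3 N^2.\<close>
  define Z where "Z i z = k (fst z) (snd z) * ((q (t i) (fst z) - q 0 (fst z)) / t i * q (t i) (snd z)
      + q 0 (fst z) * ((q (t i) (snd z) - q 0 (snd z)) / t i)) * ind ?E z" for i z
  have "(\<lambda>i. \<integral>z. Z i z \<partial>?L) \<longlonglongrightarrow> (\<integral>z. kD D 0 z * ind ?E z \<partial>?L)"
  proof (rule integral_dominated_convergence)
    have "integrable ?L (\<lambda>z. (?i (fst z) * (3 * real N * real N)) * ?i (snd z))"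
    proof -
      have "integrable ?L (\<lambda>(x, y). (?i x * (3 * real N * real N)) * ?i y)"
        using nice_finite[of N "3 * real N * real N"] nice_finite[of N 1]
        by (intro lborel_pair.Fubini_integrable) (auto simp: abs_mult)
      then show ?thesis by (simp add: case_prod_beta')
    qed
    then show "integrable ?L (\<lambda>z. ind ?E z * (3 * real N * real N))"
      by (simp add: ind_def mult_ac)
    show "AE z in ?L. (\<lambda>i. Z i z) \<longlonglongrightarrow> kD D 0 z * ind ?E z"
      unfolding Z_def kD_def by (intro always_eventually allI tendsto_intros ql qc)
    fix i show "AE z in ?L. norm (Z i z) \<le> ind ?E z * (3 * real N * real N)"
    proof (intro always_eventually allI)
      fix z
      show "norm (Z i z) \<le> ind ?E z * (3 * real N * real N)"
      proof (cases "ind ?E z = 0")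
        case False
        then have z: "ind ?E z = 1" "fst z \<in> ?E" "snd z \<in> ?E" using ind_cases[of ?E z] by auto
        let ?A = "(q (t i) (fst z) - q 0 (fst z)) / t i * q (t i) (snd z)"
        let ?B = "q 0 (fst z) * ((q (t i) (snd z) - q 0 (snd z)) / t i)"
        have "\<bar>?A\<bar> \<le> real N * (2 * real N)"
          unfolding abs_mult using dq[OF z(2)] qK[OF z(3)] by (intro mult_mono) auto
        moreover have "\<bar>?B\<bar> \<le> real N * real N"
          unfolding abs_mult using dq[OF z(3)] z(2) by (intro mult_mono) (auto simp: nice_def)
        ultimately have AB: "\<bar>?A + ?B\<bar> \<le> 3 * real N * real N"
          by (intro order_trans[OF abs_triangle_ineq]) simp
        have "\<bar>k (fst z) (snd z)\<bar> * \<bar>?A + ?B\<bar> \<le> 1 * (3 * real N * real N)"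
          using k_bounded AB by (intro mult_mono) auto
        then show ?thesis by (simp add: Z_def z(1) abs_mult)
      qed (simp add: Z_def)
    qed
  next
    show "(\<lambda>z. kD D 0 z * ind ?E z) \<in> borel_measurable ?L" unfolding kD_def by measurable
    show "Z i \<in> borel_measurable ?L" for i unfolding Z_def by measurable
  qed
  moreover have "(\<integral>z. Z i z \<partial>?L) = ((\<integral>z. k (fst z) (snd z) * (q (t i) (fst z) * q (t i) (snd z)) * ind ?E z \<partial>?L)
      - (\<integral>z. k (fst z) (snd z) * (q 0 (fst z) * q 0 (snd z)) * ind ?E z \<partial>?L)) / t i" for i
  proof -
    have "Z i z = (k (fst z) (snd z) * (q (t i) (fst z) * q (t i) (snd z)) * ind ?E z
      - k (fst z) (snd z) * (q 0 (fst z) * q 0 (snd z)) * ind ?E z) / t i" for z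
      using t(1)[of i] by (simp add: Z_def field_simps)
    then show ?thesis
      using kqq_integrable[OF nice_sets[of N], of "t i"] kqq_integrable[OF nice_sets[of N], of 0]
      by (simp only: integral_divide_zero Bochner_Integration.integral_diff)
  qed
  ultimately have "(\<lambda>i. ((\<integral>z. k (fst z) (snd z) * (q (t i) (fst z) * q (t i) (snd z)) * ind ?E z \<partial>?L)
      - (\<integral>z. k (fst z) (snd z) * (q 0 (fst z) * q 0 (snd z)) * ind ?E z \<partial>?L)) / t i) \<longlonglongrightarrow> u D ?E 0"
    by (simp only: u_def)
  from tendsto_diff[OF this tendsto_mult[OF tendsto_const[of 2] W]]
  show ?thesis
    by (rule Lim_transform_eventually) (intro always_eventually allI, simp add: \<phi>_def diff_divide_distrib)
qed

text \<open>On nice sets the density at 0 is positive, so there the score loses no derivative even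
  at the end point.\<close>

lemma uw_nice: "u D (nice N) 0 - 2 * w D (nice N) 0 = u Dt (nice N) 0 - 2 * w Dt (nice N) 0"
proof -
  have 1: "kD D 0 z * ind (nice N) z = kD Dt 0 z * ind (nice N) z" for z
    using ind_cases[of "nice N" z] by (auto simp: kD_def Dt_def nice_def)
  have 2: "\<alpha> x * D 0 x * indicator (nice N) x = \<alpha> x * Dt 0 x * indicator (nice N) x" for x
    by (auto simp: Dt_def nice_def indicator_def)
  show ?thesis unfolding u_def w_def by (simp only: 1 2)
qed

text \<open>By convexity the secant slopes from a are at most Crit(b) - Crit(a); up to err they are
  at least those of the truncated criterion. The limit t to 0 turns the latter into a derivative
  close to m 0, and the limit in N removes the errors.\<close>

theorem crit_subgradient:
  assumes convex: "convex_on \<Theta> (crit k P n xs)"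
  shows "(\<integral>y. ghat xs a y \<bullet> (b - a) \<partial>iid M (P a)) \<le> crit k P n xs b - crit k P n xs a"
proof -
  have \<gamma>0: "\<gamma> 0 = a" and \<gamma>1: "\<gamma> 1 = b" by (simp_all add: \<gamma>_def)
  have secant: "\<phi> UNIV s - \<phi> UNIV 0 \<le> s * (\<phi> UNIV 1 - \<phi> UNIV 0)" if s: "0 \<le> s" "s \<le> 1" for s :: real
  proof -
    have "crit k P n xs ((1 - s) *\<^sub>R a + s *\<^sub>R b) \<le> (1 - s) * crit k P n xs a + s * crit k P n xs b"
      using s ab by (intro convex_onD[OF convex]) auto
    moreover have "(1 - s) *\<^sub>R a + s *\<^sub>R b = \<gamma> s" using s by (simp add: \<gamma>_eq algebra_simps)
    ultimately show ?thesis unfolding crit_\<phi>[symmetric] \<gamma>0 \<gamma>1 by (simp add: algebra_simps)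
  qed
  \<comment> \<open>One \<open>err\<close> comes from truncating the increment, the other from
    comparing the truncated derivative at 0 with m 0.\<close>
  have K_bound: "m 0 - 2 * err (1 - measure (P (\<gamma> 0)) (nice N)) \<le> \<phi> UNIV 1 - \<phi> UNIV 0" if N: "1 \<le> N" for N
  proof -
    let ?E = "nice N"
    define t where "t = (\<lambda>i. 1 / real (Suc (i + N)))"
    define c where "c = real N * measure lborel ?E"
    have t: "0 < t i" "t i \<le> 1" "t i * real N \<le> 1" for i
      by (auto simp: t_def divide_le_eq)
    have t0: "t \<longlonglongrightarrow> 0"
      unfolding t_def using LIMSEQ_ignore_initial_segment[OF lim_inverse_n'[THEN LIMSEQ_Suc], of N] by simp
    have c0: "0 \<le> c" by (simp add: c_def)
    \<comment> \<open>Mass missed at times up to t i: what is missed at 0, plus a drift of at most t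
      i c that disappears in the limit.\<close>
    let ?\<delta> = "\<lambda>i. 1 - measure (P (\<gamma> 0)) ?E + t i * c"
    have ineq: "(\<phi> ?E (t i) - \<phi> ?E 0) / t i - err (?\<delta> i) \<le> \<phi> UNIV 1 - \<phi> UNIV 0" for i
    proof -
      have "1 - measure (P (\<gamma> r)) ?E \<le> ?\<delta> i" if r: "0 < r" "r < t i" for r
      proof -
        have "r * real N \<le> 1" using mult_right_mono[of r "t i" "real N"] r t(3)[of i] by simp
        from nice_measure_lower[OF r(1) this N]
        have "1 - measure (P (\<gamma> r)) ?E \<le> 1 - measure (P (\<gamma> 0)) ?E + r * c" by (simp add: c_def)
        also have "r * c \<le> t i * c" using r c0 by (intro mult_right_mono) auto
        finally show ?thesis by simp
      qed
      then have "\<phi> ?E (t i) - \<phi> ?E 0 - t i * err (?\<delta> i) \<le> \<phi> UNIV (t i) - \<phi> UNIV 0"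
        using t(1)[of i] t(2)[of i] by (intro \<phi>_diff_lower nice_sets) auto
      also have "\<dots> \<le> t i * (\<phi> UNIV 1 - \<phi> UNIV 0)"
        using t(1)[of i] t(2)[of i] by (intro secant) auto
      finally have "(\<phi> ?E (t i) - \<phi> ?E 0 - t i * err (?\<delta> i)) / t i \<le> \<phi> UNIV 1 - \<phi> UNIV 0"
        using t(1)[of i] by (simp add: divide_le_eq mult.commute)
      then show ?thesis using t(1)[of i] by (simp add: diff_divide_distrib)
    qed
    have "(\<lambda>i. ?\<delta> i) \<longlonglongrightarrow> 1 - measure (P (\<gamma> 0)) ?E + 0 * c"
      by (intro tendsto_intros t0)
    then have "(\<lambda>i. err (?\<delta> i)) \<longlonglongrightarrow> err (1 - measure (P (\<gamma> 0)) ?E)"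
      using err_tendsto by simp
    from tendsto_diff[OF \<phi>_nice_derivative[OF N] this]
    have "u D ?E 0 - 2 * w D ?E 0 - err (1 - measure (P (\<gamma> 0)) ?E) \<le> \<phi> UNIV 1 - \<phi> UNIV 0"
      by (rule LIMSEQ_le_const2) (use ineq in \<open>auto simp: t_def\<close>)
    then show ?thesis
      using m_truncated[OF nice_sets[of N], of 0] unfolding uw_nice by linarith
  qed
  have "(\<lambda>N. m 0 - 2 * err (1 - measure (P (\<gamma> 0)) (nice N))) \<longlonglongrightarrow> m 0 - 2 * err (1 - 1)"
    by (intro tendsto_intros err_tendsto nice_measure_tendsto)
  then have "m 0 - 2 * err (1 - 1) \<le> \<phi> UNIV 1 - \<phi> UNIV 0"
    by (rule LIMSEQ_le_const2) (use K_bound in blast)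
  then show ?thesis
    unfolding crit_\<phi>[symmetric] \<gamma>0 \<gamma>1 by (simp add: err_0 m_def h_def \<gamma>0)
qed

end

section \<open>Regret of the projected stochastic gradient algorithm\<close>

context sgd_model
begin

text \<open>Moving the parameter from the measure into the density reduces this to measurability of
  a parameter integral over Lebesgue measure.\<close>

lemma P_integral_measurable:
  assumes F: "(\<lambda>z. F (fst z) (snd z)) \<in> borel_measurable (N \<Otimes>\<^sub>M borel)" and f: "f \<in> measurable N R\<Theta>"
  shows "(\<lambda>\<omega>. \<integral>x. F \<omega> x \<partial>P (f \<omega>) :: real) \<in> borel_measurable N"
proof -
  have f': "f \<omega> \<in> \<Theta>" if "\<omega> \<in> space N" for \<omega>
    using measurable_space[OF f that] by (simp add: space_restrict_space)
  have eq: "(\<integral>x. F \<omega> x \<partial>P (f \<omega>)) = (\<integral>x. p (f \<omega>) x * F \<omega> x \<partial>lborel)" if \<omega>: "\<omega> \<in> space N" for \<omega>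
  proof -
    have "F \<omega> \<in> borel_measurable borel"
      using measurable_compose[OF measurable_Pair1'[OF \<omega>] F] by simp
    then show ?thesis
      unfolding P_density[OF f'[OF \<omega>]]
      by (subst integral_density) (auto simp: p_nonneg[OF f'[OF \<omega>]] p_meas[OF f'[OF \<omega>]])
  qed
  have p1: "(\<lambda>z. p (f (fst z)) (snd z)) \<in> borel_measurable (N \<Otimes>\<^sub>M borel)"
    by (intro p_joint_compose measurable_compose[OF measurable_fst f] measurable_snd)
  have "(\<lambda>z. p (f (fst z)) (snd z) * F (fst z) (snd z)) \<in> borel_measurable (N \<Otimes>\<^sub>M borel)"
    by (intro borel_measurable_times p1 F)
  then have "(\<lambda>(\<omega>, x). p (f \<omega>) x * F \<omega> x) \<in> borel_measurable (N \<Otimes>\<^sub>M lborel)"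
    unfolding case_prod_beta' measurable_cong_sets[OF sets_pair_measure_cong[OF refl sets_lborel] refl] .
  then have "(\<lambda>\<omega>. \<integral>x. p (f \<omega>) x * F \<omega> x \<partial>lborel) \<in> borel_measurable N"
    by (rule lborel.borel_measurable_lebesgue_integral)
  then show ?thesis
    by (subst measurable_cong[OF eq])
qed

lemma kk_measurable: "(\<lambda>\<theta>. \<integral>z. k (fst z) (snd z) \<partial>(P \<theta> \<Otimes>\<^sub>M P \<theta>)) \<in> borel_measurable R\<Theta>"
proof -
  have eq: "(\<integral>z. k (fst z) (snd z) \<partial>(P \<theta> \<Otimes>\<^sub>M P \<theta>)) = (\<integral>x. (\<integral>y. k x y \<partial>P \<theta>) \<partial>P \<theta>)" if "\<theta> \<in> space R\<Theta>" for \<theta>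
  proof -
    have \<theta>: "\<theta> \<in> \<Theta>" using that by (simp add: space_restrict_space)
    interpret Q: prob_space "P \<theta>" by (rule P_prob[OF \<theta>])
    interpret QQ: pair_prob_space "P \<theta>" "P \<theta>" ..
    have sP[measurable_cong]: "sets (P \<theta>) = sets borel" by (rule sets_P[OF \<theta>])
    have "integrable (P \<theta> \<Otimes>\<^sub>M P \<theta>) (\<lambda>z. k (fst z) (snd z))"
      by (rule QQ.integrable_const_bound[where B=1]) (auto simp: k_bounded)
    from QQ.integral_fst'[OF this] show ?thesis by simp
  qed
  have 1: "(\<lambda>z. \<integral>y. k (snd z) y \<partial>P (fst z)) \<in> borel_measurable (R\<Theta> \<Otimes>\<^sub>M borel)"
    by (rule P_integral_measurable[where f=fst]) measurable
  have "(\<lambda>\<theta>. \<integral>x. (\<integral>y. k x y \<partial>P \<theta>) \<partial>P \<theta>) \<in> borel_measurable R\<Theta>"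
    by (rule P_integral_measurable[where f="\<lambda>\<theta>. \<theta>", OF _ measurable_ident_sets[OF refl]]) (rule 1)
  then show ?thesis by (subst measurable_cong[OF eq])
qed

lemma crit_measurable: "crit k P n xs \<in> borel_measurable R\<Theta>"
proof -
  have "(\<lambda>\<theta>. \<integral>y. k (xs i) y \<partial>P \<theta>) \<in> borel_measurable R\<Theta>" for i
    by (rule P_integral_measurable[where f="\<lambda>\<theta>. \<theta>", OF _ measurable_ident_sets[OF refl]]) measurable
  then have "(\<lambda>\<theta>. (\<integral>z. k (fst z) (snd z) \<partial>(P \<theta> \<Otimes>\<^sub>M P \<theta>)) - 2 / real n * (\<Sum>i=1..n. \<integral>y. k (xs i) y \<partial>P \<theta>))
      \<in> borel_measurable R\<Theta>"
    by (intro borel_measurable_diff borel_measurable_times borel_measurable_const borel_measurable_sum kk_measurable)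
  then show ?thesis by (simp add: crit_def[abs_def])
qed

text \<open>The Hilbert space may be nonseparable, so measurability is obtained from the real
  integrals in the expansion of the squared distance.\<close>

lemma mmd_measurable:
  assumes Q: "is_law Q"
  shows "(\<lambda>\<theta>. mmd fn k (P \<theta>) Q) \<in> borel_measurable R\<Theta>"
proof -
  let ?\<mu> = "mean_embedding fn k Q"
  have eq: "mmd fn k (P \<theta>) Q = sqrt ((\<integral>z. k (fst z) (snd z) \<partial>(P \<theta> \<Otimes>\<^sub>M P \<theta>)) - 2 * (\<integral>x. K x \<bullet> ?\<mu> \<partial>P \<theta>) + ?\<mu> \<bullet> ?\<mu>)"
    if "\<theta> \<in> space R\<Theta>" for \<theta>
  proof -
    have \<theta>: "\<theta> \<in> \<Theta>" using that by (simp add: space_restrict_space)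
    have "(mmd fn k (P \<theta>) Q)\<^sup>2 = (\<integral>z. k (fst z) (snd z) \<partial>(P \<theta> \<Otimes>\<^sub>M P \<theta>)) - 2 * (\<integral>x. K x \<bullet> ?\<mu> \<partial>P \<theta>) + ?\<mu> \<bullet> ?\<mu>"
      by (simp only: mmd_power2 mean_embedding_inner[OF law_P[OF \<theta>] law_P[OF \<theta>]] mean_embedding[OF law_P[OF \<theta>], of ?\<mu>])
    from real_sqrt_unique[OF this mmd_nonneg] show ?thesis by simp
  qed
  have "(\<lambda>\<theta>. \<integral>x. K x \<bullet> ?\<mu> \<partial>P \<theta>) \<in> borel_measurable R\<Theta>"
    by (rule P_integral_measurable[where f="\<lambda>\<theta>. \<theta>", OF _ measurable_ident_sets[OF refl]]) measurable
  then have "(\<lambda>\<theta>. sqrt ((\<integral>z. k (fst z) (snd z) \<partial>(P \<theta> \<Otimes>\<^sub>M P \<theta>)) - 2 * (\<integral>x. K x \<bullet> ?\<mu> \<partial>P \<theta>) + ?\<mu> \<bullet> ?\<mu>))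
      \<in> borel_measurable R\<Theta>"
    by (intro measurable_compose[OF _ borel_measurable_sqrt] borel_measurable_add borel_measurable_diff borel_measurable_times borel_measurable_const kk_measurable)
  then show ?thesis by (subst measurable_cong[OF eq])
qed

text \<open>The criterion is a squared distance, at most 4, minus a squared norm, at most 1.
  Boundedness settles integrability along the trajectory.\<close>

lemma crit_bound:
  assumes \<theta>: "\<theta> \<in> \<Theta>"
  shows "\<bar>crit k P n xs \<theta>\<bar> \<le> 5"
proof -
  let ?e = "empirical n xs"
  have 1: "(mmd fn k (P \<theta>) ?e)\<^sup>2 \<le> 2\<^sup>2"
    by (intro power_mono mmd_le_2 law_P[OF \<theta>] is_law_empirical[OF n] mmd_nonneg)
  have 2: "(norm (mean_embedding fn k ?e))\<^sup>2 \<le> 1\<^sup>2"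
    by (intro power_mono norm_mean_embedding_le is_law_empirical[OF n]) auto
  have "crit k P n xs \<theta> = (mmd fn k (P \<theta>) ?e)\<^sup>2 - (norm (mean_embedding fn k ?e))\<^sup>2"
    using mmd_empirical_crit[where P=P and \<theta>=\<theta> and x=xs, OF n law_P[OF \<theta>]] by simp
  moreover have "\<bar>x - y\<bar> \<le> 5" if "x \<le> 2\<^sup>2" "y \<le> 1\<^sup>2" "0 \<le> x" "0 \<le> y" for x y :: real
    using that by simp
  ultimately show ?thesis using 1 2 by simp
qed

lemma average_in: "w \<in> space W \<Longrightarrow> T \<ge> 1 \<Longrightarrow> average_iterate T w \<in> \<Theta>"
proof -
  assume w: "w \<in> space W" and T: "T \<ge> 1"
  have "(\<Sum>t=1..T. (1 / real T) *\<^sub>R w t) \<in> \<Theta>"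
    using w T by (intro convex_sum Theta) (auto simp: space_W)
  then show ?thesis by (simp add: average_iterate_def scaleR_sum_right)
qed

lemma average_measurable:
  assumes T: "T \<ge> 1"
  shows "average_iterate T \<in> measurable W R\<Theta>"
proof (rule measurable_restrict_space2)
  have "(\<lambda>w. w t) \<in> borel_measurable W" for t
    using coord_measurable[of t] by (simp add: measurable_restrict_space2_iff)
  then show "average_iterate T \<in> borel_measurable W"
    unfolding average_iterate_def[abs_def]
    by (intro borel_measurable_scaleR borel_measurable_const borel_measurable_sum)
qed (use average_in[OF _ T] in auto)

text \<open>Conditioning on the path up to time t. Boundedness of F is what exchanging bind and
  integral asks for.\<close>

lemma sgd_integral_Suc:
  fixes F :: "(nat \<Rightarrow> 'a) \<Rightarrow> real"
  assumes \<theta>0: "\<theta>0 \<in> \<Theta>" and F: "F \<in> borel_measurable W" "\<And>w. w \<in> space W \<Longrightarrow> \<bar>F w\<bar> \<le> c"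
  shows "(\<integral>w. F w \<partial>SGD \<eta> \<theta>0 xs (Suc t)) =
    (\<integral>w. (\<integral>y. F (step (\<eta> (Suc t)) t xs w y) \<partial>iid M (P (w t))) \<partial>SGD \<eta> \<theta>0 xs t)"
proof -
  let ?S = "SGD \<eta> \<theta>0 xs t"
  interpret S: prob_space ?S by (rule sgd_space(1)[OF \<theta>0])
  have st: "(\<lambda>z. step (\<eta> (Suc t)) t xs (fst z) (snd z)) \<in> measurable (W \<Otimes>\<^sub>M Y\<^sub>M) W"
  proof -
    have 1: "(\<lambda>(\<omega>, y). step (\<eta> (Suc t)) t xs (snd \<omega>) y) \<in> measurable ((count_space (UNIV::unit set) \<Otimes>\<^sub>M W) \<Otimes>\<^sub>M Y\<^sub>M) W"
      by (rule step_measurable) simp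
    have 2: "(\<lambda>z. (((), fst z), snd z)) \<in> measurable (W \<Otimes>\<^sub>M Y\<^sub>M) ((count_space (UNIV::unit set) \<Otimes>\<^sub>M W) \<Otimes>\<^sub>M Y\<^sub>M)"
      by (intro measurable_Pair measurable_const measurable_fst measurable_snd) simp
    show ?thesis using measurable_compose[OF 2 1] by simp
  qed
  let ?\<kappa> = "\<lambda>w. distr (iid M (P (w t))) W (step (\<eta> (Suc t)) t xs w)"
  have \<kappa>: "?\<kappa> \<in> measurable W (prob_algebra W)"
  proof (rule measurable_distr_prob_space2)
    show "(\<lambda>w. iid M (P (w t))) \<in> measurable W (prob_algebra Y\<^sub>M)"
      by (intro measurable_compose[OF _ iid_kernel] coord_measurable)
    show "(\<lambda>(w, y). step (\<eta> (Suc t)) t xs w y) \<in> measurable (W \<Otimes>\<^sub>M Y\<^sub>M) W"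
      using st by (simp add: case_prod_beta')
  qed
  have \<kappa>': "?\<kappa> \<in> measurable ?S (subprob_algebra W)"
    using measurable_prob_algebraD[OF \<kappa>] by (simp add: measurable_cong_sets[OF sgd_space(2)[OF \<theta>0] refl])
  have "(\<integral>w. F w \<partial>SGD \<eta> \<theta>0 xs (Suc t)) = (\<integral>w. F w \<partial>(?S \<bind> ?\<kappa>))"
    by (simp add: step_def[abs_def])
  also have "\<dots> = (\<integral>w. (\<integral>v. F v \<partial>?\<kappa> w) \<partial>?S)"
  proof (rule integral_bind[where K=W and B'=1 and B=c])
    show "F \<in> borel_measurable W" "?\<kappa> \<in> measurable ?S (subprob_algebra W)" "finite_measure ?S"
      by (rule F(1) \<kappa>' S.finite_measure_axioms)+
    show "\<bar>F w\<bar> \<le> c" if "w \<in> space W" for w using that by (rule F(2))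
    show "AE x in ?S. emeasure (?\<kappa> x) (space (?\<kappa> x)) \<le> ennreal 1"
    proof (rule AE_I2)
      fix x assume "x \<in> space ?S"
      then have "?\<kappa> x \<in> space (prob_algebra W)"
        by (intro measurable_space[OF \<kappa>]) (simp add: sgd_space(3)[OF \<theta>0])
      then have "prob_space (?\<kappa> x)" by (simp add: space_prob_algebra)
      then show "emeasure (?\<kappa> x) (space (?\<kappa> x)) \<le> ennreal 1" by (simp only: prob_space.emeasure_space_1 ennreal_1 order_refl)
    qed
  qed
  also have "\<dots> = (\<integral>w. (\<integral>y. F (step (\<eta> (Suc t)) t xs w y) \<partial>iid M (P (w t))) \<partial>?S)"
  proof (intro Bochner_Integration.integral_cong refl integral_distr F(1))
    fix w assume "w \<in> space ?S"
    then have w: "w \<in> space W" by (simp add: sgd_space(3)[OF \<theta>0])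
    then have wt: "w t \<in> \<Theta>" by (auto simp: space_W)
    have "step (\<eta> (Suc t)) t xs w \<in> measurable Y\<^sub>M W"
      using measurable_compose[OF measurable_Pair1'[OF w] st] by simp
    then show "step (\<eta> (Suc t)) t xs w \<in> measurable (iid M (P (w t))) W"
      by (simp add: measurable_cong_sets[OF sets_iid[OF wt] refl])
  qed
  finally show ?thesis .
qed

text \<open>Later steps write only later entries, so entry i keeps the distribution it had at time
  i. Hence the law at the final time serves all iterates at once.\<close>

lemma sgd_integral_coord:
  fixes f :: "'a \<Rightarrow> real"
  assumes \<theta>0: "\<theta>0 \<in> \<Theta>" and f: "f \<in> borel_measurable R\<Theta>" "\<And>\<theta>. \<theta> \<in> \<Theta> \<Longrightarrow> \<bar>f \<theta>\<bar> \<le> c"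
  shows "i \<le> t \<Longrightarrow> (\<integral>w. f (w i) \<partial>SGD \<eta> \<theta>0 xs t) = (\<integral>w. f (w i) \<partial>SGD \<eta> \<theta>0 xs i)"
proof (induction t rule: dec_induct)
  case (step t)
  let ?S = "SGD \<eta> \<theta>0 xs t"
  have m: "(\<lambda>w. f (w i)) \<in> borel_measurable W" by (rule measurable_compose[OF coord_measurable f(1)])
  have "(\<integral>w. f (w i) \<partial>SGD \<eta> \<theta>0 xs (Suc t)) =
      (\<integral>w. (\<integral>y. f (step (\<eta> (Suc t)) t xs w y i) \<partial>iid M (P (w t))) \<partial>?S)"
    using f(2) by (intro sgd_integral_Suc[OF \<theta>0 m]) (auto simp: space_W)
  also have "\<dots> = (\<integral>w. f (w i) \<partial>?S)"
  proof (intro Bochner_Integration.integral_cong refl)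
    fix w assume "w \<in> space ?S"
    then have "w t \<in> \<Theta>" by (auto simp: sgd_space(3)[OF \<theta>0] space_W)
    then interpret Y: prob_space "iid M (P (w t))" by (rule prob_iid)
    have "step (\<eta> (Suc t)) t xs w y i = w i" for y using step.hyps by (simp add: step_def)
    then show "(\<integral>y. f (step (\<eta> (Suc t)) t xs w y i) \<partial>iid M (P (w t))) = f (w i)"
      by (simp add: Y.prob_space)
  qed
  finally show ?case using step.IH by simp
qed simp

end

section \<open>Descent and averaging for a fixed sample\<close>

locale sgd_sample = sgd_model k fn \<Theta> P p n M
  for k :: "'x::euclidean_space \<Rightarrow> 'x \<Rightarrow> real" and fn :: "'h::{real_inner,complete_space} \<Rightarrow> 'x \<Rightarrow> real"
    and \<Theta> :: "'a::euclidean_space set" and P p n M +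
  fixes xs :: "nat \<Rightarrow> 'x" and B :: real and \<theta>0 :: 'a
  assumes B_pos: "B > 0" and start: "\<theta>0 \<in> \<Theta>"
    and second_moment: "\<And>\<theta>. \<theta> \<in> \<Theta> \<Longrightarrow>
      (\<integral>\<^sup>+y. ennreal ((norm (ghat xs \<theta> y))\<^sup>2) \<partial>iid M (P \<theta>)) \<le> ennreal (B\<^sup>2)"
    and convex: "convex_on \<Theta> (crit k P n xs)"
    and subgradient: "\<And>a b. a \<in> \<Theta> \<Longrightarrow> b \<in> \<Theta> \<Longrightarrow>
      (\<integral>y. ghat xs a y \<bullet> (b - a) \<partial>iid M (P a)) \<le> crit k P n xs b - crit k P n xs a"
begin

abbreviation "f \<equiv> crit k P n xs"
abbreviation "diam \<equiv> diameter \<Theta>"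

lemma dist_le_diam: "a \<in> \<Theta> \<Longrightarrow> b \<in> \<Theta> \<Longrightarrow> norm (a - b) \<le> diam"
  using diameter_bounded_bound[OF Theta(3), of a b] by (simp add: dist_norm)

lemma diam_nonneg: "0 \<le> diam" by (rule diameter_ge_0[OF Theta(3)])

text \<open>Projection does not increase the distance to a point of \<Theta>. In the expanded square
  the cross term is bounded by the subgradient inequality, the last one by the second
  moment.\<close>

lemma one_step:
  assumes \<theta>: "\<theta> \<in> \<Theta>" "\<theta>' \<in> \<Theta>" and \<eta>: "0 \<le> \<eta>"
  shows "(\<integral>y. (norm (closest_point \<Theta> (\<theta> - \<eta> *\<^sub>R ghat xs \<theta> y) - \<theta>'))\<^sup>2 \<partial>iid M (P \<theta>)) \<le>
    (norm (\<theta> - \<theta>'))\<^sup>2 - 2 * \<eta> * (f \<theta> - f \<theta>') + \<eta>\<^sup>2 * B\<^sup>2"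
proof -
  let ?Y = "iid M (P \<theta>)" and ?g = "ghat xs \<theta>"
  interpret Y: prob_space ?Y by (rule prob_iid[OF \<theta>(1)])
  have gY: "?g \<in> borel_measurable Y\<^sub>M"
    by (rule stoch_grad_measurable) (use \<theta> in \<open>auto simp: space_restrict_space\<close>)
  then have g[measurable]: "?g \<in> borel_measurable ?Y"
    by (simp add: measurable_cong_sets[OF sets_iid[OF \<theta>(1)] refl])
  have i2: "integrable ?Y (\<lambda>y. (norm (?g y))\<^sup>2)"
    using second_moment[OF \<theta>(1)] by (intro integrableI_bounded) (auto intro: le_less_trans)
  have e2: "(\<integral>y. (norm (?g y))\<^sup>2 \<partial>?Y) \<le> B\<^sup>2"
    using second_moment[OF \<theta>(1)] by (subst integral_eq_nn_integral) (auto intro!: enn2real_leI)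
  have i1: "integrable ?Y (\<lambda>y. ?g y \<bullet> v)" for v
  proof (rule Bochner_Integration.integrable_bound)
    show "integrable ?Y (\<lambda>y. (norm (?g y))\<^sup>2 + (norm v)\<^sup>2)" using i2 by simp
    show "AE y in ?Y. norm (?g y \<bullet> v) \<le> norm ((norm (?g y))\<^sup>2 + (norm v)\<^sup>2)"
    proof (rule AE_I2)
      fix y
      have "\<bar>?g y \<bullet> v\<bar> \<le> norm (?g y) * norm v" by (rule Cauchy_Schwarz_ineq2)
      moreover have "2 * (norm (?g y) * norm v) \<le> (norm (?g y))\<^sup>2 + (norm v)\<^sup>2"
        using sum_squares_bound[of "norm (?g y)" "norm v"] by simp
      moreover have "0 \<le> norm (?g y) * norm v" by simp
      ultimately have "\<bar>?g y \<bullet> v\<bar> \<le> (norm (?g y))\<^sup>2 + (norm v)\<^sup>2" by linarith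
      then show "norm (?g y \<bullet> v) \<le> norm ((norm (?g y))\<^sup>2 + (norm v)\<^sup>2)" by simp
    qed
  qed measurable
  let ?q = "\<lambda>y. (norm (\<theta> - \<theta>'))\<^sup>2 + 2 * \<eta> * (?g y \<bullet> (\<theta>' - \<theta>)) + \<eta>\<^sup>2 * (norm (?g y))\<^sup>2"
  have iq: "integrable ?Y ?q" using i1 i2 by simp
  have le: "(norm (closest_point \<Theta> (\<theta> - \<eta> *\<^sub>R ?g y) - \<theta>'))\<^sup>2 \<le> ?q y" for y
  proof -
    have "norm (closest_point \<Theta> (\<theta> - \<eta> *\<^sub>R ?g y) - \<theta>') \<le> norm ((\<theta> - \<eta> *\<^sub>R ?g y) - \<theta>')"
      using closest_point_lipschitz[OF Theta(2,1,4), of "\<theta> - \<eta> *\<^sub>R ?g y" \<theta>'] closest_point_self[OF \<theta>(2)]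
      by (simp add: dist_norm)
    then have "(norm (closest_point \<Theta> (\<theta> - \<eta> *\<^sub>R ?g y) - \<theta>'))\<^sup>2 \<le> (norm ((\<theta> - \<theta>') - \<eta> *\<^sub>R ?g y))\<^sup>2"
      by (intro power_mono) (auto simp: algebra_simps)
    also have "\<dots> = ?q y"
      unfolding power2_norm_eq_inner by (simp add: inner_simps inner_commute power2_eq_square algebra_simps)
    finally show ?thesis .
  qed
  \<comment> \<open>Nonnegativity of the majorant stands in for integrability of the left
    side.\<close>
  have "(\<integral>y. (norm (closest_point \<Theta> (\<theta> - \<eta> *\<^sub>R ?g y) - \<theta>'))\<^sup>2 \<partial>?Y) \<le> (\<integral>y. ?q y \<partial>?Y)"
    by (rule integral_mono'[OF iq le order_trans[OF zero_le_power2 le]])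
  also have "\<dots> = (norm (\<theta> - \<theta>'))\<^sup>2 + 2 * \<eta> * (\<integral>y. ?g y \<bullet> (\<theta>' - \<theta>) \<partial>?Y) + \<eta>\<^sup>2 * (\<integral>y. (norm (?g y))\<^sup>2 \<partial>?Y)"
    using i1 i2 by (simp add: Y.prob_space)
  also have "\<dots> \<le> (norm (\<theta> - \<theta>'))\<^sup>2 + 2 * \<eta> * (f \<theta>' - f \<theta>) + \<eta>\<^sup>2 * B\<^sup>2"
    using \<eta> e2 subgradient[OF \<theta>] by (intro add_mono mult_left_mono order_refl) auto
  finally show ?thesis by (simp add: algebra_simps)
qed

text \<open>The average starts at time \<open>1\<close>, so the one-step inequality is also used once beyond time \<open>T\<close>.\<close>

lemma regret:
  assumes T: "T \<ge> 1" and \<theta>': "\<theta>' \<in> \<Theta>" and \<eta>: "0 \<le> \<eta>"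
  shows "2 * \<eta> * (\<Sum>t=1..T. (\<integral>w. f (w t) \<partial>SGD (\<lambda>_. \<eta>) \<theta>0 xs T) - f \<theta>') \<le> diam\<^sup>2 + real T * \<eta>\<^sup>2 * B\<^sup>2"
proof -
  let ?S = "SGD (\<lambda>_. \<eta>) \<theta>0 xs"
  let ?N = "\<lambda>\<theta>. (norm (\<theta> - \<theta>'))\<^sup>2"
  define e where "e t = (\<integral>w. ?N (w t) \<partial>?S t)" for t
  define c where "c t = (\<integral>w. f (w t) \<partial>?S t)" for t
  have Nm: "?N \<in> borel_measurable R\<Theta>" by (intro measurable_restrict_space1) measurable
  have Nb: "\<bar>?N \<theta>\<bar> \<le> diam\<^sup>2" if "\<theta> \<in> \<Theta>" for \<theta>
    using dist_le_diam[OF that \<theta>'] by (simp add: power_mono)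
  have int: "integrable (?S t) (\<lambda>w. F (w i))"
    if F: "F \<in> borel_measurable R\<Theta>" "\<And>\<theta>. \<theta> \<in> \<Theta> \<Longrightarrow> \<bar>F \<theta>\<bar> \<le> C" for F :: "'a \<Rightarrow> real" and C t i
  proof -
    interpret S: prob_space "?S t" by (rule sgd_space(1)[OF start])
    show ?thesis
    proof (rule S.integrable_const_bound[where B=C])
      show "AE w in ?S t. norm (F (w i)) \<le> C"
        by (rule AE_I2) (auto simp: sgd_space(3)[OF start] space_W intro!: F(2))
      show "(\<lambda>w. F (w i)) \<in> borel_measurable (?S t)"
        unfolding measurable_cong_sets[OF sgd_space(2)[OF start] refl]
        by (rule measurable_compose[OF coord_measurable F(1)])
    qed
  qed
  have e0: "0 \<le> e t" for t unfolding e_def by (intro Bochner_Integration.integral_nonneg) auto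
  have e_le: "e t \<le> diam\<^sup>2" for t
  proof -
    interpret S: prob_space "?S t" by (rule sgd_space(1)[OF start])
    have "e t \<le> (\<integral>w. diam\<^sup>2 \<partial>?S t)"
      unfolding e_def using Nb
      by (intro integral_mono int[OF Nm Nb]) (auto simp: sgd_space(3)[OF start] space_W)
    then show ?thesis by (simp add: S.prob_space)
  qed
  have rec: "e (Suc t) \<le> e t - 2 * \<eta> * (c t - f \<theta>') + \<eta>\<^sup>2 * B\<^sup>2" for t
  proof -
    interpret S: prob_space "?S t" by (rule sgd_space(1)[OF start])
    have Nm': "(\<lambda>w. ?N (w (Suc t))) \<in> borel_measurable W"
      by (rule measurable_compose[OF coord_measurable Nm])
    have "e (Suc t) = (\<integral>w. (\<integral>y. ?N (step \<eta> t xs w y (Suc t)) \<partial>iid M (P (w t))) \<partial>?S t)"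
      unfolding e_def using Nb by (intro sgd_integral_Suc[OF start Nm']) (auto simp: space_W)
    also have "\<dots> \<le> (\<integral>w. ?N (w t) - 2 * \<eta> * (f (w t) - f \<theta>') + \<eta>\<^sup>2 * B\<^sup>2 \<partial>?S t)"
    proof (rule integral_mono')
      show "integrable (?S t) (\<lambda>w. ?N (w t) - 2 * \<eta> * (f (w t) - f \<theta>') + \<eta>\<^sup>2 * B\<^sup>2)"
        using int[OF Nm Nb] int[OF crit_measurable crit_bound] by simp
      fix w assume "w \<in> space (?S t)"
      then have wt: "w t \<in> \<Theta>" by (auto simp: sgd_space(3)[OF start] space_W)
      show le: "(\<integral>y. ?N (step \<eta> t xs w y (Suc t)) \<partial>iid M (P (w t))) \<le> ?N (w t) - 2 * \<eta> * (f (w t) - f \<theta>') + \<eta>\<^sup>2 * B\<^sup>2"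
        using one_step[OF wt \<theta>' \<eta>] by (simp add: step_def)
      have "0 \<le> (\<integral>y. ?N (step \<eta> t xs w y (Suc t)) \<partial>iid M (P (w t)))"
        by (intro Bochner_Integration.integral_nonneg) auto
      then show "0 \<le> ?N (w t) - 2 * \<eta> * (f (w t) - f \<theta>') + \<eta>\<^sup>2 * B\<^sup>2" using le by linarith
    qed
    also have "\<dots> = e t - 2 * \<eta> * (c t - f \<theta>') + \<eta>\<^sup>2 * B\<^sup>2"
      unfolding e_def c_def using int[OF Nm Nb] int[OF crit_measurable crit_bound] by (simp add: S.prob_space)
    finally show ?thesis .
  qed
  \<comment> \<open>The initial value is e 1, bounded by diam^2 like every e t; the final value e (T
    + 1) is dropped below as nonnegative.\<close>
  have sum: "e (Suc j) + 2 * \<eta> * (\<Sum>t=1..j. c t - f \<theta>') \<le> diam\<^sup>2 + real j * \<eta>\<^sup>2 * B\<^sup>2" for j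
  proof (induction j)
    case 0
    then show ?case using e_le[of 1] by simp
  next
    case (Suc j)
    then show ?case using rec[of "Suc j"] by (simp add: algebra_simps)
  qed
  have "c t = (\<integral>w. f (w t) \<partial>?S T)" if "t \<in> {1..T}" for t
    unfolding c_def using that by (intro sgd_integral_coord[OF start crit_measurable crit_bound, symmetric]) auto
  then have "(\<Sum>t=1..T. c t - f \<theta>') = (\<Sum>t=1..T. (\<integral>w. f (w t) \<partial>?S T) - f \<theta>')"
    by (intro sum.cong) auto
  then show ?thesis using sum[of T] e0[of "Suc T"] by simp
qed

lemma f_average_integrable:
  assumes T: "T \<ge> 1"
  shows "integrable (SGD \<eta> \<theta>0 xs t) (\<lambda>w. f (average_iterate T w))"
proof -
  interpret S: prob_space "SGD \<eta> \<theta>0 xs t" by (rule sgd_space(1)[OF start])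
  show ?thesis
  proof (rule S.integrable_const_bound[where B=5])
    show "AE w in SGD \<eta> \<theta>0 xs t. norm (f (average_iterate T w)) \<le> 5"
      by (rule AE_I2) (auto simp: sgd_space(3)[OF start] intro!: crit_bound average_in[OF _ T])
    show "(\<lambda>w. f (average_iterate T w)) \<in> borel_measurable (SGD \<eta> \<theta>0 xs t)"
      unfolding measurable_cong_sets[OF sgd_space(2)[OF start] refl]
      by (rule measurable_compose[OF average_measurable[OF T] crit_measurable])
  qed
qed

text \<open>The step size equates the two terms of the regret bound, T \<eta>^2 B^2 = diam^2. The
  mean regret is then at most diam^2 / (\<eta> T) = diam B / sqrt T, and convexity moves the average
  over t inside the criterion.\<close>

theorem expected_excess:
  assumes T: "T \<ge> 1" and \<theta>': "\<theta>' \<in> \<Theta>"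
  shows "has_expectation_le (SGD (\<lambda>_. diam / (B * sqrt (real T))) \<theta>0 xs T)
    (\<lambda>w. f (average_iterate T w) - f \<theta>') (diam * B / sqrt (real T))"
proof -
  define \<eta> where "\<eta> = diam / (B * sqrt (real T))"
  let ?S = "SGD (\<lambda>_. \<eta>) \<theta>0 xs T"
  interpret S: prob_space ?S by (rule sgd_space(1)[OF start])
  note ia = f_average_integrable[OF T, of "\<lambda>_. \<eta>" T]
  have T0: "0 < real T" using T by simp
  have "(\<integral>w. f (average_iterate T w) - f \<theta>' \<partial>?S) \<le> diam * B / sqrt (real T)"
  \<comment> \<open>For diam = 0 the step size is 0 and the regret bound says nothing, but then
    \<Theta> is a single point.\<close>
  proof (cases "diam = 0")
    case True
    have "f (average_iterate T w) - f \<theta>' = 0" if "w \<in> space ?S" for w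
    proof -
      have "average_iterate T w \<in> \<Theta>" using that by (intro average_in T) (simp add: sgd_space(3)[OF start])
      then have "average_iterate T w = \<theta>'" using dist_le_diam[OF _ \<theta>'] True by fastforce
      then show ?thesis by simp
    qed
    then have "(\<integral>w. f (average_iterate T w) - f \<theta>' \<partial>?S) = (\<integral>w. 0 \<partial>?S)"
      by (intro Bochner_Integration.integral_cong) auto
    then show ?thesis using True by simp
  next
    case False
    then have D: "0 < diam" using diam_nonneg by simp
    have \<eta>: "0 < \<eta>" using D B_pos T0 by (simp add: \<eta>_def)
    have it: "integrable ?S (\<lambda>w. f (w t))" for t
    proof (rule S.integrable_const_bound[where B=5])
      show "AE w in ?S. norm (f (w t)) \<le> 5"
        by (rule AE_I2) (auto simp: sgd_space(3)[OF start] space_W intro!: crit_bound)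
      show "(\<lambda>w. f (w t)) \<in> borel_measurable ?S"
        unfolding measurable_cong_sets[OF sgd_space(2)[OF start] refl]
        by (rule measurable_compose[OF coord_measurable crit_measurable])
    qed
    have "(\<integral>w. f (average_iterate T w) \<partial>?S) \<le> (\<integral>w. (\<Sum>t=1..T. (1 / real T) * f (w t)) \<partial>?S)"
    proof (rule integral_mono[OF ia])
      show "integrable ?S (\<lambda>w. \<Sum>t=1..T. (1 / real T) * f (w t))"
        using it by (intro Bochner_Integration.integrable_sum integrable_mult_right)
      fix w assume "w \<in> space ?S"
      then have "w \<in> space W" by (simp add: sgd_space(3)[OF start])
      then have "f (\<Sum>t\<in>{1..T}. (1 / real T) *\<^sub>R w t) \<le> (\<Sum>t\<in>{1..T}. (1 / real T) * f (w t))"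
        using T by (intro convex_on_sum[OF _ _ convex]) (auto simp: space_W)
      then show "f (average_iterate T w) \<le> (\<Sum>t=1..T. (1 / real T) * f (w t))"
        by (simp add: average_iterate_def scaleR_sum_right)
    qed
    also have "\<dots> = (\<Sum>t=1..T. (1 / real T) * (\<integral>w. f (w t) \<partial>?S))"
      using it by (subst Bochner_Integration.integral_sum) auto
    also have "\<dots> = (1 / real T) * (\<Sum>t=1..T. (\<integral>w. f (w t) \<partial>?S) - f \<theta>') + f \<theta>'"
      using T0 by (simp add: sum_subtractf sum_distrib_left[symmetric] sum_divide_distrib[symmetric] diff_divide_distrib)
    finally have 1: "(\<integral>w. f (average_iterate T w) - f \<theta>' \<partial>?S) \<le> (1 / real T) * (\<Sum>t=1..T. (\<integral>w. f (w t) \<partial>?S) - f \<theta>')"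
      using ia by (simp add: S.prob_space)
    have "\<eta>\<^sup>2 * B\<^sup>2 * real T = diam\<^sup>2"
      using B_pos T0 by (simp add: \<eta>_def power_divide power_mult_distrib)
    then have "2 * \<eta> * (\<Sum>t=1..T. (\<integral>w. f (w t) \<partial>?S) - f \<theta>') \<le> 2 * diam\<^sup>2"
      using regret[OF T \<theta>', of \<eta>] \<eta> by (simp add: mult_ac)
    then have "(\<Sum>t=1..T. (\<integral>w. f (w t) \<partial>?S) - f \<theta>') \<le> diam\<^sup>2 / \<eta>"
      using \<eta> by (simp add: field_simps)
    also have "diam\<^sup>2 / \<eta> = diam * B * sqrt (real T)"
      using D B_pos T0 by (simp add: \<eta>_def power2_eq_square)
    finally have "(1 / real T) * (\<Sum>t=1..T. (\<integral>w. f (w t) \<partial>?S) - f \<theta>') \<le> (1 / real T) * (diam * B * sqrt (real T))"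
      using T0 by (intro mult_left_mono) auto
    also have "(1 / real T) * (diam * B * sqrt (real T)) = diam * B / sqrt (real T)"
    proof -
      have "(1 / real T) * (diam * B * sqrt (real T)) = diam * B * (sqrt (real T) / real T)" by simp
      also have "sqrt (real T) / real T = inverse (sqrt (real T))" by (intro sqrt_divide_self_eq) simp
      finally show ?thesis by (simp add: divide_inverse)
    qed
    finally show ?thesis using 1 by linarith
  qed
  moreover have "integrable ?S (\<lambda>w. f (average_iterate T w) - f \<theta>')"
    by (rule Bochner_Integration.integrable_diff[OF ia S.integrable_const])
  ultimately show ?thesis by (simp only: has_expectation_le_def \<eta>_def simp_thms)
qed

end

section \<open>Rates\<close>

context sgd_model
begin

lemma crit_subgradient_inequality:
  assumes "B \<ge> 0" "convex_on \<Theta> (crit k P n xs)" "a \<in> \<Theta>" "b \<in> \<Theta>"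
    and "\<And>\<theta>. \<theta> \<in> \<Theta> \<Longrightarrow>
      (\<integral>\<^sup>+y. ennreal ((norm (ghat xs \<theta> y))\<^sup>2) \<partial>iid M (P \<theta>)) \<le> ennreal (B\<^sup>2)"
  shows "(\<integral>y. ghat xs a y \<bullet> (b - a) \<partial>iid M (P a)) \<le> crit k P n xs b - crit k P n xs a"
proof -
  obtain g where g: "\<And>x x'. 0 \<le> g x x'" "integrable (lborel \<Otimes>\<^sub>M lborel) (\<lambda>(x, x'). g x x')"
    "\<And>\<theta> x x'. \<theta> \<in> \<Theta> \<Longrightarrow> norm (k x x' *\<^sub>R gradient_within (\<lambda>t. p t x * p t x') \<theta> \<Theta>) \<le> g x x'"
    using R unfolding regularity_conditions_def by blast
  interpret seg: sgd_segment k fn \<Theta> P p n M a b xs B g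
    by unfold_locales (fact assms g)+
  show ?thesis by (rule seg.crit_subgradient[OF assms(2)])
qed

end

section \<open>Random samples and the distance to the true law\<close>

locale sgd_process = sgd_model k fn \<Theta> P p n M
  for k :: "'x::euclidean_space \<Rightarrow> 'x \<Rightarrow> real" and fn :: "'h::{real_inner,complete_space} \<Rightarrow> 'x \<Rightarrow> real"
    and \<Theta> :: "'a::euclidean_space set" and P p n M +
  fixes \<Omega> :: "'o measure" and X :: "nat \<Rightarrow> 'o \<Rightarrow> 'x" and P0 :: "'x measure"
    and \<theta>hat :: "'o \<Rightarrow> 'a" and B :: real and \<theta>0 :: 'a
  assumes Omega: "prob_space \<Omega>" and stationary: "stationary_process \<Omega> X"
    and marginal: "\<And>t. distr \<Omega> borel (X t) = P0"
    and B_pos: "B > 0" and start: "\<theta>0 \<in> \<Theta>"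
    and minimizer: "\<And>\<omega>. \<omega> \<in> space \<Omega> \<Longrightarrow>
      is_arg_min (\<lambda>\<theta>. mmd fn k (P \<theta>) (empirical n (\<lambda>i. X i \<omega>))) (\<lambda>\<theta>. \<theta> \<in> \<Theta>) (\<theta>hat \<omega>)"
    and B: "\<And>\<omega> \<theta>. \<omega> \<in> space \<Omega> \<Longrightarrow> \<theta> \<in> \<Theta> \<Longrightarrow>
      (\<integral>\<^sup>+y. ennreal ((norm (ghat (\<lambda>i. X i \<omega>) \<theta> y))\<^sup>2) \<partial>iid M (P \<theta>)) \<le> ennreal (B\<^sup>2)"
    and crit_convex: "\<And>\<omega>. \<omega> \<in> space \<Omega> \<Longrightarrow> convex_on \<Theta> (crit k P n (\<lambda>i. X i \<omega>))"
begin

definition "traj T \<omega> = SGD (\<lambda>_. diameter \<Theta> / (B * sqrt (real T))) \<theta>0 (\<lambda>i. X i \<omega>) T"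
definition "c \<omega> = crit k P n (\<lambda>i. X i \<omega>)" for \<omega>
definition "emp \<omega> = empirical n (\<lambda>i. X i \<omega>)" for \<omega>
definition "best = (INF \<theta>\<in>\<Theta>. mmd fn k (P \<theta>) P0)"
text \<open>A bound for the mean squared distance between the empirical measure and P0.\<close>

definition "mixing = (1 + 2 * (\<Sum>t=1..n. rho fn k P0 \<Omega> X t)) / real n"

lemma \<theta>hat_in: "\<omega> \<in> space \<Omega> \<Longrightarrow> \<theta>hat \<omega> \<in> \<Theta>"
  using minimizer by (simp add: is_arg_min_def)

lemma \<theta>hat_le: "\<omega> \<in> space \<Omega> \<Longrightarrow> \<theta> \<in> \<Theta> \<Longrightarrow> mmd fn k (P (\<theta>hat \<omega>)) (emp \<omega>) \<le> mmd fn k (P \<theta>) (emp \<omega>)"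
  using minimizer[of \<omega>] unfolding is_arg_min_def emp_def by force

lemma X_meas[measurable]: "X t \<in> borel_measurable \<Omega>"
  using stationary by (simp add: stationary_process_def)

lemma law_P0: "is_law P0"
proof -
  interpret prob_space \<Omega> by (rule Omega)
  show ?thesis unfolding is_law_def marginal[of 0, symmetric] by (auto intro!: prob_space_distr)
qed

lemma sample: "\<omega> \<in> space \<Omega> \<Longrightarrow> sgd_sample k fn \<Theta> P p n M (\<lambda>i. X i \<omega>) B \<theta>0"
  by unfold_locales (auto intro!: crit_subgradient_inequality[of B] B_pos start B crit_convex less_imp_le[OF B_pos])

lemma excess:
  assumes "T \<ge> 1" "\<omega> \<in> space \<Omega>"
  shows "has_expectation_le (traj T \<omega>) (\<lambda>w. c \<omega> (average_iterate T w) - c \<omega> (\<theta>hat \<omega>)) (diameter \<Theta> * B / sqrt (real T))"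
  using sgd_sample.expected_excess[OF sample[OF assms(2)] assms(1) \<theta>hat_in[OF assms(2)]]
  by (simp add: traj_def c_def)

text \<open>Squared distances to the empirical measure differ by the excess of the criterion, which
  sqrt (x + y) \<le> sqrt x + sqrt y splits off. The distance between the empirical measure and P0
  is paid twice: once to compare the minimizer with any other parameter, once to return to
  P0.\<close>

lemma mmd_excess:
  assumes \<omega>: "\<omega> \<in> space \<Omega>" and \<theta>: "\<theta> \<in> \<Theta>"
  shows "0 \<le> c \<omega> \<theta> - c \<omega> (\<theta>hat \<omega>)"
    and "mmd fn k (P \<theta>) P0 \<le> best + 2 * mmd fn k (emp \<omega>) P0 + sqrt (c \<omega> \<theta> - c \<omega> (\<theta>hat \<omega>))"
proof -
  let ?e = "emp \<omega>"
  have sq: "(mmd fn k (P t) ?e)\<^sup>2 = c \<omega> t + (norm (mean_embedding fn k ?e))\<^sup>2" if "t \<in> \<Theta>" for t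
    unfolding c_def emp_def by (rule mmd_empirical_crit[where P=P and \<theta>=t, OF n law_P[OF that]])
  have "(mmd fn k (P (\<theta>hat \<omega>)) ?e)\<^sup>2 \<le> (mmd fn k (P \<theta>) ?e)\<^sup>2"
    by (intro power_mono \<theta>hat_le \<omega> \<theta> mmd_nonneg)
  then show nonneg: "0 \<le> c \<omega> \<theta> - c \<omega> (\<theta>hat \<omega>)"
    using sq[OF \<theta>] sq[OF \<theta>hat_in[OF \<omega>]] by simp
  have "(mmd fn k (P \<theta>) ?e)\<^sup>2 = (mmd fn k (P (\<theta>hat \<omega>)) ?e)\<^sup>2 + (c \<omega> \<theta> - c \<omega> (\<theta>hat \<omega>))"
    using sq[OF \<theta>] sq[OF \<theta>hat_in[OF \<omega>]] by simp
  from real_sqrt_unique[OF this mmd_nonneg]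
  have "mmd fn k (P \<theta>) ?e = sqrt ((mmd fn k (P (\<theta>hat \<omega>)) ?e)\<^sup>2 + (c \<omega> \<theta> - c \<omega> (\<theta>hat \<omega>)))" by simp
  also have "\<dots> \<le> sqrt ((mmd fn k (P (\<theta>hat \<omega>)) ?e)\<^sup>2) + sqrt (c \<omega> \<theta> - c \<omega> (\<theta>hat \<omega>))"
    using nonneg by (intro sqrt_add_le_add_sqrt) auto
  also have "sqrt ((mmd fn k (P (\<theta>hat \<omega>)) ?e)\<^sup>2) = mmd fn k (P (\<theta>hat \<omega>)) ?e"
    by (simp add: mmd_nonneg)
  finally have 1: "mmd fn k (P \<theta>) ?e \<le> mmd fn k (P (\<theta>hat \<omega>)) ?e + sqrt (c \<omega> \<theta> - c \<omega> (\<theta>hat \<omega>))" .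
  have "mmd fn k (P (\<theta>hat \<omega>)) ?e - mmd fn k ?e P0 \<le> best"
    unfolding best_def
  proof (rule cINF_greatest[OF Theta(4)])
    fix t assume t: "t \<in> \<Theta>"
    have "mmd fn k (P (\<theta>hat \<omega>)) ?e \<le> mmd fn k (P t) ?e" by (rule \<theta>hat_le[OF \<omega> t])
    also have "\<dots> \<le> mmd fn k (P t) P0 + mmd fn k P0 ?e" by (rule mmd_triangle)
    finally show "mmd fn k (P (\<theta>hat \<omega>)) ?e - mmd fn k ?e P0 \<le> mmd fn k (P t) P0"
      by (simp add: mmd_sym[of P0])
  qed
  then show "mmd fn k (P \<theta>) P0 \<le> best + 2 * mmd fn k ?e P0 + sqrt (c \<omega> \<theta> - c \<omega> (\<theta>hat \<omega>))"
    using 1 mmd_triangle[of "P \<theta>" P0 ?e] by simp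
qed

lemma best_nonneg: "0 \<le> best"
  unfolding best_def by (rule cINF_greatest[OF Theta(4) mmd_nonneg])

lemma mixing_nonneg: "0 \<le> mixing"
  unfolding mixing_def rho_def by (intro divide_nonneg_nonneg add_nonneg_nonneg mult_nonneg_nonneg sum_nonneg) auto

text \<open>The expectation over the draws is estimated for each sample separately, where
  \<theta>hat \<omega> is a constant, and the resulting majorant no longer contains it. This
  accommodates an arbitrary choice of minimizers as \<omega> varies.\<close>

lemma expected_mmd:
  assumes T: "T \<ge> 1"
  shows "has_expectation_le (\<Omega> \<bind> traj T) (\<lambda>w. mmd fn k (P (average_iterate T w)) P0)
    (best + 3 * sqrt mixing + sqrt (diameter \<Theta> * B / sqrt (real T)))"
proof -
  interpret \<Omega>: prob_space \<Omega> by (rule Omega)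
  let ?F = "\<lambda>w. mmd fn k (P (average_iterate T w)) P0"
  let ?r = "sqrt (diameter \<Theta> * B / sqrt (real T))"
  have tr: "traj T \<in> measurable \<Omega> (prob_algebra W)"
    unfolding traj_def[abs_def] by (rule sgd_kernel[OF X_meas start])
  have tr_sp: "prob_space (traj T \<omega>)" "sets (traj T \<omega>) = sets W" "space (traj T \<omega>) = space W" for \<omega>
    unfolding traj_def by (rule sgd_space[OF start])+
  have Fm: "?F \<in> borel_measurable W"
    by (rule measurable_compose[OF average_measurable[OF T] mmd_measurable[OF law_P0]])
  have Fb: "\<bar>?F w\<bar> \<le> 2" if "w \<in> space W" for w
    using mmd_le_2[OF law_P[OF average_in[OF that T]] law_P0] mmd_nonneg[of "P (average_iterate T w)" P0] by simp
  have kern: "AE \<omega> in \<Omega>. emeasure (traj T \<omega>) (space (traj T \<omega>)) \<le> ennreal 1"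
    by (rule AE_I2) (simp only: prob_space.emeasure_space_1[OF tr_sp(1)] ennreal_1 order_refl)
  note bind_args = Fm Fb measurable_prob_algebraD[OF tr] \<Omega>.finite_measure_axioms kern
  have int: "integrable (\<Omega> \<bind> traj T) ?F"
    by (rule integrable_bind[where K=W and B=2 and B'=1]) (fact bind_args)+
  have emp_int: "integrable \<Omega> (\<lambda>\<omega>. mmd fn k (emp \<omega>) P0)"
  proof (rule \<Omega>.integrable_const_bound[where B=2])
    show "AE \<omega> in \<Omega>. norm (mmd fn k (emp \<omega>) P0) \<le> 2"
      by (rule AE_I2) (use mmd_le_2[OF is_law_empirical[OF n] law_P0] mmd_nonneg in \<open>simp add: emp_def\<close>)
    show "(\<lambda>\<omega>. mmd fn k (emp \<omega>) P0) \<in> borel_measurable \<Omega>"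
      unfolding emp_def by (rule expected_mmd_empirical(1)[OF Omega stationary marginal n])
  qed
  have "(\<integral>w. ?F w \<partial>(\<Omega> \<bind> traj T)) = (\<integral>\<omega>. (\<integral>w. ?F w \<partial>traj T \<omega>) \<partial>\<Omega>)"
    by (rule integral_bind[where K=W and B=2 and B'=1]) (fact bind_args)+
  also have "\<dots> \<le> (\<integral>\<omega>. best + ?r + 2 * mmd fn k (emp \<omega>) P0 \<partial>\<Omega>)"
  proof (rule integral_mono')
    show "integrable \<Omega> (\<lambda>\<omega>. best + ?r + 2 * mmd fn k (emp \<omega>) P0)" using emp_int by simp
    fix \<omega> assume \<omega>: "\<omega> \<in> space \<Omega>"
    interpret S: prob_space "traj T \<omega>" by (rule tr_sp(1))
    let ?x = "\<lambda>w. c \<omega> (average_iterate T w) - c \<omega> (\<theta>hat \<omega>)"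
    have ex: "integrable (traj T \<omega>) ?x" "(\<integral>w. ?x w \<partial>traj T \<omega>) \<le> diameter \<Theta> * B / sqrt (real T)"
      using excess[OF T \<omega>] by (auto simp: has_expectation_le_def)
    have avg: "average_iterate T w \<in> \<Theta>" if "w \<in> space (traj T \<omega>)" for w
      using that T by (intro average_in) (simp_all add: tr_sp)
    have xb: "\<bar>sqrt (?x w)\<bar> \<le> sqrt 10" if "w \<in> space (traj T \<omega>)" for w
    proof -
      \<comment> \<open>Two values of the criterion, each at most 5 in absolute value.\<close>
      have "?x w \<le> 10"
        using crit_bound[OF avg[OF that], of "\<lambda>i. X i \<omega>"] crit_bound[OF \<theta>hat_in[OF \<omega>], of "\<lambda>i. X i \<omega>"]
        unfolding c_def by linarith
      then show ?thesis using mmd_excess(1)[OF \<omega> avg[OF that]] by simp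
    qed
    have xm: "(\<lambda>w. sqrt (?x w)) \<in> borel_measurable (traj T \<omega>)"
      using ex(1) by (intro measurable_compose[OF _ borel_measurable_sqrt]) simp
    have "(\<integral>w. sqrt (?x w) \<partial>traj T \<omega>)\<^sup>2 \<le> (\<integral>w. (sqrt (?x w))\<^sup>2 \<partial>traj T \<omega>)"
      by (rule power2_expectation_le[OF tr_sp(1) xm xb])
    also have "\<dots> = (\<integral>w. ?x w \<partial>traj T \<omega>)"
      using mmd_excess(1)[OF \<omega> avg] by (intro Bochner_Integration.integral_cong) auto
    finally have sq: "(\<integral>w. sqrt (?x w) \<partial>traj T \<omega>) \<le> ?r"
      using ex(2) by (intro real_le_rsqrt) simp
    have xi: "integrable (traj T \<omega>) (\<lambda>w. sqrt (?x w))"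
      using xb xm by (intro S.integrable_const_bound[where B="sqrt 10"]) auto
    have "(\<integral>w. ?F w \<partial>traj T \<omega>) \<le> (\<integral>w. best + 2 * mmd fn k (emp \<omega>) P0 + sqrt (?x w) \<partial>traj T \<omega>)"
    proof (rule integral_mono')
      show "integrable (traj T \<omega>) (\<lambda>w. best + 2 * mmd fn k (emp \<omega>) P0 + sqrt (?x w))"
        by (intro Bochner_Integration.integrable_add S.integrable_const xi)
      fix w assume w: "w \<in> space (traj T \<omega>)"
      show le: "?F w \<le> best + 2 * mmd fn k (emp \<omega>) P0 + sqrt (?x w)" by (rule mmd_excess(2)[OF \<omega> avg[OF w]])
      then show "0 \<le> best + 2 * mmd fn k (emp \<omega>) P0 + sqrt (?x w)" by (rule order_trans[OF mmd_nonneg])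
    qed
    also have "\<dots> = best + 2 * mmd fn k (emp \<omega>) P0 + (\<integral>w. sqrt (?x w) \<partial>traj T \<omega>)"
      by (subst Bochner_Integration.integral_add[OF S.integrable_const xi]) (simp add: S.prob_space)
    finally show "(\<integral>w. ?F w \<partial>traj T \<omega>) \<le> best + ?r + 2 * mmd fn k (emp \<omega>) P0"
      using sq by linarith
    have "0 \<le> ?r" using diameter_ge_0[OF Theta(3)] B_pos by simp
    then show "0 \<le> best + ?r + 2 * mmd fn k (emp \<omega>) P0" using best_nonneg mmd_nonneg[of "emp \<omega>" P0] by linarith
  qed
  also have "\<dots> = best + ?r + 2 * (\<integral>\<omega>. mmd fn k (emp \<omega>) P0 \<partial>\<Omega>)"
    using emp_int by (simp add: \<Omega>.prob_space)
  also have "\<dots> \<le> best + ?r + 2 * sqrt mixing"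
    using expected_mmd_empirical(2)[OF Omega stationary marginal n] unfolding emp_def mixing_def by simp
  \<comment> \<open>The two triangle inequalities produce the factor 2, which is relaxed to
    3.\<close>
  also have "\<dots> \<le> best + 3 * sqrt mixing + ?r"
    using mixing_nonneg by simp
  finally show ?thesis using int by (simp only: has_expectation_le_def simp_thms)
qed

end

theorem proposition5p2:
  fixes k :: "'x::euclidean_space \<Rightarrow> 'x \<Rightarrow> real"
    and fn :: "'h::{real_inner,complete_space} \<Rightarrow> 'x \<Rightarrow> real"
    and \<Omega> :: "'o measure"
    and X :: "nat \<Rightarrow> 'o \<Rightarrow> 'x"
    and P0 :: "'x measure"
    and \<Theta> :: "'a::euclidean_space set"
    and P :: "'a \<Rightarrow> 'x measure"
    and p :: "'a \<Rightarrow> 'x \<Rightarrow> real"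
    and \<theta>hat :: "'o \<Rightarrow> 'a"
    and \<theta>0 :: 'a
    and n M T :: nat
    and B :: real
  assumes k_measurable: "(\<lambda>(x, y). k x y) \<in> borel_measurable (borel \<Otimes>\<^sub>M borel)"
    and k_symmetric: "\<And>x y. k x y = k y x"
    and k_pos_def: "pos_def_kernel k"
    and k_bounded: "\<And>x y. \<bar>k x y\<bar> \<le> 1"
    and rkhs: "is_rkhs fn k"
    and k_characteristic: "characteristic fn k"
    and Omega: "prob_space \<Omega>"
    and stationary: "stationary_process \<Omega> X"
    and marginal: "\<And>t. distr \<Omega> borel (X t) = P0"
    and n: "n \<ge> 1" and M: "M \<ge> 2" and T: "T \<ge> 1"
    and Theta: "closed \<Theta>" "convex \<Theta>" "bounded \<Theta>"
    and P_prob: "\<And>\<theta>. \<theta> \<in> \<Theta> \<Longrightarrow> prob_space (P \<theta>)"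
    and R: "regularity_conditions \<Theta> k P p"
    and start: "\<theta>0 \<in> \<Theta>"
    and minimizer: "\<And>\<omega>. \<omega> \<in> space \<Omega> \<Longrightarrow>
      is_arg_min (\<lambda>\<theta>. mmd fn k (P \<theta>) (empirical n (\<lambda>i. X i \<omega>))) (\<lambda>\<theta>. \<theta> \<in> \<Theta>) (\<theta>hat \<omega>)"
    and B_pos: "B > 0"
    and B: "\<And>\<omega> \<theta>. \<omega> \<in> space \<Omega> \<Longrightarrow> \<theta> \<in> \<Theta> \<Longrightarrow>
      (\<integral>\<^sup>+y. ennreal ((norm (stoch_grad k \<Theta> p n M (\<lambda>i. X i \<omega>) \<theta> y))\<^sup>2) \<partial>iid M (P \<theta>)) \<le> ennreal (B\<^sup>2)"
    and crit_convex: "\<And>\<omega>. \<omega> \<in> space \<Omega> \<Longrightarrow> convex_on \<Theta> (crit k P n (\<lambda>i. X i \<omega>))"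
  shows
    "(\<forall>\<omega>\<in>space \<Omega>.
        has_expectation_le
          (sgd k \<Theta> P p n M (\<lambda>_. diameter \<Theta> / (B * sqrt (real T))) \<theta>0 (\<lambda>i. X i \<omega>) T)
          (\<lambda>w. crit k P n (\<lambda>i. X i \<omega>) (average_iterate T w) - crit k P n (\<lambda>i. X i \<omega>) (\<theta>hat \<omega>))
          (diameter \<Theta> * B / sqrt (real T))) \<and>
     has_expectation_le
       (\<Omega> \<bind> (\<lambda>\<omega>. sgd k \<Theta> P p n M (\<lambda>_. diameter \<Theta> / (B * sqrt (real T))) \<theta>0 (\<lambda>i. X i \<omega>) T))
       (\<lambda>w. mmd fn k (P (average_iterate T w)) P0)
       ((INF \<theta>\<in>\<Theta>. mmd fn k (P \<theta>) P0)
          + 3 * sqrt ((1 + 2 * (\<Sum>t=1..n. rho fn k P0 \<Omega> X t)) / real n)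
          + sqrt (diameter \<Theta> * B / sqrt (real T))) \<and>
     has_expectation_le
       (\<Omega> \<bind> (\<lambda>\<omega>. sgd k \<Theta> P p n M (\<lambda>_. diameter \<Theta> / (B * sqrt (real (n\<^sup>2)))) \<theta>0 (\<lambda>i. X i \<omega>) (n\<^sup>2)))
       (\<lambda>w. mmd fn k (P (average_iterate (n\<^sup>2) w)) P0)
       ((INF \<theta>\<in>\<Theta>. mmd fn k (P \<theta>) P0)
          + (sqrt (diameter \<Theta> * B) + 3 * sqrt (1 + 2 * (\<Sum>t=1..n. rho fn k P0 \<Omega> X t))) / sqrt (real n))"
proof -
  have model: "sgd_process k fn \<Theta> P p n M \<Omega> X P0 \<theta>hat B \<theta>0"
  proof (intro sgd_process.intro sgd_model.intro rkhs_kernel.intro sgd_model_axioms.intro sgd_process_axioms.intro)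
    show "\<Theta> \<noteq> {}" using start by blast
  qed (fact assms)+
  interpret sgd_process k fn \<Theta> P p n M \<Omega> X P0 \<theta>hat B \<theta>0 by (rule model)
  have n2: "1 \<le> n\<^sup>2" using n by simp
  have mix: "sqrt mixing = sqrt (1 + 2 * (\<Sum>t=1..n. rho fn k P0 \<Omega> X t)) / sqrt (real n)"
    unfolding mixing_def by (rule real_sqrt_divide)
  \<comment> \<open>T = n^2 makes the excess diam B / n, whose square root has the rate of the
    sampling error.\<close>
  have diam: "sqrt (diameter \<Theta> * B / sqrt (real (n\<^sup>2))) = sqrt (diameter \<Theta> * B) / sqrt (real n)"
    by (simp add: real_sqrt_divide)
  have rate: "best + 3 * sqrt mixing + sqrt (diameter \<Theta> * B / sqrt (real (n\<^sup>2))) =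
      best + (sqrt (diameter \<Theta> * B) + 3 * sqrt (1 + 2 * (\<Sum>t=1..n. rho fn k P0 \<Omega> X t))) / sqrt (real n)"
    unfolding mix diam by (simp only: add_divide_distrib times_divide_eq_right add.assoc add.commute[of "sqrt (diameter \<Theta> * B) / sqrt (real n)"])
  have 1: "\<forall>\<omega>\<in>space \<Omega>. has_expectation_le
      (sgd k \<Theta> P p n M (\<lambda>_. diameter \<Theta> / (B * sqrt (real T))) \<theta>0 (\<lambda>i. X i \<omega>) T)
      (\<lambda>w. crit k P n (\<lambda>i. X i \<omega>) (average_iterate T w) - crit k P n (\<lambda>i. X i \<omega>) (\<theta>hat \<omega>))
      (diameter \<Theta> * B / sqrt (real T))"
    using excess[OF T] by (simp add: traj_def c_def)
  show ?thesis
    using 1 expected_mmd[OF T] expected_mmd[OF n2] unfolding rate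
    unfolding traj_def[abs_def] best_def mixing_def by blast
qed

end
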